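(* Let $Q=[0,1]^{\mathbb{N}}$ be the Hilbert cube. The set of chains $c\in\mathcal{C}(Q)$ such that every $A\in c\setminus\{Q\}$ is a chainable, hereditarily indecomposable continuum (a point or a pseudo-arc) and a Z-set in $Q$ is a dense $G_\delta$ subset of $\mathcal{C}(Q)$.
   Context: For a compact space $Y$, $V(Y)$ denotes the space of non-empty compact subsets of $Y$ with the Vietoris topology, and $V^2(Y)=V(V(Y))$. A maximal chain of closed subsets of $Q$ is an element $c\in V^2(Q)$ whose members are linearly ordered by inclusion and which is maximal with this property (if $K\in V(Q)$ and $c\cup\{K\}$ is linearly ordered by inclusion, then $K\in c$). $\mathcal{C}(Q)\subseteq V^2(Q)$ is the space, with the inherited topology, of those maximal chains $c$ that are connected as subspaces of $V(Q)$; equivalently, each member of $c$ is connected. Fix a compatible metric $d$ on $Q$. A closed set $A\subseteq Q$ is a Z-set if for every $\varepsilon>0$ there is a continuous map $f\colon Q\to Q\setminus A$ with $d(f(x),x)<\varepsilon$ for all $x\in Q$. A continuum is a compact, connected (metrizable) space. An open cover $\{U_0,\dots,U_{n-1}\}$ of a continuum is a chain cover if for all $i,j<n$, $U_i\cap U_j\ne\emptyset \iff |i-j|\le 1$. A continuum is chainable if every open cover admits a refinement that is a chain cover. A continuum is indecomposable if it is not the union of two proper subcontinua, and hereditarily indecomposable if every subcontinuum is indecomposable. The pseudo-arc is the unique (up to homeomorphism) chainable, hereditarily indecomposable continuum having more than one point. *)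

theory Defs
  imports "HOL-Analysis.Analysis"
begin

definition hilbert_cube :: "(nat \<Rightarrow> real) topology" where
  "hilbert_cube = product_topology (\<lambda>_. top_of_set {0..1}) UNIV"

definition vietoris_points :: "'a topology \<Rightarrow> 'a set set" where
  "vietoris_points X = {K. compactin X K \<and> K \<noteq> {}}"

definition vietoris :: "'a topology \<Rightarrow> 'a set topology" where
  "vietoris X = topology_generated_by
     ({{K \<in> vietoris_points X. K \<subseteq> U} | U. openin X U} \<union>
      {{K \<in> vietoris_points X. K \<inter> U \<noteq> {}} | U. openin X U})"

lemma topspace_vietoris [simp]: "topspace (vietoris X) = vietoris_points X"
proof
  show "topspace (vietoris X) \<subseteq> vietoris_points X"
    unfolding vietoris_def topology_generated_by_topspace by auto
  show "vietoris_points X \<subseteq> topspace (vietoris X)"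
  proof
    fix K assume K: "K \<in> vietoris_points X"
    then have "K \<subseteq> topspace X"
      by (simp add: vietoris_points_def compactin_subset_topspace)
    with K have "K \<in> {K \<in> vietoris_points X. K \<subseteq> topspace X}"
      by simp
    moreover have "{K \<in> vietoris_points X. K \<subseteq> topspace X} \<in>
        {{K \<in> vietoris_points X. K \<subseteq> U} | U. openin X U}"
      by (rule CollectI, rule exI[of _ "topspace X"]) simp
    ultimately show "K \<in> topspace (vietoris X)"
      unfolding vietoris_def topology_generated_by_topspace
      by (meson UnI1 UnionI)
  qed
qed

definition maximal_closed_chain :: "'a topology \<Rightarrow> 'a set set \<Rightarrow> bool" where
  "maximal_closed_chain X c \<longleftrightarrow>
     c \<in> topspace (vietoris (vietoris X)) \<and> chain\<^sub>\<subseteq> c \<and>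
     (\<forall>K \<in> topspace (vietoris X). chain\<^sub>\<subseteq> (insert K c) \<longrightarrow> K \<in> c)"

text \<open>The space of connected maximal chains; connectedness is that of \<open>c\<close> as a
  subspace of \<open>vietoris X\<close>.\<close>

definition connected_chains :: "'a topology \<Rightarrow> 'a set set topology" where
  "connected_chains X = subtopology (vietoris (vietoris X))
     {c. maximal_closed_chain X c \<and> connectedin (vietoris X) c}"

definition Z_set :: "'a topology \<Rightarrow> ('a \<Rightarrow> 'a \<Rightarrow> real) \<Rightarrow> 'a set \<Rightarrow> bool" where
  "Z_set X d A \<longleftrightarrow> closedin X A \<and>
     (\<forall>\<epsilon>>0. \<exists>f. continuous_map X (subtopology X (topspace X - A)) f \<and>
                (\<forall>x \<in> topspace X. d (f x) x < \<epsilon>))"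

text \<open>The library's \<open>connected_space\<close> admits the empty space; continua are taken to be
  non-empty.\<close>

definition continuum :: "'a topology \<Rightarrow> bool" where
  "continuum X \<longleftrightarrow> topspace X \<noteq> {} \<and> compact_space X \<and> connected_space X \<and> metrizable_space X"

definition subcontinuum :: "'a topology \<Rightarrow> 'a set \<Rightarrow> bool" where
  "subcontinuum X K \<longleftrightarrow> K \<subseteq> topspace X \<and> continuum (subtopology X K)"

definition open_cover :: "'a topology \<Rightarrow> 'a set set \<Rightarrow> bool" where
  "open_cover X \<U> \<longleftrightarrow> (\<forall>U \<in> \<U>. openin X U) \<and> \<Union>\<U> = topspace X"

definition chain_cover :: "'a topology \<Rightarrow> nat \<Rightarrow> (nat \<Rightarrow> 'a set) \<Rightarrow> bool" where
  "chain_cover X n U \<longleftrightarrow> open_cover X (U ` {..<n}) \<and>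
     (\<forall>i<n. \<forall>j<n. U i \<inter> U j \<noteq> {} \<longleftrightarrow> \<bar>int i - int j\<bar> \<le> 1)"

definition chainable :: "'a topology \<Rightarrow> bool" where
  "chainable X \<longleftrightarrow>
     (\<forall>\<U>. open_cover X \<U> \<longrightarrow>
        (\<exists>n U. chain_cover X n U \<and> (\<forall>i<n. \<exists>V \<in> \<U>. U i \<subseteq> V)))"

definition indecomposable :: "'a topology \<Rightarrow> bool" where
  "indecomposable X \<longleftrightarrow>
     \<not> (\<exists>A B. subcontinuum X A \<and> subcontinuum X B \<and>
              A \<noteq> topspace X \<and> B \<noteq> topspace X \<and> A \<union> B = topspace X)"

definition hereditarily_indecomposable :: "'a topology \<Rightarrow> bool" where
  "hereditarily_indecomposable X \<longleftrightarrow>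
     (\<forall>K. subcontinuum X K \<longrightarrow> indecomposable (subtopology X K))"

end

theory Submission
  imports Defs
begin

text \<open>
  For compact Hausdorff \<open>X\<close>, the connected maximal chains are exactly the compact connected
  chains that contain \<open>X\<close> and some singleton, so they form a closed subspace of the compact space
  \<open>V\<^sup>2(X)\<close> and Baire's theorem applies. Chainability, hereditary indecomposability and being a
  Z-set are each countable conjunctions of Vietoris-open conditions on a continuum; requiring
  such a condition of every member of a chain that misses a given basic open set is again open.
  It remains to find, near each chain \<open>c\<close>, a chain whose members satisfy these conditions at a
  given scale. Induction along the connected set \<open>c\<close> yields a path \<open>\<gamma>\<close> whose initial
  segments \<open>\<gamma>[0,t]\<close> trace out \<open>c\<close>. Composing \<open>\<gamma>\<close> with a crooked map of the interval and changing two
  remote coordinates, one into the parameter and one into \<open>0\<close>, gives an arc \<open>h\<close> whose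
  initial segments are chainable, indecomposable at the scale in question, and can be avoided by a
  small move. The initial segments of \<open>h\<close>, followed by the sets
  \<open>(1 - s) h[0,1] + s Q\<close>, form the required chain.
\<close>

section \<open>The Vietoris topology\<close>

text \<open>The cube belongs to every chain but fails the conditions, so these cannot be asked of
  all members at once. Letting a member escape a condition by meeting a given ball exempts the cube,
  and also all sets close to it. This is why the tail of the approximating chain may be crude: the
  cube is a member of \<open>c\<close>, so some initial segment of \<open>h\<close> is already close
  to it, and so is everything above.

  The crooked map \<open>\<sigma>\<close> acts on the parameter and not on the cube, because it must
  not disturb the traces. It fixes 0 and 1 and maps each \<open>[0,t]\<close> onto some
  \<open>[0,s]\<close>, every \<open>s\<close> occurring, so
  \<open>\<gamma> \<circ> \<sigma>\<close> has the same initial traces as \<open>\<gamma>\<close>.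
  Uniform continuity of \<open>\<gamma>\<close> carries the crookedness into the cube.

  The coordinate holding the parameter makes \<open>h\<close> injective and its subcontinua visible
  as parameter intervals; crookedness then forbids two of them to cross. The coordinate held at 0
  can be pushed to 1, away from the whole arc. Both lie so far out that the metric hardly sees the
  change.\<close>

lemma vietoris_points_subset_topspace: "K \<in> vietoris_points X \<Longrightarrow> K \<subseteq> topspace X"
  by (simp add: vietoris_points_def compactin_subset_topspace)

lemma openin_vietoris_subset:
  "openin X U \<Longrightarrow> openin (vietoris X) {K \<in> vietoris_points X. K \<subseteq> U}"
  unfolding vietoris_def by (rule topology_generated_by_Basis) blast

lemma openin_vietoris_meets:
  "openin X U \<Longrightarrow> openin (vietoris X) {K \<in> vietoris_points X. K \<inter> U \<noteq> {}}"
  unfolding vietoris_def by (rule topology_generated_by_Basis) blast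

lemma closedin_vietoris_subset:
  assumes "closedin X C"
  shows "closedin (vietoris X) {K \<in> vietoris_points X. K \<subseteq> C}"
proof -
  have "{K \<in> vietoris_points X. K \<subseteq> C} =
      topspace (vietoris X) - {K \<in> vietoris_points X. K \<inter> (topspace X - C) \<noteq> {}}"
    by (auto dest: vietoris_points_subset_topspace)
  then show ?thesis
    using assms
    by (simp only: closedin_diff closedin_topspace openin_vietoris_meets openin_diff openin_topspace)
qed

lemma closedin_vietoris_meets:
  assumes "closedin X C"
  shows "closedin (vietoris X) {K \<in> vietoris_points X. K \<inter> C \<noteq> {}}"
proof -
  have "{K \<in> vietoris_points X. K \<inter> C \<noteq> {}} =
      topspace (vietoris X) - {K \<in> vietoris_points X. K \<subseteq> topspace X - C}"
    by (auto dest: vietoris_points_subset_topspace)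
  then show ?thesis
    using assms
    by (simp only: closedin_diff closedin_topspace openin_vietoris_subset openin_diff openin_topspace)
qed

text \<open>A point of \<open>A\<close> outside \<open>B\<close> and the compact set
  \<open>B\<close> have disjoint open neighbourhoods; meeting the one and lying inside the other
  both persist nearby. This openness of non-inclusion is behind the Hausdorff property, the
  closedness of the set of chains and the closed graph of inclusion.\<close>

lemma vietoris_not_subset_separation:
  assumes "Hausdorff_space X" "A \<in> vietoris_points X" "B \<in> vietoris_points X" "\<not> A \<subseteq> B"
  obtains \<U> \<W> where "openin (vietoris X) \<U>" "openin (vietoris X) \<W>" "A \<in> \<U>" "B \<in> \<W>"
    "\<And>A' B'. A' \<in> \<U> \<Longrightarrow> B' \<in> \<W> \<Longrightarrow> \<not> A' \<subseteq> B'"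
proof -
  obtain x where x: "x \<in> A" "x \<notin> B" using assms(4) by blast
  have cA: "compactin X A" "compactin X B" using assms by (auto simp: vietoris_points_def)
  have "compactin X {x}" using x cA(1) compactin_subset_topspace by fastforce
  moreover have "disjnt {x} B" using x by (auto simp: disjnt_def)
  ultimately obtain U W where UW: "openin X U" "openin X W" "{x} \<subseteq> U" "B \<subseteq> W" "disjnt U W"
    using assms(1) cA unfolding Hausdorff_space_compact_sets by meson
  show thesis
  proof (rule that)
    show "openin (vietoris X) {K \<in> vietoris_points X. K \<inter> U \<noteq> {}}"
      "openin (vietoris X) {K \<in> vietoris_points X. K \<subseteq> W}"
      using UW by (auto intro: openin_vietoris_meets openin_vietoris_subset)
  qed (use UW assms x in \<open>auto simp: disjnt_iff\<close>)
qed

lemma Hausdorff_space_vietoris: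
  assumes "Hausdorff_space X"
  shows "Hausdorff_space (vietoris X)"
  unfolding Hausdorff_space_def
proof (intro allI impI)
  fix A B assume *: "A \<in> topspace (vietoris X) \<and> B \<in> topspace (vietoris X) \<and> A \<noteq> B"
  then consider "\<not> A \<subseteq> B" | "\<not> B \<subseteq> A" by blast
  then show "\<exists>U V. openin (vietoris X) U \<and> openin (vietoris X) V \<and> A \<in> U \<and> B \<in> V \<and> disjnt U V"
  proof cases
    case 1
    then show ?thesis
      using vietoris_not_subset_separation[OF assms, of A B] *
      by (metis disjnt_iff dual_order.refl topspace_vietoris)
  next
    case 2
    then show ?thesis
      using vietoris_not_subset_separation[OF assms, of B A] *
      by (metis disjnt_iff dual_order.refl topspace_vietoris)
  qed
qed

text \<open>By Alexander's lemma only subbasic covers matter. Let \<open>V\<close> be the union of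
  the open sets whose hit-sets occur, and \<open>L\<close> its complement. If \<open>L\<close> is
  non-empty, it is itself a point of the hyperspace and lies in no hit-set of the cover, so some set
  of the form \<open>K \<subseteq> U\<close> covers it. Whatever is not inside \<open>U\<close>
  meets the compact set \<open>topspace X - U \<subseteq> V\<close>, for which finitely many
  hit-sets suffice.\<close>

lemma compact_space_vietoris:
  assumes X: "compact_space X"
  shows "compact_space (vietoris X)"
proof -
  define \<B> where "\<B> = {{K \<in> vietoris_points X. K \<subseteq> U} | U. openin X U} \<union>
      {{K \<in> vietoris_points X. K \<inter> U \<noteq> {}} | U. openin X U}"
  have top: "\<Union>\<B> = vietoris_points X"
    using topspace_vietoris[of X] unfolding vietoris_def \<B>_def topology_generated_by_topspace .
  \<comment> \<open>Alexander's lemma presents the topology through its subbase relative to the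
    union; this identifies it with \<open>topology_generated_by\<close>.\<close>
  have eq: "topology (arbitrary union_of (finite intersection_of (\<lambda>x. x \<in> \<B>) relative_to \<Union>\<B>)) = vietoris X"
    unfolding vietoris_def \<B>_def[symmetric]
  proof (rule topology_eq[THEN iffD2], intro allI iffI)
    fix S
    let ?T = "topology (arbitrary union_of (finite intersection_of (\<lambda>x. x \<in> \<B>) relative_to \<Union>\<B>))"
    show "openin (topology_generated_by \<B>) S" if "openin ?T S"
      by (rule minimal_topology_subbase[OF _ _ that])
        (auto intro: topology_generated_by_Basis simp flip: topology_generated_by_topspace)
    show "openin ?T S" if "openin (topology_generated_by \<B>) S"
    proof -
      have "openin ?T B" if "B \<in> \<B>" for B
      proof -
        have "B = \<Union>\<B> \<inter> B" using that by blast
        moreover have "(finite intersection_of (\<lambda>x. x \<in> \<B>)) B"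
          using that by (rule finite_intersection_of_inc)
        ultimately have "(finite intersection_of (\<lambda>x. x \<in> \<B>) relative_to \<Union>\<B>) B"
          unfolding relative_to_def by blast
        then show ?thesis unfolding openin_subbase by (rule arbitrary_union_of_inc)
      qed
      with that show ?thesis
        using generate_topology_on_coarsest[OF istopology_openin, of \<B> ?T S]
        by (simp add: openin_topology_generated_by_iff)
    qed
  qed
  show ?thesis
  proof (rule Alexander_subbase[OF eq])
    fix \<C> assume C: "\<C> \<subseteq> \<B>" "\<Union>\<C> = topspace (vietoris X)"
    define V where "V = \<Union>{U. openin X U \<and> {K \<in> vietoris_points X. K \<inter> U \<noteq> {}} \<in> \<C>}"
    have oV: "openin X V" unfolding V_def by blast
    define L where "L = topspace X - V"
    have cL: "compactin X L"
      unfolding L_def using oV X by (intro closedin_compact_space closedin_diff closedin_topspace)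
    have fin: "\<exists>\<F>. finite \<F> \<and> \<F> \<subseteq> \<C> \<and> (\<forall>K \<in> vietoris_points X. K \<inter> M \<noteq> {} \<longrightarrow> K \<in> \<Union>\<F>)"
      if M: "compactin X M" "M \<subseteq> V" for M
    proof -
      obtain \<G> where G: "finite \<G>" "\<G> \<subseteq> {U. openin X U \<and> {K \<in> vietoris_points X. K \<inter> U \<noteq> {}} \<in> \<C>}" "M \<subseteq> \<Union>\<G>"
        using M unfolding V_def compactin_def by (metis (no_types, lifting) mem_Collect_eq)
      show ?thesis
      proof (intro exI conjI)
        show "finite ((\<lambda>U. {K \<in> vietoris_points X. K \<inter> U \<noteq> {}}) ` \<G>)" using G by simp
        show "(\<lambda>U. {K \<in> vietoris_points X. K \<inter> U \<noteq> {}}) ` \<G> \<subseteq> \<C>" using G by auto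
        show "\<forall>K \<in> vietoris_points X. K \<inter> M \<noteq> {} \<longrightarrow> K \<in> \<Union>((\<lambda>U. {K \<in> vietoris_points X. K \<inter> U \<noteq> {}}) ` \<G>)"
          using G(3) by blast
      qed
    qed
    show "\<exists>C'. finite C' \<and> C' \<subseteq> \<C> \<and> \<Union>C' = topspace (vietoris X)"
    proof (cases "L = {}")
      case True
      then have "topspace X \<subseteq> V" unfolding L_def by blast
      moreover have "compactin X (topspace X)" using X compact_space_def by blast
      ultimately obtain \<F> where F: "finite \<F>" "\<F> \<subseteq> \<C>" "\<forall>K \<in> vietoris_points X. K \<inter> topspace X \<noteq> {} \<longrightarrow> K \<in> \<Union>\<F>"
        using fin by meson
      have "K \<in> \<Union>\<F>" if "K \<in> vietoris_points X" for K
      proof -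
        have "K \<subseteq> topspace X" "K \<noteq> {}" using that by (auto simp: vietoris_points_def dest!: compactin_subset_topspace)
        then have "K \<inter> topspace X \<noteq> {}" by blast
        then show ?thesis using F(3) that by blast
      qed
      then have "\<Union>\<F> = topspace (vietoris X)"
        using Union_mono[OF F(2)] C by auto
      then show ?thesis using F by blast
    next
      case False
      then have "L \<in> vietoris_points X" using cL by (simp add: vietoris_points_def)
      then obtain W where W: "W \<in> \<C>" "L \<in> W" using C by auto
      have nL: "L \<inter> U = {}" if "openin X U" "{K \<in> vietoris_points X. K \<inter> U \<noteq> {}} \<in> \<C>" for U
        using that unfolding L_def V_def by auto
      have "W \<in> \<B>" using W C(1) by blast
      then consider U where "openin X U" "W = {K \<in> vietoris_points X. K \<subseteq> U}"
        | U where "openin X U" "W = {K \<in> vietoris_points X. K \<inter> U \<noteq> {}}"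
        unfolding \<B>_def by blast
      then obtain U where U: "openin X U" "W = {K \<in> vietoris_points X. K \<subseteq> U}"
      proof cases
        case (2 U)
        then show ?thesis using nL[of U] W by auto
      qed (use that in blast)
      have "L \<subseteq> U" using W U by blast
      then have "topspace X - U \<subseteq> V" unfolding L_def by blast
      moreover have "compactin X (topspace X - U)"
        using U X by (intro closedin_compact_space closedin_diff closedin_topspace)
      ultimately obtain \<F> where F: "finite \<F>" "\<F> \<subseteq> \<C>" "\<forall>K \<in> vietoris_points X. K \<inter> (topspace X - U) \<noteq> {} \<longrightarrow> K \<in> \<Union>\<F>"
        using fin by meson
      have "K \<in> \<Union>(insert W \<F>)" if "K \<in> vietoris_points X" for K
      proof -
        have "K \<subseteq> topspace X" using that by (rule vietoris_points_subset_topspace)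
        then have "K \<inter> (topspace X - U) \<noteq> {} \<or> K \<subseteq> U" by blast
        then show ?thesis using F(3) that U by auto
      qed
      then have "vietoris_points X \<subseteq> \<Union>(insert W \<F>)" by (rule subsetI)
      moreover have "\<Union>(insert W \<F>) \<subseteq> \<Union>\<C>"
        using F(2) W by (intro Union_mono) simp
      ultimately have "\<Union>(insert W \<F>) = topspace (vietoris X)"
        unfolding C(2) topspace_vietoris by blast
      then show ?thesis using F W
        by (intro exI[of _ "insert W \<F>"]) auto
    qed
  qed
qed

text \<open>The two halves of a disconnected compact set are compact and disjoint, so disjoint open
  sets around them disconnect every nearby set as well.\<close>

lemma closedin_vietoris_connectedin:
  assumes X: "Hausdorff_space X"
  shows "closedin (vietoris X) {K \<in> vietoris_points X. connectedin X K}"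
proof -
  have "openin (vietoris X) (vietoris_points X - {K \<in> vietoris_points X. connectedin X K})"
  proof (subst openin_subopen, intro ballI)
    fix K assume K: "K \<in> vietoris_points X - {K \<in> vietoris_points X. connectedin X K}"
    then have cK: "compactin X K" "\<not> connectedin X K" "K \<subseteq> topspace X"
      by (auto simp: vietoris_points_def dest: compactin_subset_topspace)
    then obtain E1 E2 where E: "closedin X E1" "closedin X E2"
      "K \<subseteq> E1 \<union> E2" "E1 \<inter> E2 \<inter> K = {}" "E1 \<inter> K \<noteq> {}" "E2 \<inter> K \<noteq> {}"
      unfolding connectedin_closedin by blast
    have "compactin X (E1 \<inter> K)" "compactin X (E2 \<inter> K)" "disjnt (E1 \<inter> K) (E2 \<inter> K)"
      using E cK by (auto simp: disjnt_def intro: closed_Int_compactin)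
    then obtain U V where UV: "openin X U" "openin X V" "E1 \<inter> K \<subseteq> U" "E2 \<inter> K \<subseteq> V" "disjnt U V"
      using X unfolding Hausdorff_space_compact_sets by meson
    let ?T = "{K \<in> vietoris_points X. K \<subseteq> U \<union> V} \<inter> {K \<in> vietoris_points X. K \<inter> U \<noteq> {}}
       \<inter> {K \<in> vietoris_points X. K \<inter> V \<noteq> {}}"
    have "openin (vietoris X) ?T"
      using UV by (intro openin_Int openin_vietoris_subset openin_vietoris_meets openin_Un)
    moreover have "K \<in> ?T" using K UV E by blast
    moreover have "\<not> connectedin X K'" if "K' \<in> ?T" for K'
    proof
      assume "connectedin X K'"
      moreover have "U \<inter> V \<inter> K' = {}" using UV(5) by (auto simp: disjnt_def)
      moreover have "K' \<subseteq> U \<union> V" "U \<inter> K' \<noteq> {}" "V \<inter> K' \<noteq> {}" using that by auto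
      ultimately show False using UV(1,2) unfolding connectedin by blast
    qed
    ultimately show "\<exists>T. openin (vietoris X) T \<and> K \<in> T \<and> T \<subseteq> vietoris_points X - {K \<in> vietoris_points X. connectedin X K}"
      by (intro exI[of _ ?T]) auto
  qed
  then show ?thesis unfolding closedin_def by auto
qed

section \<open>Connected maximal chains\<close>

lemma finite_chain_Inter_in:
  "finite \<F> \<Longrightarrow> \<F> \<noteq> {} \<Longrightarrow> chain\<^sub>\<subseteq> \<F> \<Longrightarrow> \<Inter>\<F> \<in> \<F>"
proof (induction rule: finite_ne_induct)
  case (insert A \<F>)
  then have "\<Inter>\<F> \<in> \<F>" by (simp add: chain_subset_def)
  moreover from this have "A \<subseteq> \<Inter>\<F> \<or> \<Inter>\<F> \<subseteq> A"
    using insert.prems by (auto simp: chain_subset_def)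
  ultimately show ?case
    by (metis Inter_insert inf.absorb_iff1 inf.absorb_iff2 insertCI)
qed simp

text \<open>Replaces maximality, which quantifies over all compact sets, by conditions that are
  visibly closed. Maximality supplies the whole space, and a singleton drawn from
  \<open>\<Inter>c\<close>, which is non-empty by compactness. Conversely, a set \<open>K\<close>
  comparable with all members but missing from \<open>c\<close> would disconnect \<open>c\<close>
  into the members inside \<open>K\<close> and those containing \<open>K\<close>.\<close>

lemma in_connected_chains_iff:
  assumes X: "compact_space X" "Hausdorff_space X" and ne: "topspace X \<noteq> {}"
  shows "c \<in> topspace (connected_chains X) \<longleftrightarrow>
    c \<in> vietoris_points (vietoris X) \<and> chain\<^sub>\<subseteq> c \<and> connectedin (vietoris X) c \<and>
    topspace X \<in> c \<and> (\<exists>x \<in> topspace X. {x} \<in> c)" (is "_ \<longleftrightarrow> ?R")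
proof
  assume "c \<in> topspace (connected_chains X)"
  then have c: "c \<in> vietoris_points (vietoris X)" "chain\<^sub>\<subseteq> c" "connectedin (vietoris X) c"
    and mx: "\<And>K. K \<in> vietoris_points X \<Longrightarrow> chain\<^sub>\<subseteq> (insert K c) \<Longrightarrow> K \<in> c"
    unfolding connected_chains_def maximal_closed_chain_def by auto
  have sub: "c \<subseteq> vietoris_points X" "c \<noteq> {}"
    using vietoris_points_subset_topspace[OF c(1)] c(1) by (auto simp: vietoris_points_def)
  have top: "topspace X \<in> c"
  proof (rule mx)
    show "topspace X \<in> vietoris_points X"
      using X ne by (simp add: vietoris_points_def compact_space_def)
    show "chain\<^sub>\<subseteq> (insert (topspace X) c)"
      using c(2) sub vietoris_points_subset_topspace[of _ X] unfolding chain_subset_def by blast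
  qed
  have "\<Inter>c \<noteq> {}"
  proof -
    have "closedin X A" if "A \<in> c" for A
      using that sub X by (auto simp: vietoris_points_def intro: compactin_imp_closedin)
    moreover have "\<Inter>\<F> \<noteq> {}" if "finite \<F>" "\<F> \<subseteq> c" for \<F>
    proof (cases "\<F> = {}")
      case False
      have "chain\<^sub>\<subseteq> \<F>" using c(2) that(2) unfolding chain_subset_def by blast
      then have "\<Inter>\<F> \<in> c" using finite_chain_Inter_in that False by blast
      then show ?thesis using sub by (auto simp: vietoris_points_def)
    qed auto
    ultimately show ?thesis using compact_space_fip[THEN iffD1, OF X(1), rule_format, of c] by simp
  qed
  then obtain x where x: "x \<in> \<Inter>c" by blast
  then have xX: "x \<in> topspace X" using top by blast
  have "{x} \<in> c"
  proof (rule mx)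
    show "{x} \<in> vietoris_points X" using xX by (simp add: vietoris_points_def)
    show "chain\<^sub>\<subseteq> (insert {x} c)" using c(2) x unfolding chain_subset_def by blast
  qed
  then show ?R using c top xX by blast
next
  assume R: ?R
  then obtain x where x: "x \<in> topspace X" "{x} \<in> c" by blast
  have sub: "c \<subseteq> vietoris_points X"
    using vietoris_points_subset_topspace R by fastforce
  have "K \<in> c" if K: "K \<in> vietoris_points X" "chain\<^sub>\<subseteq> (insert K c)" for K
  proof (rule ccontr)
    assume nK: "K \<notin> c"
    have clK: "closedin X K" using K X by (auto simp: vietoris_points_def intro: compactin_imp_closedin)
    \<comment> \<open>\<open>?U\<close> consists of the sets that contain \<open>K\<close>, written
      as an intersection of hit conditions on closed singletons so that it is seen to be closed. The
      two sides are inhabited by \<open>{x}\<close> and by the whole space.\<close>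
    let ?L = "{A \<in> vietoris_points X. A \<subseteq> K}" and ?U = "\<Inter>y\<in>K. {A \<in> vietoris_points X. A \<inter> {y} \<noteq> {}}"
    have "K \<noteq> {}" "K \<subseteq> topspace X" using K vietoris_points_subset_topspace by (auto simp: vietoris_points_def)
    have "closedin (vietoris X) ?L" using clK by (rule closedin_vietoris_subset)
    moreover have "closedin (vietoris X) ?U"
    proof (intro closedin_INT closedin_vietoris_meets)
      fix y assume "y \<in> K"
      then show "closedin X {y}"
        using X \<open>K \<subseteq> topspace X\<close> by (auto simp: closedin_Hausdorff_singleton)
    qed (use \<open>K \<noteq> {}\<close> in auto)
    moreover have "c \<subseteq> ?L \<union> ?U"
    proof
      fix A assume A: "A \<in> c"
      then have "A \<subseteq> K \<or> K \<subseteq> A" using K(2) by (auto simp: chain_subset_def)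
      then show "A \<in> ?L \<union> ?U" using A sub by blast
    qed
    moreover have "?L \<inter> ?U \<inter> c = {}"
      using nK by (auto dest: subset_antisym)
    moreover have "?U \<inter> c \<noteq> {}"
      using R sub \<open>K \<subseteq> topspace X\<close> by auto
    moreover have "?L \<inter> c \<noteq> {}"
    proof -
      have "{x} \<subseteq> K"
      proof (rule ccontr)
        assume "\<not> {x} \<subseteq> K"
        then have "K \<subseteq> {x}" using K(2) x(2) by (auto simp: chain_subset_def)
        then have "K = {x}" using \<open>K \<noteq> {}\<close> by blast
        then show False using nK x(2) by simp
      qed
      then show ?thesis using x sub by blast
    qed
    ultimately show False using R unfolding connectedin_closedin by blast
  qed
  with R show "c \<in> topspace (connected_chains X)"
    unfolding connected_chains_def maximal_closed_chain_def by auto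
qed

lemma connected_chains_members:
  assumes "compact_space X" "Hausdorff_space X" "topspace X \<noteq> {}"
    and "c \<in> topspace (connected_chains X)"
  shows "c \<subseteq> vietoris_points X"
  using assms vietoris_points_subset_topspace[of c "vietoris X"] by (simp add: in_connected_chains_iff)

text \<open>All members contain the common point \<open>x\<close>. If \<open>A\<close> split into
  closed parts \<open>P\<close> containing \<open>x\<close> and \<open>R\<close>, then a member
  inside \<open>A\<close> either lies in \<open>P\<close> or meets \<open>R\<close>, and a member
  above \<open>A\<close> meets \<open>R\<close>; these two closed alternatives would disconnect
  \<open>c\<close>.\<close>

lemma connected_chains_member_connected:
  assumes X: "compact_space X" "Hausdorff_space X" "topspace X \<noteq> {}"
    and c: "c \<in> topspace (connected_chains X)" and A: "A \<in> c"
  shows "connectedin X A"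
proof (rule ccontr)
  assume n: "\<not> connectedin X A"
  have sub: "c \<subseteq> vietoris_points X" using connected_chains_members[OF X c] .
  have "A \<in> vietoris_points X" using sub A by blast
  then have "closedin X A" "A \<subseteq> topspace X"
    using X vietoris_points_subset_topspace by (auto simp: vietoris_points_def intro: compactin_imp_closedin)
  obtain x where x: "{x} \<in> c" using c X by (auto simp: in_connected_chains_iff)
  have ch: "chain\<^sub>\<subseteq> c" and con: "connectedin (vietoris X) c" using c X by (auto simp: in_connected_chains_iff)
  have xA: "x \<in> A"
  proof (rule ccontr)
    assume "x \<notin> A"
    then have "A \<subseteq> {x}" using ch x A unfolding chain_subset_def by blast
    with \<open>x \<notin> A\<close> have "A = {}" by blast
    then show False using \<open>A \<in> vietoris_points X\<close> by (auto simp: vietoris_points_def)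
  qed
  obtain E1 E2 where E0: "closedin X E1" "closedin X E2"
      "A \<subseteq> E1 \<union> E2" "E1 \<inter> E2 \<inter> A = {}" "E1 \<inter> A \<noteq> {}" "E2 \<inter> A \<noteq> {}"
    using n \<open>A \<subseteq> topspace X\<close> unfolding connectedin_closedin by blast
  obtain P R where PR: "closedin X P" "closedin X R" "A = P \<union> R" "P \<inter> R = {}" "x \<in> P" "R \<noteq> {}"
  proof (cases "x \<in> E1")
    case True
    show ?thesis
      by (rule that[of "E1 \<inter> A" "E2 \<inter> A"]) (use E0 True xA \<open>closedin X A\<close> in auto)
  next
    case False
    show ?thesis
      by (rule that[of "E2 \<inter> A" "E1 \<inter> A"]) (use E0 False xA \<open>closedin X A\<close> in auto)
  qed
  let ?L = "{B \<in> vietoris_points X. B \<subseteq> P}" and ?U = "{B \<in> vietoris_points X. B \<inter> R \<noteq> {}}"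
  have "closedin (vietoris X) ?L" "closedin (vietoris X) ?U"
    by (rule closedin_vietoris_subset[OF PR(1)], rule closedin_vietoris_meets[OF PR(2)])
  moreover have "c \<subseteq> ?L \<union> ?U"
  proof
    fix B assume B: "B \<in> c"
    then have "B \<subseteq> A \<or> A \<subseteq> B" using ch A unfolding chain_subset_def by blast
    then show "B \<in> ?L \<union> ?U" using B sub PR by blast
  qed
  moreover have "?L \<inter> ?U \<inter> c = {}" using PR by blast
  moreover have "{x} \<in> ?L \<inter> c" using x PR sub by auto
  moreover have "A \<in> ?U \<inter> c" using A PR sub by auto
  ultimately show False using con unfolding connectedin_closedin by blast
qed

text \<open>Each of the four conditions of \<open>in_connected_chains_iff\<close> is closed: two
  distinct points of a member, or two incomparable members, can be separated by open sets and so
  persist in a neighbourhood.\<close>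

lemma closedin_connected_chains:
  assumes X: "compact_space X" "Hausdorff_space X" "topspace X \<noteq> {}"
  shows "closedin (vietoris (vietoris X)) (topspace (connected_chains X))"
proof -
  let ?V = "vietoris X" and ?VV = "vietoris (vietoris X)"
  let ?P = "vietoris_points (vietoris X)"
  have HV: "Hausdorff_space ?V" using X by (intro Hausdorff_space_vietoris)
  have 1: "closedin ?VV {c \<in> ?P. connectedin ?V c}"
    using HV by (rule closedin_vietoris_connectedin)
  have "topspace X \<in> vietoris_points X"
    using X by (simp add: vietoris_points_def compact_space_def)
  then have "closedin ?V {topspace X}"
    using HV by (simp add: closedin_Hausdorff_singleton)
  then have 2: "closedin ?VV {c \<in> ?P. c \<inter> {topspace X} \<noteq> {}}"
    by (rule closedin_vietoris_meets)
  have "openin ?V (vietoris_points X - {{x} |x. x \<in> topspace X})"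
  proof (subst openin_subopen, intro ballI)
    fix K assume K: "K \<in> vietoris_points X - {{x} |x. x \<in> topspace X}"
    then have "K \<noteq> {}" "K \<subseteq> topspace X" using vietoris_points_subset_topspace by (auto simp: vietoris_points_def)
    then obtain x where "x \<in> K" by blast
    with K \<open>K \<subseteq> topspace X\<close> obtain y where y: "y \<in> K" "x \<noteq> y" by blast
    then obtain U W where UW: "openin X U" "openin X W" "x \<in> U" "y \<in> W" "disjnt U W"
      using X(2) \<open>x \<in> K\<close> \<open>K \<subseteq> topspace X\<close> unfolding Hausdorff_space_def by (metis subsetD)
    let ?T = "{K \<in> vietoris_points X. K \<inter> U \<noteq> {}} \<inter> {K \<in> vietoris_points X. K \<inter> W \<noteq> {}}"
    have "openin ?V ?T" using UW by (intro openin_Int openin_vietoris_meets)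
    moreover have "K \<in> ?T" using K \<open>x \<in> K\<close> y UW by blast
    moreover have "?T \<subseteq> vietoris_points X - {{x} |x. x \<in> topspace X}"
      using UW(5) by (auto simp: disjnt_def)
    ultimately show "\<exists>T. openin ?V T \<and> K \<in> T \<and> T \<subseteq> vietoris_points X - {{x} |x. x \<in> topspace X}"
      by blast
  qed
  moreover have "{{x} |x. x \<in> topspace X} \<subseteq> vietoris_points X"
    by (auto simp: vietoris_points_def)
  ultimately have "closedin ?V {{x} |x. x \<in> topspace X}"
    by (simp add: closedin_def)
  then have 3: "closedin ?VV {c \<in> ?P. c \<inter> {{x} |x. x \<in> topspace X} \<noteq> {}}"
    by (rule closedin_vietoris_meets)
  have "openin ?VV (?P - {c \<in> ?P. chain\<^sub>\<subseteq> c})"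
  proof (subst openin_subopen, intro ballI)
    fix c assume c: "c \<in> ?P - {c \<in> ?P. chain\<^sub>\<subseteq> c}"
    then obtain A B where AB: "A \<in> c" "B \<in> c" "\<not> A \<subseteq> B" "\<not> B \<subseteq> A"
      unfolding chain_subset_def by blast
    have "c \<subseteq> vietoris_points X" using c vietoris_points_subset_topspace by fastforce
    then have AB': "A \<in> vietoris_points X" "B \<in> vietoris_points X" using AB by auto
    obtain \<U> \<W> where UW: "openin ?V \<U>" "openin ?V \<W>" "A \<in> \<U>" "B \<in> \<W>"
      "\<And>A' B'. A' \<in> \<U> \<Longrightarrow> B' \<in> \<W> \<Longrightarrow> \<not> A' \<subseteq> B'"
      using vietoris_not_subset_separation[OF X(2) AB' AB(3)] by metis
    obtain \<U>' \<W>' where UW': "openin ?V \<U>'" "openin ?V \<W>'" "B \<in> \<U>'" "A \<in> \<W>'"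
      "\<And>A' B'. A' \<in> \<U>' \<Longrightarrow> B' \<in> \<W>' \<Longrightarrow> \<not> A' \<subseteq> B'"
      using vietoris_not_subset_separation[OF X(2) AB'(2,1) AB(4)] by metis
    let ?T = "{c \<in> ?P. c \<inter> (\<U> \<inter> \<W>') \<noteq> {}} \<inter> {c \<in> ?P. c \<inter> (\<W> \<inter> \<U>') \<noteq> {}}"
    have "openin ?VV ?T" using UW UW' by (intro openin_Int openin_vietoris_meets)
    moreover have "c \<in> ?T" using c AB UW UW' by blast
    moreover have "?T \<subseteq> ?P - {c \<in> ?P. chain\<^sub>\<subseteq> c}"
    proof
      fix d assume d: "d \<in> ?T"
      then obtain A' B' where d': "A' \<in> d" "B' \<in> d" "A' \<in> \<U>" "A' \<in> \<W>'" "B' \<in> \<W>" "B' \<in> \<U>'" by blast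
      have "\<not> A' \<subseteq> B'" "\<not> B' \<subseteq> A'" using UW(5)[OF d'(3,5)] UW'(5)[OF d'(6,4)] .
      then have "\<not> chain\<^sub>\<subseteq> d" using d'(1,2) unfolding chain_subset_def by blast
      then show "d \<in> ?P - {c \<in> ?P. chain\<^sub>\<subseteq> c}" using d by blast
    qed
    ultimately show "\<exists>T. openin ?VV T \<and> c \<in> T \<and> T \<subseteq> ?P - {c \<in> ?P. chain\<^sub>\<subseteq> c}"
      by blast
  qed
  then have 4: "closedin ?VV {c \<in> ?P. chain\<^sub>\<subseteq> c}"
    by (simp add: closedin_def)
  have "topspace (connected_chains X) = {c \<in> ?P. chain\<^sub>\<subseteq> c} \<inter> {c \<in> ?P. connectedin ?V c}
      \<inter> {c \<in> ?P. c \<inter> {topspace X} \<noteq> {}} \<inter> {c \<in> ?P. c \<inter> {{x} |x. x \<in> topspace X} \<noteq> {}}"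
    by (rule set_eqI, unfold in_connected_chains_iff[OF X]) blast
  then show ?thesis using 1 2 3 4 by (simp only: closedin_Int)
qed

lemma connected_chains_eq_subtopology:
  "connected_chains X = subtopology (vietoris (vietoris X)) (topspace (connected_chains X))"
  unfolding connected_chains_def by (metis subtopology_restrict topspace_subtopology)

lemma
  assumes X: "compact_space X" "Hausdorff_space X" "topspace X \<noteq> {}"
  shows compact_space_connected_chains: "compact_space (connected_chains X)"
    and Hausdorff_space_connected_chains: "Hausdorff_space (connected_chains X)"
proof -
  have "compact_space (vietoris (vietoris X))" "Hausdorff_space (vietoris (vietoris X))"
    using X by (auto intro: compact_space_vietoris Hausdorff_space_vietoris)
  then show "compact_space (connected_chains X)" "Hausdorff_space (connected_chains X)"
    using closedin_connected_chains[OF X] connected_chains_eq_subtopology[of X]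
    by (metis closedin_compact_space compact_space_subtopology, metis Hausdorff_space_subtopology)
qed

section \<open>Hausdorff closeness\<close>

text \<open>On non-empty compact sets this says that the Hausdorff distance is below
  \<open>e\<close>. The pointwise form avoids suprema and makes the triangle inequality
  immediate.\<close>

definition hausdorff_close :: "real \<Rightarrow> 'a::metric_space set \<Rightarrow> 'a set \<Rightarrow> bool" where
  "hausdorff_close e A B \<longleftrightarrow> (\<forall>x\<in>A. \<exists>y\<in>B. dist x y < e) \<and> (\<forall>y\<in>B. \<exists>x\<in>A. dist x y < e)"

lemma hausdorff_close_mono: "hausdorff_close e A B \<Longrightarrow> e \<le> e' \<Longrightarrow> hausdorff_close e' A B"
  unfolding hausdorff_close_def by (meson order_less_le_trans)

lemma hausdorff_close_sym: "hausdorff_close e A B \<Longrightarrow> hausdorff_close e B A"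
  unfolding hausdorff_close_def by (simp add: dist_commute)

lemma hausdorff_close_trans:
  assumes "hausdorff_close e A B" "hausdorff_close e' B C"
  shows "hausdorff_close (e + e') A C"
  unfolding hausdorff_close_def
proof (intro conjI ballI)
  fix x assume "x \<in> A"
  then obtain y z where "y \<in> B" "z \<in> C" "dist x y < e" "dist y z < e'"
    using assms unfolding hausdorff_close_def by meson
  then show "\<exists>z\<in>C. dist x z < e + e'"
    by (intro bexI[of _ z]) (use dist_triangle[of x z y] in linarith)
next
  fix z assume "z \<in> C"
  then obtain y x where "y \<in> B" "x \<in> A" "dist x y < e" "dist y z < e'"
    using assms unfolding hausdorff_close_def by meson
  then show "\<exists>x\<in>A. dist x z < e + e'"
    by (intro bexI[of _ x]) (use dist_triangle[of x z y] in linarith)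
qed

lemma vietoris_points_top_of_set:
  "K \<in> vietoris_points (top_of_set S) \<longleftrightarrow> compact K \<and> K \<subseteq> S \<and> K \<noteq> {}"
  by (auto simp: vietoris_points_def compactin_subtopology)

lemma vietoris_open_imp_hausdorff_close:
  fixes S :: "'a::metric_space set"
  assumes "openin (vietoris (top_of_set S)) \<U>" "A \<in> \<U>"
  shows "\<exists>e>0. \<forall>B\<in>vietoris_points (top_of_set S). hausdorff_close e A B \<longrightarrow> B \<in> \<U>"
proof -
  let ?VP = "vietoris_points (top_of_set S)"
  have "generate_topology_on ({{K \<in> ?VP. K \<subseteq> U} | U. openin (top_of_set S) U} \<union>
      {{K \<in> ?VP. K \<inter> U \<noteq> {}} | U. openin (top_of_set S) U}) \<U>"
    using assms(1) unfolding vietoris_def by (rule openin_topology_generated_by)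
  then show ?thesis using assms(2)
  proof (induction arbitrary: A rule: generate_topology_on.induct)
    case (Int a b)
    from Int.IH(1)[of A] Int.prems obtain e where e1: "e > 0" "\<forall>B\<in>?VP. hausdorff_close e A B \<longrightarrow> B \<in> a" by blast
    from Int.IH(2)[of A] Int.prems obtain e' where e2: "e' > 0" "\<forall>B\<in>?VP. hausdorff_close e' A B \<longrightarrow> B \<in> b" by blast
    note e = e1 e2
    show ?case
    proof (intro exI[of _ "min e e'"] conjI ballI impI)
      fix B assume "B \<in> ?VP" "hausdorff_close (min e e') A B"
      then show "B \<in> a \<inter> b"
        using e hausdorff_close_mono[of "min e e'" A B] by simp
    qed (use e in simp)
  next
    case (UN K)
    then obtain a where a: "a \<in> K" "A \<in> a" by blast
    from UN.IH[OF this] show ?case using a by blast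
  next
    case (Basis s)
    then consider U where "openin (top_of_set S) U" "s = {K \<in> ?VP. K \<subseteq> U}"
      | U where "openin (top_of_set S) U" "s = {K \<in> ?VP. K \<inter> U \<noteq> {}}" by blast
    then show ?case
    proof cases
      case (1 U)
      then obtain T where T: "open T" "U = S \<inter> T" unfolding openin_open by blast
      then have "compact A" "A \<subseteq> T" using 1 Basis by (auto simp: vietoris_points_top_of_set)
      then obtain e where e: "e > 0" "(\<Union>x\<in>A. ball x e) \<subseteq> T"
        using compact_subset_open_imp_ball_epsilon_subset T(1) by metis
      have "B \<subseteq> U" if B: "B \<in> ?VP" "hausdorff_close e A B" for B
      proof
        fix y assume "y \<in> B"
        then obtain x where "x \<in> A" "dist x y < e" using B unfolding hausdorff_close_def by blast
        then have "y \<in> (\<Union>x\<in>A. ball x e)" by auto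
        then have "y \<in> T" using e(2) by blast
        then show "y \<in> U" using T B \<open>y \<in> B\<close> by (auto simp: vietoris_points_top_of_set)
      qed
      then show ?thesis using e(1) 1(2) by blast
    next
      case (2 U)
      then obtain T where T: "open T" "U = S \<inter> T" unfolding openin_open by blast
      then obtain x where x: "x \<in> A" "x \<in> T" using 2 Basis by auto
      then obtain e where e: "e > 0" "ball x e \<subseteq> T" using T(1) open_contains_ball by blast
      have "B \<inter> U \<noteq> {}" if B: "B \<in> ?VP" "hausdorff_close e A B" for B
      proof -
        obtain y where "y \<in> B" "dist x y < e" using B x unfolding hausdorff_close_def by blast
        then have "y \<in> T" using e by auto
        then have "y \<in> B \<inter> U" using T B \<open>y \<in> B\<close> by (auto simp: vietoris_points_top_of_set)
        then show ?thesis by blast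
      qed
      then show ?thesis using e(1) 2(2) by blast
    qed
  qed simp
qed

text \<open>A finite \<open>e/2\<close>-net \<open>F\<close> of \<open>A\<close> turns closeness
  into finitely many Vietoris conditions: stay within the \<open>e\<close>-neighbourhood of
  \<open>A\<close> and hit the \<open>e/2\<close>-ball about each point of \<open>F\<close>. With
  \<open>vietoris_open_imp_hausdorff_close\<close> this identifies the Vietoris topology with that
  of the Hausdorff distance.\<close>

lemma hausdorff_close_vietoris_neighbourhood:
  fixes S :: "'a::metric_space set"
  assumes A: "A \<in> vietoris_points (top_of_set S)" and e: "e > 0"
  obtains \<U> where "openin (vietoris (top_of_set S)) \<U>" "A \<in> \<U>" "\<And>B. B \<in> \<U> \<Longrightarrow> hausdorff_close e A B"
proof -
  let ?VP = "vietoris_points (top_of_set S)"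
  have cA: "compact A" "A \<subseteq> S" "A \<noteq> {}" using A by (auto simp: vietoris_points_top_of_set)
  obtain F where F: "finite F" "F \<subseteq> A" "A \<subseteq> (\<Union>x\<in>F. ball x (e/2))"
    using compactE_image[OF cA(1), of A "\<lambda>x. ball x (e/2)"] e
    by (metis UN_I centre_in_ball half_gt_zero open_ball subsetI)
  have "F \<noteq> {}" using F cA by auto
  let ?U = "{K \<in> ?VP. K \<subseteq> S \<inter> (\<Union>x\<in>A. ball x e)} \<inter> (\<Inter>x\<in>F. {K \<in> ?VP. K \<inter> (S \<inter> ball x (e/2)) \<noteq> {}})"
  show thesis
  proof (rule that)
    show "openin (vietoris (top_of_set S)) ?U"
      using F(1) \<open>F \<noteq> {}\<close>
      by (intro openin_Int openin_INT2 openin_vietoris_subset openin_vietoris_meets openin_open_Int) auto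
    have "x \<in> A \<inter> (S \<inter> ball x (e/2))" if "x \<in> F" for x using that cA(2) F(2) e by auto
    moreover have "A \<subseteq> S \<inter> (\<Union>x\<in>A. ball x e)" using cA(2) e by auto
    ultimately show "A \<in> ?U" using A by blast
    fix B assume B: "B \<in> ?U"
    show "hausdorff_close e A B"
      unfolding hausdorff_close_def
    proof (intro conjI ballI)
      fix x assume "x \<in> A"
      then obtain z where z: "z \<in> F" "dist z x < e/2" using F by auto
      then have "B \<inter> (S \<inter> ball z (e/2)) \<noteq> {}" using B by blast
      then obtain y where "y \<in> B" "dist z y < e/2" by auto
      then show "\<exists>y\<in>B. dist x y < e"
        using z dist_triangle_half_r by blast
    next
      fix y assume "y \<in> B"
      then have "y \<in> (\<Union>x\<in>A. ball x e)" using B by blast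
      then show "\<exists>x\<in>A. dist x y < e" by auto
    qed
  qed
qed

text \<open>The same comparison one level up, with closeness of families measured member by member.
  It reduces density in the space of chains to approximating the members of \<open>c\<close> in both
  directions.\<close>

lemma vietoris2_open_imp_hausdorff_close:
  fixes S :: "'a::metric_space set"
  assumes "openin (vietoris (vietoris (top_of_set S))) \<N>" "c \<in> \<N>"
  shows "\<exists>e>0. \<forall>c'\<in>vietoris_points (vietoris (top_of_set S)).
    (\<forall>A\<in>c. \<exists>A'\<in>c'. hausdorff_close e A A') \<longrightarrow> (\<forall>A'\<in>c'. \<exists>A\<in>c. hausdorff_close e A A') \<longrightarrow> c' \<in> \<N>"
proof -
  let ?V = "vietoris (top_of_set S)"
  let ?P = "vietoris_points ?V"
  let ?VP = "vietoris_points (top_of_set S)"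
  have sub: "c' \<subseteq> ?VP" if "c' \<in> ?P" for c'
    using vietoris_points_subset_topspace that by fastforce
  have "generate_topology_on ({{K \<in> ?P. K \<subseteq> U} | U. openin ?V U} \<union>
      {{K \<in> ?P. K \<inter> U \<noteq> {}} | U. openin ?V U}) \<N>"
    using assms(1) unfolding vietoris_def[of ?V] by (rule openin_topology_generated_by)
  then show ?thesis using assms(2)
  proof (induction arbitrary: c rule: generate_topology_on.induct)
    case (Int a b)
    from Int.IH(1)[of c] Int.prems obtain e where
      e: "e > 0" "\<And>c'. c' \<in> ?P \<Longrightarrow> (\<forall>A\<in>c. \<exists>A'\<in>c'. hausdorff_close e A A') \<Longrightarrow> (\<forall>A'\<in>c'. \<exists>A\<in>c. hausdorff_close e A A') \<Longrightarrow> c' \<in> a" by blast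
    from Int.IH(2)[of c] Int.prems obtain e' where
      e': "e' > 0" "\<And>c'. c' \<in> ?P \<Longrightarrow> (\<forall>A\<in>c. \<exists>A'\<in>c'. hausdorff_close e' A A') \<Longrightarrow> (\<forall>A'\<in>c'. \<exists>A\<in>c. hausdorff_close e' A A') \<Longrightarrow> c' \<in> b" by blast
    have *: "hausdorff_close e A A' \<and> hausdorff_close e' A A'" if "hausdorff_close (min e e') A A'" for A A'
      using that hausdorff_close_mono[OF that] by auto
    show ?case
    proof (intro exI[of _ "min e e'"] conjI ballI impI)
      show "min e e' > 0" using e e' by simp
      fix c' assume c': "c' \<in> ?P" "\<forall>A\<in>c. \<exists>A'\<in>c'. hausdorff_close (min e e') A A'"
        "\<forall>A'\<in>c'. \<exists>A\<in>c. hausdorff_close (min e e') A A'"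
      have "\<forall>A\<in>c. \<exists>A'\<in>c'. hausdorff_close e A A'" "\<forall>A'\<in>c'. \<exists>A\<in>c. hausdorff_close e A A'"
        "\<forall>A\<in>c. \<exists>A'\<in>c'. hausdorff_close e' A A'" "\<forall>A'\<in>c'. \<exists>A\<in>c. hausdorff_close e' A A'"
        using c'(2,3) * by fast+
      then show "c' \<in> a \<inter> b" using e(2) e'(2) c'(1) by (intro IntI)
    qed
  next
    case (UN K)
    then obtain a where a: "a \<in> K" "c \<in> a" by blast
    from UN.IH[OF this] show ?case using a by blast
  next
    case (Basis s)
    then consider U where "openin ?V U" "s = {K \<in> ?P. K \<subseteq> U}"
      | U where "openin ?V U" "s = {K \<in> ?P. K \<inter> U \<noteq> {}}" by blast
    then show ?case
    proof cases
      case (1 U)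
      then have c: "c \<in> ?P" "c \<subseteq> U" using Basis by auto
      \<comment> \<open>A Lebesgue number argument on the compact family \<open>c\<close>: half of
        the admissible radius goes to reaching a member from one of finitely many centres, the other
        half remains for the passage from that member to the approximating set.\<close>
      have "\<exists>e \<O>. e > 0 \<and> (\<forall>B\<in>?VP. hausdorff_close (e+e) A B \<longrightarrow> B \<in> U) \<and> openin ?V \<O> \<and> A \<in> \<O>
        \<and> (\<forall>B\<in>\<O>. hausdorff_close e A B)" if "A \<in> c" for A
      proof -
        have "A \<in> U" using that c by blast
        then obtain e where e: "e > 0" "\<forall>B\<in>?VP. hausdorff_close e A B \<longrightarrow> B \<in> U"
          using vietoris_open_imp_hausdorff_close[OF 1(1)] by blast
        have "A \<in> ?VP" using that c sub by blast
        then obtain \<O> where "openin ?V \<O>" "A \<in> \<O>" "\<And>B. B \<in> \<O> \<Longrightarrow> hausdorff_close (e/2) A B"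
          using hausdorff_close_vietoris_neighbourhood[of A S "e/2"] e by auto
        with e show ?thesis by (intro exI[of _ "e/2"] exI[of _ \<O>]) simp
      qed
      then obtain \<epsilon> \<O> where h: "\<And>A. A \<in> c \<Longrightarrow> \<epsilon> A > 0 \<and> (\<forall>B\<in>?VP. hausdorff_close (\<epsilon> A + \<epsilon> A) A B \<longrightarrow> B \<in> U)
         \<and> openin ?V (\<O> A) \<and> A \<in> \<O> A \<and> (\<forall>B\<in>\<O> A. hausdorff_close (\<epsilon> A) A B)" by metis
      have "compactin ?V c" using c by (simp add: vietoris_points_def)
      moreover have "\<forall>T\<in>\<O> ` c. openin ?V T" "c \<subseteq> \<Union>(\<O> ` c)" using h by auto
      ultimately have "\<exists>\<F>. finite \<F> \<and> \<F> \<subseteq> \<O> ` c \<and> c \<subseteq> \<Union>\<F>"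
        unfolding compactin_def by metis
      then obtain F where F: "finite F" "F \<subseteq> c" "c \<subseteq> \<Union>(\<O> ` F)"
        by (metis finite_subset_image)
      have "c \<noteq> {}" using c by (simp add: vietoris_points_def)
      then have "F \<noteq> {}" using F by auto
      define e where "e = Min (\<epsilon> ` F)"
      have e: "e > 0" "\<And>A. A \<in> F \<Longrightarrow> e \<le> \<epsilon> A"
        using F \<open>F \<noteq> {}\<close> h unfolding e_def by (auto simp: subset_iff)
      have "c' \<in> s" if c': "c' \<in> ?P" "\<forall>A'\<in>c'. \<exists>A\<in>c. hausdorff_close e A A'" for c'
      proof -
        have "A' \<in> U" if A': "A' \<in> c'" for A'
        proof -
          obtain A where A: "A \<in> c" "hausdorff_close e A A'" using c' A' by blast
          then obtain B where B: "B \<in> F" "A \<in> \<O> B" using F by blast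
          then have "B \<in> c" using F by blast
          have "hausdorff_close (\<epsilon> B) B A" using h[OF \<open>B \<in> c\<close>] B by blast
          moreover have "hausdorff_close (\<epsilon> B) A A'" using A(2) e(2)[OF B(1)] by (rule hausdorff_close_mono)
          ultimately have "hausdorff_close (\<epsilon> B + \<epsilon> B) B A'" by (rule hausdorff_close_trans)
          then show ?thesis using h[OF \<open>B \<in> c\<close>] sub[OF c'(1)] A' by blast
        qed
        then show ?thesis using 1 c' by blast
      qed
      then show ?thesis using e(1) by blast
    next
      case (2 U)
      then obtain A where A: "A \<in> c" "A \<in> U" using Basis by blast
      obtain e where e: "e > 0" "\<forall>B\<in>?VP. hausdorff_close e A B \<longrightarrow> B \<in> U"
        using vietoris_open_imp_hausdorff_close[OF 2(1) A(2)] by blast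
      have "c' \<in> s" if c': "c' \<in> ?P" "\<forall>A\<in>c. \<exists>A'\<in>c'. hausdorff_close e A A'" for c'
      proof -
        obtain A' where "A' \<in> c'" "hausdorff_close e A A'" using A c' by blast
        then have "A' \<in> c' \<inter> U" using e sub[OF c'(1)] by blast
        then show ?thesis using 2 c' by blast
      qed
      then show ?thesis using e(1) by blast
    qed
  qed simp
qed

section \<open>Crooked functions on an interval\<close>

text \<open>This is the usual crookedness of maps of the interval: on the way from
  \<open>f p\<close> to \<open>f q\<close> the function nearly reaches \<open>f q\<close>, then
  returns nearly to \<open>f p\<close>, before it ends. Only the order \<open>u \<le> v\<close>
  carries the information.\<close>

definition crooked_on :: "real \<Rightarrow> (real \<Rightarrow> real) \<Rightarrow> real \<Rightarrow> real \<Rightarrow> bool" where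
  "crooked_on \<delta> f s t \<longleftrightarrow> (\<forall>p q. s \<le> p \<longrightarrow> p \<le> q \<longrightarrow> q \<le> t \<longrightarrow>
     (\<exists>u v. p \<le> u \<and> u \<le> v \<and> v \<le> q \<and> \<bar>f u - f q\<bar> \<le> \<delta> \<and> \<bar>f v - f p\<bar> \<le> \<delta>))"

lemma crooked_onE:
  assumes "crooked_on \<delta> f s t" "s \<le> p" "p \<le> q" "q \<le> t"
  obtains u v where "p \<le> u" "u \<le> v" "v \<le> q" "\<bar>f u - f q\<bar> \<le> \<delta>" "\<bar>f v - f p\<bar> \<le> \<delta>"
  using assms unfolding crooked_on_def by blast

text \<open>Either \<open>y\<close> lies between the two end values and the intermediate value
  theorem applies, or \<open>y\<close> falls in the gap between \<open>f r\<close> and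
  \<open>z\<close>, and then \<open>r\<close> itself is good enough.\<close>

lemma near_hit_left:
  fixes f :: "real \<Rightarrow> real"
  assumes "continuous_on {l..r} f" "l \<le> r" "\<bar>f r - z\<bar> \<le> \<delta>" "f l \<le> y \<and> y \<le> z \<or> z \<le> y \<and> y \<le> f l"
  obtains u where "l \<le> u" "u \<le> r" "\<bar>f u - y\<bar> \<le> \<delta>"
proof -
  have "\<exists>u. l \<le> u \<and> u \<le> r \<and> f u = y" if "f l \<le> y" "y \<le> f r"
    using IVT'[of f l y r] assms(1,2) that by blast
  moreover have "\<exists>u. l \<le> u \<and> u \<le> r \<and> f u = y" if "f r \<le> y" "y \<le> f l"
    using IVT2'[of f r y l] assms(1,2) that by blast
  moreover have "\<bar>f r - y\<bar> \<le> \<delta>" if "\<not> (f l \<le> y \<and> y \<le> f r)" "\<not> (f r \<le> y \<and> y \<le> f l)"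
    using that assms(3,4) by linarith
  moreover have "\<delta> \<ge> 0" using assms(3) by linarith
  ultimately show thesis using assms(2) that by (metis abs_zero diff_self order_refl)
qed

lemma near_hit_right:
  fixes f :: "real \<Rightarrow> real"
  assumes "continuous_on {l..r} f" "l \<le> r" "\<bar>f l - z\<bar> \<le> \<delta>" "f r \<le> y \<and> y \<le> z \<or> z \<le> y \<and> y \<le> f r"
  obtains u where "l \<le> u" "u \<le> r" "\<bar>f u - y\<bar> \<le> \<delta>"
proof -
  have "continuous_on {-r..-l} (\<lambda>t. f (- t))"
    by (rule continuous_on_compose2[OF assms(1)]) (auto intro!: continuous_intros)
  then obtain u where "-r \<le> u" "u \<le> -l" "\<bar>f (-u) - y\<bar> \<le> \<delta>"
    using near_hit_left[of "-r" "-l" "\<lambda>t. f (-t)" z \<delta> y] assms by auto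
  then show thesis using that[of "-u"] by simp
qed

text \<open>The pattern is a zigzag: up to \<open>b - \<delta>\<close>, down to
  \<open>a + \<delta>\<close>, up to \<open>b\<close>. Stopping short of the extremes by
  \<open>\<delta>\<close> is within the tolerance of crookedness, so a rise and the following
  descent nearly take all values involved. When \<open>p\<close> and \<open>q\<close> lie in
  different pieces, crookedness of one piece supplies a pair in the right order and
  \<open>near_hit_left\<close> or \<open>near_hit_right\<close> corrects the values.\<close>

lemma crooked_on_concat:
  fixes f :: "real \<Rightarrow> real"
  assumes cf: "continuous_on {s0..s3} f" and s: "s0 \<le> s1" "s1 \<le> s2" "s2 \<le> s3" and \<delta>: "\<delta> \<ge> 0"
    and cr: "crooked_on \<delta> f s0 s1" "crooked_on \<delta> f s1 s2" "crooked_on \<delta> f s2 s3"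
    and v: "f s1 = b - \<delta>" "f s2 = a + \<delta>"
    and r1: "\<And>t. s0 \<le> t \<Longrightarrow> t \<le> s1 \<Longrightarrow> a \<le> f t \<and> f t \<le> b - \<delta>"
    and r2: "\<And>t. s1 \<le> t \<Longrightarrow> t \<le> s2 \<Longrightarrow> a + \<delta> \<le> f t \<and> f t \<le> b - \<delta>"
    and r3: "\<And>t. s2 \<le> t \<Longrightarrow> t \<le> s3 \<Longrightarrow> a + \<delta> \<le> f t \<and> f t \<le> b"
  shows "crooked_on \<delta> f s0 s3"
  unfolding crooked_on_def
proof (intro allI impI)
  fix p q assume pq: "s0 \<le> p" "p \<le> q" "q \<le> s3"
  let ?G = "\<exists>u v. p \<le> u \<and> u \<le> v \<and> v \<le> q \<and> \<bar>f u - f q\<bar> \<le> \<delta> \<and> \<bar>f v - f p\<bar> \<le> \<delta>"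
  have cont: "continuous_on {l..r} f" if "s0 \<le> l" "r \<le> s3" for l r
    using that by (intro continuous_on_subset[OF cf]) auto
  have c12: ?G if p: "p \<le> s1" and q: "s1 \<le> q" "q \<le> s2"
  proof (cases "f p \<le> f q")
    case True
    obtain u' v' where uv: "p \<le> u'" "u' \<le> v'" "v' \<le> s1" "\<bar>f u' - f s1\<bar> \<le> \<delta>" "\<bar>f v' - f p\<bar> \<le> \<delta>"
      using crooked_onE[OF cr(1) pq(1) p order_refl] .
    obtain u where "p \<le> u" "u \<le> u'" "\<bar>f u - f q\<bar> \<le> \<delta>"
      by (rule near_hit_left[OF cont[of p u'] _ uv(4), of "f q"]) (use uv p q s pq v True r2[of q] in auto)
    then show ?thesis using uv q by (intro exI[of _ u] exI[of _ v']) linarith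
  next
    case False
    obtain u' v' where uv: "s1 \<le> u'" "u' \<le> v'" "v' \<le> q" "\<bar>f u' - f q\<bar> \<le> \<delta>" "\<bar>f v' - f s1\<bar> \<le> \<delta>"
      using crooked_onE[OF cr(2) order_refl q] .
    obtain w where "v' \<le> w" "w \<le> q" "\<bar>f w - f p\<bar> \<le> \<delta>"
      by (rule near_hit_right[OF cont[of v' q] _ uv(5), of "f p"]) (use uv p q s pq v False r1[of p] in auto)
    then show ?thesis using uv p by (intro exI[of _ u'] exI[of _ w]) linarith
  qed
  have c23: ?G if p: "s1 \<le> p" "p \<le> s2" and q: "s2 \<le> q"
  proof (cases "f p \<le> f q")
    case True
    obtain u' v' where uv: "s2 \<le> u'" "u' \<le> v'" "v' \<le> q" "\<bar>f u' - f q\<bar> \<le> \<delta>" "\<bar>f v' - f s2\<bar> \<le> \<delta>"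
      using crooked_onE[OF cr(3) order_refl q pq(3)] .
    obtain w where "v' \<le> w" "w \<le> q" "\<bar>f w - f p\<bar> \<le> \<delta>"
      by (rule near_hit_right[OF cont[of v' q] _ uv(5), of "f p"]) (use uv p q s pq v True r2[of p] in auto)
    then show ?thesis using uv p by (intro exI[of _ u'] exI[of _ w]) linarith
  next
    case False
    obtain u' v' where uv: "p \<le> u'" "u' \<le> v'" "v' \<le> s2" "\<bar>f u' - f s2\<bar> \<le> \<delta>" "\<bar>f v' - f p\<bar> \<le> \<delta>"
      using crooked_onE[OF cr(2) p(1,2) order_refl] .
    obtain u where "p \<le> u" "u \<le> u'" "\<bar>f u - f q\<bar> \<le> \<delta>"
      by (rule near_hit_left[OF cont[of p u'] _ uv(4), of "f q"]) (use uv p q s pq v False r3[of q] in auto)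
    then show ?thesis using uv q by (intro exI[of _ u] exI[of _ v']) linarith
  qed
  \<comment> \<open>If \<open>f p \<le> f q\<close>, the first rise passes near \<open>f q\<close>
    and the descent then passes near \<open>f p\<close>. Otherwise both values lie in the range of
    the descent, and crookedness of the descent alone reverses their order.\<close>
  have c13: ?G if p: "p \<le> s1" and q: "s2 \<le> q"
  proof (cases "f p \<le> f q")
    case True
    have z: "\<bar>f s1 - b\<bar> \<le> \<delta>" "\<bar>f s2 - a\<bar> \<le> \<delta>" using v \<delta> by auto
    obtain u where "p \<le> u" "u \<le> s1" "\<bar>f u - f q\<bar> \<le> \<delta>"
      by (rule near_hit_left[OF cont[of p s1] _ z(1), of "f q"]) (use p q s pq v True r3[of q] in auto)
    moreover have "f p \<le> f s1" using r1[of p] v p pq by simp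
    then obtain w where "s1 \<le> w" "w \<le> s2" "\<bar>f w - f p\<bar> \<le> \<delta>"
      using near_hit_left[OF cont[of s1 s2] _ z(2), of "f p"] p s pq r1[of p] by auto
    ultimately show ?thesis using q by (intro exI[of _ u] exI[of _ w]) linarith
  next
    case False
    obtain u' v' where uv: "s1 \<le> u'" "u' \<le> v'" "v' \<le> s2" "\<bar>f u' - f s2\<bar> \<le> \<delta>" "\<bar>f v' - f s1\<bar> \<le> \<delta>"
      using crooked_onE[OF cr(2) order_refl s(2) order_refl] .
    obtain u where u: "s1 \<le> u" "u \<le> u'" "\<bar>f u - f q\<bar> \<le> \<delta>"
      by (rule near_hit_left[OF cont[of s1 u'] _ uv(4), of "f q"])
        (use uv p q s pq v False r3[of q] r1[of p] in auto)
    obtain w where "v' \<le> w" "w \<le> s2" "\<bar>f w - f p\<bar> \<le> \<delta>"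
      by (rule near_hit_right[OF cont[of v' s2] _ uv(5), of "f p"])
        (use uv p q s pq v False r3[of q] r1[of p] in auto)
    then show ?thesis using u uv p q by (intro exI[of _ u] exI[of _ w]) linarith
  qed
  consider "q \<le> s1" | "s2 \<le> p" | "s1 \<le> p" "q \<le> s2" | "p \<le> s1" "s1 \<le> q" "q \<le> s2"
    | "s1 \<le> p" "p \<le> s2" "s2 \<le> q" | "p \<le> s1" "s2 \<le> q"
    by linarith
  then show ?G
  proof cases
    case 1 then show ?thesis using cr(1) pq unfolding crooked_on_def by blast
  next
    case 2 then show ?thesis using cr(3) pq unfolding crooked_on_def by blast
  next
    case 3 then show ?thesis using cr(2) pq unfolding crooked_on_def by blast
  qed (use c12 c23 c13 in blast)+
qed

lemma crooked_on_cong: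
  assumes "crooked_on \<delta> f s t" "\<And>x. s \<le> x \<Longrightarrow> x \<le> t \<Longrightarrow> g x = f x"
  shows "crooked_on \<delta> g s t"
  unfolding crooked_on_def
proof (intro allI impI)
  fix p q assume "s \<le> p" "p \<le> q" "q \<le> t"
  then obtain u v where "p \<le> u" "u \<le> v" "v \<le> q" "\<bar>f u - f q\<bar> \<le> \<delta>" "\<bar>f v - f p\<bar> \<le> \<delta>"
    using crooked_onE[OF assms(1)] by metis
  then show "\<exists>u v. p \<le> u \<and> u \<le> v \<and> v \<le> q \<and> \<bar>g u - g q\<bar> \<le> \<delta> \<and> \<bar>g v - g p\<bar> \<le> \<delta>"
    using assms(2) \<open>s \<le> p\<close> \<open>q \<le> t\<close> by (intro exI[of _ u] exI[of _ v]) simp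
qed

text \<open>Induction on the height of the range in units of \<open>\<delta>\<close>: every piece of
  the zigzag is lower by at least \<open>\<delta>\<close>. The base height is
  \<open>2 * \<delta>\<close> because there a monotone function is crooked with \<open>u = v\<close>
  at the mean of the two values.\<close>

lemma crooked_exists_aux:
  fixes \<delta> :: real
  assumes "\<delta> > 0"
  shows "a \<le> b \<Longrightarrow> b - a \<le> (real n + 2) * \<delta> \<Longrightarrow> s < t \<Longrightarrow>
    \<exists>f. continuous_on {s..t} f \<and> f s = a \<and> f t = b \<and> (\<forall>x\<in>{s..t}. a \<le> f x \<and> f x \<le> b) \<and> crooked_on \<delta> f s t"
proof (induction n arbitrary: a b s t)
  case 0
  define f where "f x = a + (b - a) * ((x - s) / (t - s))" for x
  have mono: "f p \<le> f q" if "p \<le> q" for p q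
    unfolding f_def using that 0 by (intro add_left_mono mult_left_mono divide_right_mono) auto
  have fs: "f s = a" "f t = b" unfolding f_def using 0 by auto
  have cont: "continuous_on A f" for A
    unfolding f_def using 0 by (intro continuous_intros) auto
  have "crooked_on \<delta> f s t"
    unfolding crooked_on_def
  proof (intro allI impI)
    fix p q assume pq: "s \<le> p" "p \<le> q" "q \<le> t"
    have "f s \<le> f p" "f p \<le> f q" "f q \<le> f t" using mono pq by auto
    then have d: "f q - f p \<le> 2 * \<delta>" using fs 0 by simp
    obtain u where "p \<le> u" "u \<le> q" "f u = (f p + f q) / 2"
      using IVT'[of f p "(f p + f q) / 2" q] \<open>f p \<le> f q\<close> pq cont by (auto simp: field_simps)
    then show "\<exists>u v. p \<le> u \<and> u \<le> v \<and> v \<le> q \<and> \<bar>f u - f q\<bar> \<le> \<delta> \<and> \<bar>f v - f p\<bar> \<le> \<delta>"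
      using d \<open>f p \<le> f q\<close> by (intro exI[of _ u] conjI) (auto simp: abs_le_iff field_simps)
  qed
  then show ?case using cont fs mono by (intro exI[of _ f]) (metis atLeastAtMost_iff)
next
  case (Suc n)
  show ?case
  proof (cases "b - a \<le> 2 * \<delta>")
    \<comment> \<open>A range this low is already covered by the induction hypothesis; the zigzag
      would need \<open>a + \<delta> \<le> b - \<delta>\<close>.\<close>
    case True
    have "2 * \<delta> \<le> (real n + 2) * \<delta>" using assms by (simp add: mult_right_mono)
    then show ?thesis using Suc True by (intro Suc.IH) linarith+
  next
    case False
    define s1 where "s1 = s + (t - s) / 3"
    define s2 where "s2 = s + 2 * (t - s) / 3"
    have s: "s < s1" "s1 < s2" "s2 < t" using Suc.prems unfolding s1_def s2_def by (auto simp: field_simps)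
    have le: "(b - \<delta>) - a \<le> (real n + 2) * \<delta>" using Suc.prems by (simp add: algebra_simps)
    \<comment> \<open>The descending middle piece is obtained as the negative of an ascending
      function on the reflected range.\<close>
    then have le2: "- (a + \<delta>) - (- (b - \<delta>)) \<le> (real n + 2) * \<delta>" and le3: "b - (a + \<delta>) \<le> (real n + 2) * \<delta>"
      using assms by auto
    have "a \<le> b - \<delta>" "- (b - \<delta>) \<le> - (a + \<delta>)" "a + \<delta> \<le> b" using False assms by auto
    from Suc.IH[OF this(1) le s(1)] Suc.IH[OF this(2) le2 s(2)] Suc.IH[OF this(3) le3 s(3)]
    obtain f1 f2 f3 where
      f1: "continuous_on {s..s1} f1" "f1 s = a" "f1 s1 = b - \<delta>" "\<forall>x\<in>{s..s1}. a \<le> f1 x \<and> f1 x \<le> b - \<delta>" "crooked_on \<delta> f1 s s1" and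
      f2: "continuous_on {s1..s2} f2" "f2 s1 = - (b - \<delta>)" "f2 s2 = - (a + \<delta>)" "\<forall>x\<in>{s1..s2}. - (b - \<delta>) \<le> f2 x \<and> f2 x \<le> - (a + \<delta>)" "crooked_on \<delta> f2 s1 s2" and
      f3: "continuous_on {s2..t} f3" "f3 s2 = a + \<delta>" "f3 t = b" "\<forall>x\<in>{s2..t}. a + \<delta> \<le> f3 x \<and> f3 x \<le> b" "crooked_on \<delta> f3 s2 t"
      by blast
    define f where "f x = (if x \<le> s1 then f1 x else if x \<le> s2 then - f2 x else f3 x)" for x
    have e1: "f x = f1 x" if "x \<le> s1" for x using that by (simp add: f_def)
    have e2: "f x = - f2 x" if "s1 \<le> x" "x \<le> s2" for x using that f1(3) f2(2) by (auto simp: f_def)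
    have e3: "f x = f3 x" if "s2 \<le> x" for x using that s(2) f2(3) f3(2) by (auto simp: f_def)
    have c1: "continuous_on {s..s1} f" using f1(1) by (rule continuous_on_cong[THEN iffD1, rotated 2]) (auto simp: e1)
    have "continuous_on {s1..s2} (\<lambda>x. - f2 x)" using f2(1) by (intro continuous_intros)
    then have c2: "continuous_on {s1..s2} f" by (rule continuous_on_cong[THEN iffD1, rotated 2]) (auto simp: e2)
    have c3: "continuous_on {s2..t} f" using f3(1) by (rule continuous_on_cong[THEN iffD1, rotated 2]) (auto simp: e3)
    have "continuous_on ({s..s1} \<union> {s1..s2} \<union> {s2..t}) f"
      using c1 c2 c3 by (intro continuous_on_closed_Un closed_Un) auto
    moreover have "{s..s1} \<union> {s1..s2} \<union> {s2..t} = {s..t}" using s by auto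
    ultimately have cf: "continuous_on {s..t} f" by simp
    have k1: "crooked_on \<delta> f s s1" using f1(5) by (rule crooked_on_cong) (auto simp: e1)
    have "crooked_on \<delta> (\<lambda>x. - f2 x) s1 s2" using f2(5) unfolding crooked_on_def by (simp add: abs_minus_commute)
    then have k2: "crooked_on \<delta> f s1 s2" by (rule crooked_on_cong) (auto simp: e2)
    have k3: "crooked_on \<delta> f s2 t" using f3(5) by (rule crooked_on_cong) (auto simp: e3)
    have r1: "a \<le> f x \<and> f x \<le> b - \<delta>" if "s \<le> x" "x \<le> s1" for x using f1(4) that by (simp add: e1)
    have r2: "a + \<delta> \<le> f x \<and> f x \<le> b - \<delta>" if "s1 \<le> x" "x \<le> s2" for x
      using f2(4) that by (force simp: e2)
    have r3: "a + \<delta> \<le> f x \<and> f x \<le> b" if "s2 \<le> x" "x \<le> t" for x using f3(4) that by (simp add: e3)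
    have "crooked_on \<delta> f s t"
      by (rule crooked_on_concat[OF cf _ _ _ _ k1 k2 k3 _ _ r1 r2 r3]) (use s assms f1(3) f3(2) in \<open>auto simp: e1 e3\<close>)
    moreover have "f s = a" "f t = b" using s f1(2) f3(3) by (auto simp: e1 e3)
    moreover have "\<forall>x\<in>{s..t}. a \<le> f x \<and> f x \<le> b"
    proof
      fix x assume "x \<in> {s..t}"
      then consider "s \<le> x" "x \<le> s1" | "s1 \<le> x" "x \<le> s2" | "s2 \<le> x" "x \<le> t" by force
      then show "a \<le> f x \<and> f x \<le> b"
        using r1[of x] r2[of x] r3[of x] assms by cases auto
    qed
    ultimately show ?thesis using cf by blast
  qed
qed

lemma crooked_exists:
  fixes \<delta> :: real
  assumes "\<delta> > 0"
  obtains f where "continuous_on {0..1} f" "f 0 = 0" "f 1 = (1::real)" "f ` {0..1} \<subseteq> {0..1}" "crooked_on \<delta> f 0 1"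
proof -
  obtain n where "1 / \<delta> \<le> real n" using real_arch_simple by blast
  then have "1 - 0 \<le> (real n + 2) * \<delta>" using assms by (simp add: field_simps)
  from crooked_exists_aux[OF assms _ this, of 0 1]
  obtain f where "continuous_on {0..1} f" "f 0 = 0" "f 1 = (1::real)" "\<forall>x\<in>{0..1}. 0 \<le> f x \<and> f x \<le> 1" "crooked_on \<delta> f 0 1"
    by auto
  then show thesis by (intro that[of f]) auto
qed

section \<open>Paths following a connected chain\<close>

lemma path_through_finite_set:
  assumes "finite F" "\<And>z. z \<in> F \<Longrightarrow> path_component U x z" "x \<in> U"
  obtains g where "path g" "pathstart g = x" "path_image g \<subseteq> U" "F \<subseteq> path_image g"
proof -
  have "\<exists>g. path g \<and> pathstart g = x \<and> path_image g \<subseteq> U \<and> F \<subseteq> path_image g"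
    using assms(1,2)
  proof (induction F)
    case empty
    show ?case using assms(3) by (intro exI[of _ "\<lambda>_. x"]) (auto simp: path_def path_image_def pathstart_def)
  next
    case (insert z F)
    then obtain g where g: "path g" "pathstart g = x" "path_image g \<subseteq> U" "F \<subseteq> path_image g" by auto
    have "path_component U x (pathfinish g)"
      using g unfolding path_component_def by blast
    then have "path_component U (pathfinish g) z"
      using insert.prems[of z] by (meson insertI1 path_component_sym path_component_trans)
    then obtain h where h: "path h" "path_image h \<subseteq> U" "pathstart h = pathfinish g" "pathfinish h = z"
      unfolding path_component_def by blast
    have "z \<in> path_image h" using h(4) pathfinish_in_path_image by blast
    then show ?case
      using g h by (intro exI[of _ "g +++ h"]) (auto simp: path_image_join)
  qed
  then show thesis using that by blast
qed

lemma joinpaths_image_initial_left: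
  assumes "0 \<le> t" "t \<le> 1/2"
  shows "(g +++ h) ` {0..t} = g ` {0..2*t}"
proof -
  have "(g +++ h) ` {0..t} = (\<lambda>x. g (2 * x)) ` {0..t}"
    using assms by (intro image_cong) (auto simp: joinpaths_def)
  also have "\<dots> = g ` ((\<lambda>x. 2 * x) ` {0..t})" by (simp only: image_image)
  also have "(\<lambda>x. 2 * x) ` {0..t} = {0..2 * t}"
    using image_mult_atLeastAtMost[of 2 0 t] by simp
  finally show ?thesis .
qed

lemma joinpaths_image_initial_right:
  assumes "1/2 \<le> t" "t \<le> 1" "pathfinish g = pathstart h"
  shows "path_image g \<subseteq> (g +++ h) ` {0..t}" "(g +++ h) ` {0..t} \<subseteq> path_image g \<union> path_image h"
proof -
  have "path_image g = (g +++ h) ` {0..1/2}"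
    using joinpaths_image_initial_left[of "1/2" g h] by (simp add: path_image_def)
  also have "\<dots> \<subseteq> (g +++ h) ` {0..t}" using assms by (intro image_mono) auto
  finally show "path_image g \<subseteq> (g +++ h) ` {0..t}" .
  have "(g +++ h) ` {0..t} \<subseteq> path_image (g +++ h)"
    using assms by (auto simp: path_image_def)
  then show "(g +++ h) ` {0..t} \<subseteq> path_image g \<union> path_image h"
    by (simp add: path_image_join assms)
qed

text \<open>The end is matched within \<open>e/2\<close> but the intermediate traces only within
  \<open>e\<close>: the spare \<open>e/2\<close> pays for the next extension step. Of
  \<open>c\<close>, only the members below \<open>A\<close> have to be traced so far.\<close>

definition path_follows_chain ::
  "'a::metric_space set set \<Rightarrow> real \<Rightarrow> 'a set \<Rightarrow> (real \<Rightarrow> 'a) \<Rightarrow> bool" where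
  "path_follows_chain c e A g \<longleftrightarrow> path g \<and> hausdorff_close (e/2) (path_image g) A \<and>
     (\<forall>t\<in>{0..1}. \<exists>B\<in>c. hausdorff_close e (g ` {0..t}) B) \<and>
     (\<forall>B\<in>c. B \<subseteq> A \<longrightarrow> (\<exists>t\<in>{0..1}. hausdorff_close e (g ` {0..t}) B))"

text \<open>The path is continued inside the \<open>e/2\<close>-neighbourhood \<open>U\<close> of
  \<open>B\<close>. As \<open>U\<close> is locally path connected and \<open>B\<close> is connected,
  all of \<open>B\<close> lies in one path component of \<open>U\<close>, so the continuation can
  visit a finite \<open>e/2\<close>-net of \<open>B\<close>. Throughout it the trace stays in
  \<open>U\<close> and contains the old path, which is \<open>e/2\<close>-close to \<open>A\<close>;
  since \<open>B\<close> is within \<open>e/2\<close> of \<open>A\<close>, the trace is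
  \<open>e\<close>-close to \<open>B\<close>.\<close>

lemma path_follows_chain_extend:
  fixes S :: "'a::metric_space set"
  assumes S: "locally path_connected S" and c: "chain\<^sub>\<subseteq> c" and e: "e > 0"
    and g: "path_follows_chain c e A g" "path_image g \<subseteq> S" "pathstart g = x" "x \<in> A"
    and AB: "A \<in> c" "B \<in> c" "A \<subseteq> B" "B \<subseteq> S" "compact B" "connected B"
      "\<And>y. y \<in> B \<Longrightarrow> \<exists>a\<in>A. dist a y < e/2"
  shows "\<exists>g'. path_follows_chain c e B g' \<and> path_image g' \<subseteq> S \<and> pathstart g' = x"
proof -
  define U where "U = S \<inter> (\<Union>b\<in>B. ball b (e/2))"
  have oU: "openin (top_of_set S) U" unfolding U_def by (intro openin_open_Int open_UN) auto
  have BU: "B \<subseteq> U" using AB e unfolding U_def by auto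
  have pg: "path g" "hausdorff_close (e/2) (path_image g) A" using g(1) unfolding path_follows_chain_def by auto
  have gU: "path_image g \<subseteq> U"
  proof
    fix p assume p: "p \<in> path_image g"
    then obtain a where "a \<in> A" "dist p a < e/2" using pg unfolding hausdorff_close_def by blast
    then have "p \<in> ball a (e/2)" "a \<in> B" using AB by (auto simp: dist_commute)
    then show "p \<in> U" using p g(2) unfolding U_def by blast
  qed
  have "path_component U (pathfinish g) x"
    using pg(1) gU g(3) path_component_sym unfolding path_component_def by metis
  moreover have "path_component U x z" if "z \<in> B" for z
  proof -
    have "connected_component U x z"
      unfolding connected_component_def using that g(4) AB BU by blast
    moreover have "locally path_connected U" using S oU by (rule locally_open_subset)
    ultimately show ?thesis by (simp add: path_component_eq_connected_component)
  qed
  ultimately have pc: "path_component U (pathfinish g) z" if "z \<in> B" for z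
    using that path_component_trans by metis
  obtain F where F: "F \<subseteq> B" "finite F" "B \<subseteq> (\<Union>z\<in>F. ball z (e/2))"
    using compactE_image[OF AB(5), of B "\<lambda>z. ball z (e/2)"] e
    by (metis UN_I centre_in_ball half_gt_zero open_ball subsetI)
  obtain h where h: "path h" "pathstart h = pathfinish g" "path_image h \<subseteq> U" "F \<subseteq> path_image h"
    by (rule path_through_finite_set[OF F(2), of U "pathfinish g"])
      (use pc F gU in \<open>auto simp: pathfinish_in_path_image subset_iff\<close>)
  define k where "k = g +++ h"
  have k: "path k" "path_image k = path_image g \<union> path_image h" "pathstart k = x"
    using pg h g(3) unfolding k_def by (auto simp: path_image_join)
  have kU: "path_image k \<subseteq> U" using k gU h by blast
  have near_B: "\<exists>b\<in>B. dist p b < e/2" if "p \<in> U" for p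
    using that unfolding U_def by (auto simp: dist_commute)
  have B_near: "\<exists>p\<in>path_image k. dist p b < e/2" if "b \<in> B" for b
    using F(3) h(4) k(2) that by (fastforce simp: subset_iff)
  have 1: "hausdorff_close (e/2) (path_image k) B"
    unfolding hausdorff_close_def using near_B B_near kU by blast
  have 2: "\<exists>C\<in>c. hausdorff_close e (k ` {0..t}) C" if t: "t \<in> {0..1}" for t
  proof (cases "t \<le> 1/2")
    case True
    then have "k ` {0..t} = g ` {0..2*t}" "2 * t \<in> {0..1}"
      using t joinpaths_image_initial_left[of t g h] unfolding k_def by auto
    then show ?thesis using g(1) unfolding path_follows_chain_def by metis
  next
    case False
    then have s: "path_image g \<subseteq> k ` {0..t}" "k ` {0..t} \<subseteq> path_image k"
      using t joinpaths_image_initial_right[of t g h] h(2) k(2) unfolding k_def by auto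
    have "hausdorff_close e (k ` {0..t}) B"
      unfolding hausdorff_close_def
    proof (intro conjI ballI)
      fix p assume "p \<in> k ` {0..t}"
      then have "p \<in> U" using s kU by blast
      then show "\<exists>b\<in>B. dist p b < e" using near_B[of p] e by force
    next
      fix b assume "b \<in> B"
      then obtain a where a: "a \<in> A" "dist a b < e/2" using AB(7) by blast
      then obtain p where p: "p \<in> path_image g" "dist p a < e/2"
        using pg(2) unfolding hausdorff_close_def by blast
      have "dist p b < e" using dist_triangle[of p b a] a p by linarith
      then show "\<exists>p\<in>k ` {0..t}. dist p b < e" using p s by blast
    qed
    then show ?thesis using AB by blast
  qed
  have 3: "\<exists>t\<in>{0..1}. hausdorff_close e (k ` {0..t}) C" if C: "C \<in> c" "C \<subseteq> B" for C
  proof (cases "C \<subseteq> A")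
    case True
    then obtain t where "t \<in> {0..1}" "hausdorff_close e (g ` {0..t}) C"
      using g(1) C unfolding path_follows_chain_def by blast
    then show ?thesis
      using joinpaths_image_initial_left[of "t/2" g h] unfolding k_def
      by (intro bexI[of _ "t/2"]) auto
  next
    case False
    \<comment> \<open>A member between \<open>A\<close> and \<open>B\<close> is close to both, so
      the complete path serves as its trace.\<close>
    then have AC: "A \<subseteq> C" using c C AB unfolding chain_subset_def by blast
    have "hausdorff_close e (path_image k) C"
      unfolding hausdorff_close_def
    proof (intro conjI ballI)
      fix p assume "p \<in> path_image k"
      then obtain b where b: "b \<in> B" "dist p b < e/2" using near_B kU by blast
      then obtain a where a: "a \<in> A" "dist a b < e/2" using AB(7) by blast
      have "dist p a < e" using dist_triangle2[of p a b] a b by linarith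
      then show "\<exists>b\<in>C. dist p b < e" using a AC by blast
    next
      fix y assume "y \<in> C"
      then obtain p where "p \<in> path_image k" "dist p y < e/2" using C B_near by blast
      then show "\<exists>p\<in>path_image k. dist p y < e" using e by force
    qed
    then show ?thesis by (intro bexI[of _ 1]) (auto simp: path_image_def)
  qed
  show ?thesis using 1 2 3 k kU unfolding path_follows_chain_def U_def by blast
qed

text \<open>Connectedness of \<open>c\<close> serves as an induction principle, so no
  parametrisation of the chain is needed: a non-empty subset of \<open>c\<close> that is stable
  under steps of Hausdorff size \<open>e/2\<close> inside \<open>c\<close> is all of
  \<open>c\<close>. The start is the constant path at \<open>x\<close>.\<close>

lemma connected_chain_followed_by_path:
  fixes S :: "'a::metric_space set"
  assumes S: "compact S" "S \<noteq> {}" "locally path_connected S"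
    and c: "c \<in> topspace (connected_chains (top_of_set S))" and e: "e > 0"
  obtains g where "path g" "path_image g \<subseteq> S"
    "\<And>t. t \<in> {0..1} \<Longrightarrow> \<exists>B\<in>c. hausdorff_close e (g ` {0..t}) B"
    "\<And>B. B \<in> c \<Longrightarrow> \<exists>t\<in>{0..1}. hausdorff_close e (g ` {0..t}) B"
proof -
  let ?X = "top_of_set S"
  have X: "compact_space ?X" "Hausdorff_space ?X" "topspace ?X \<noteq> {}"
    using S by (auto simp: compact_space_subtopology Hausdorff_space_subtopology Hausdorff_space_euclidean)
  have c': "c \<in> vietoris_points (vietoris ?X)" "chain\<^sub>\<subseteq> c" "connectedin (vietoris ?X) c" "S \<in> c"
    using c X by (auto simp: in_connected_chains_iff)
  obtain x where x: "{x} \<in> c" using c X by (auto simp: in_connected_chains_iff)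
  have sub: "compact A" "A \<subseteq> S" "A \<noteq> {}" "connected A" if "A \<in> c" for A
    using connected_chains_members[OF X c] that connected_chains_member_connected[OF X c that]
    by (auto simp: subset_iff vietoris_points_top_of_set connectedin_subtopology)
  have xA: "x \<in> A" if "A \<in> c" for A
  proof -
    have "A \<subseteq> {x} \<or> {x} \<subseteq> A" using c'(2) x that unfolding chain_subset_def by blast
    then show ?thesis using sub(3)[OF that] by blast
  qed
  define Good where "Good A \<longleftrightarrow> (\<exists>g. path_follows_chain c e A g \<and> path_image g \<subseteq> S \<and> pathstart g = x)" for A
  have Good0: "Good {x}"
  proof -
    have "hausdorff_close r {x} {x}" if "r > 0" for r using that by (simp add: hausdorff_close_def)
    moreover have "C = {x}" if "C \<in> c" "C \<subseteq> {x}" for C using sub[OF that(1)] that by blast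
    ultimately show ?thesis
      unfolding Good_def path_follows_chain_def using x e sub(2)[OF x]
      by (intro exI[of _ "\<lambda>_. x"]) (auto simp: path_image_def path_def pathstart_def image_constant_conv)
  qed
  \<comment> \<open>Closing the good members downwards makes a step to a smaller member trivial;
    only a step beyond \<open>A'\<close> calls for an extension of its path.\<close>
  define D where "D = {A \<in> c. \<exists>A'\<in>c. A \<subseteq> A' \<and> Good A'}"
  have step: "B' \<in> D" if B: "B \<in> D" "B' \<in> c" "hausdorff_close (e/2) B B'" for B B'
  proof -
    obtain A' where A': "A' \<in> c" "B \<subseteq> A'" "Good A'" using B unfolding D_def by blast
    show ?thesis
    proof (cases "B' \<subseteq> A'")
      case True then show ?thesis using A' B unfolding D_def by blast
    next
      case False
      then have "A' \<subseteq> B'" using c'(2) A' B unfolding chain_subset_def by blast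
      moreover obtain g where "path_follows_chain c e A' g" "path_image g \<subseteq> S" "pathstart g = x"
        using A' unfolding Good_def by blast
      moreover have "\<exists>a\<in>A'. dist a y < e/2" if "y \<in> B'" for y
        using B(3) A'(2) that unfolding hausdorff_close_def by blast
      ultimately have "Good B'"
        unfolding Good_def
        using path_follows_chain_extend[OF S(3) c'(2) e, of A' g x B'] A' B xA sub[of B'] by blast
      then show ?thesis using B unfolding D_def by blast
    qed
  qed
  \<comment> \<open>Radius \<open>e/4\<close>, so that a member of \<open>c\<close> shared by two
    such neighbourhoods puts their centres within one step \<open>e/2\<close>.\<close>
  have "\<exists>\<U>. openin (vietoris ?X) \<U> \<and> A \<in> \<U> \<and> (\<forall>B\<in>\<U>. hausdorff_close (e/4) A B)" if "A \<in> c" for A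
    using hausdorff_close_vietoris_neighbourhood[of A S "e/4"] e that sub[of A]
    by (metis divide_pos_pos vietoris_points_top_of_set zero_less_numeral)
  then obtain \<U> where U: "\<And>A. A \<in> c \<Longrightarrow> openin (vietoris ?X) (\<U> A)" "\<And>A. A \<in> c \<Longrightarrow> A \<in> \<U> A"
    "\<And>A B. A \<in> c \<Longrightarrow> B \<in> \<U> A \<Longrightarrow> hausdorff_close (e/4) A B" by metis
  have "S \<in> D"
  proof (rule ccontr)
    assume "S \<notin> D"
    let ?E1 = "\<Union>(\<U> ` D)" and ?E2 = "\<Union>(\<U> ` (c - D))"
    have D: "D \<subseteq> c" unfolding D_def by blast
    have "openin (vietoris ?X) ?E1" "openin (vietoris ?X) ?E2" using U(1) D by auto
    moreover have "c \<subseteq> ?E1 \<union> ?E2"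
    proof
      fix A assume "A \<in> c"
      with U(2)[OF this] show "A \<in> ?E1 \<union> ?E2" by (cases "A \<in> D") auto
    qed
    moreover have "?E1 \<inter> ?E2 \<inter> c = {}"
    proof (rule ccontr)
      assume "?E1 \<inter> ?E2 \<inter> c \<noteq> {}"
      then obtain B A1 A2 where B: "B \<in> c" "A1 \<in> D" "B \<in> \<U> A1" "A2 \<in> c" "A2 \<notin> D" "B \<in> \<U> A2" by auto
      have "A1 \<in> c" using B D by blast
      have "hausdorff_close (e/4 + e/4) A1 A2"
        using hausdorff_close_trans[OF U(3)[OF \<open>A1 \<in> c\<close> B(3)] hausdorff_close_sym[OF U(3)[OF B(4,6)]]] .
      then have "A2 \<in> D" using step B by simp
      then show False using B by blast
    qed
    moreover have "{x} \<in> D" unfolding D_def using x Good0 by blast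
    then have "{x} \<in> ?E1 \<inter> c" using U(2)[OF x] x by blast
    then have "?E1 \<inter> c \<noteq> {}" by blast
    moreover have "S \<in> ?E2 \<inter> c" using U(2)[OF c'(4)] c'(4) \<open>S \<notin> D\<close> by blast
    then have "?E2 \<inter> c \<noteq> {}" by blast
    ultimately show False using connectedinD[OF c'(3), of ?E1 ?E2] by blast
  qed
  then obtain A' where "A' \<in> c" "S \<subseteq> A'" "Good A'" unfolding D_def by blast
  then have "Good S" using sub(2)[of A'] by (metis subset_antisym)
  then show thesis
    using that sub(2) unfolding Good_def path_follows_chain_def by meson
qed

section \<open>Chainability and hereditary indecomposability at a fixed scale\<close>

lemma continuum_top_of_set: "continuum (top_of_set A) \<longleftrightarrow> A \<noteq> {} \<and> compact A \<and> connected (A::'a::metric_space set)"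
  unfolding continuum_def
  by (auto simp: compact_space_subtopology connected_space_subtopology metrizable_space_subtopology
      metrizable_space_euclidean compact_space_def compactin_subtopology connectedin_def[symmetric]
      simp flip: connectedin_topspace)

lemma subcontinuum_top_of_set:
  "subcontinuum (top_of_set A) K \<longleftrightarrow> K \<subseteq> A \<and> K \<noteq> {} \<and> compact K \<and> connected (K::'a::metric_space set)"
proof -
  have "K \<subseteq> A \<Longrightarrow> subtopology (top_of_set A) K = top_of_set K"
    by (simp add: subtopology_subtopology inf.absorb2)
  then show ?thesis
    unfolding subcontinuum_def using continuum_top_of_set[of K] by (metis topspace_euclidean_subtopology)
qed

text \<open>Two overlapping subcontinua, neither inside the other, decompose their union; conversely
  the two parts of a decomposition must overlap because the whole is connected. The condition on
  pairs is the one that can be broken into scales.\<close>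

lemma hereditarily_indecomposable_iff:
  fixes A :: "'a::metric_space set"
  shows "hereditarily_indecomposable (top_of_set A) \<longleftrightarrow>
    (\<forall>L M. subcontinuum (top_of_set A) L \<longrightarrow> subcontinuum (top_of_set A) M \<longrightarrow> L \<inter> M \<noteq> {} \<longrightarrow> L \<subseteq> M \<or> M \<subseteq> L)"
    (is "_ \<longleftrightarrow> ?R")
proof
  assume h: "hereditarily_indecomposable (top_of_set A)"
  show ?R
  proof (intro allI impI)
    fix L M assume LM: "subcontinuum (top_of_set A) L" "subcontinuum (top_of_set A) M" "L \<inter> M \<noteq> {}"
    then have K: "subcontinuum (top_of_set A) (L \<union> M)"
      by (auto simp: subcontinuum_top_of_set compact_Un connected_Un)
    then have "L \<union> M \<subseteq> A" by (simp add: subcontinuum_top_of_set)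
    then have eq: "subtopology (top_of_set A) (L \<union> M) = top_of_set (L \<union> M)"
      by (simp add: subtopology_subtopology inf.absorb2)
    have "indecomposable (top_of_set (L \<union> M))"
      using h K eq unfolding hereditarily_indecomposable_def by metis
    moreover have "subcontinuum (top_of_set (L \<union> M)) L" "subcontinuum (top_of_set (L \<union> M)) M"
      using LM by (auto simp: subcontinuum_top_of_set)
    ultimately have "L = L \<union> M \<or> M = L \<union> M" unfolding indecomposable_def topspace_euclidean_subtopology by blast
    then show "L \<subseteq> M \<or> M \<subseteq> L" by blast
  qed
next
  assume R: ?R
  show "hereditarily_indecomposable (top_of_set A)"
    unfolding hereditarily_indecomposable_def
  proof (intro allI impI)
    fix K assume K: "subcontinuum (top_of_set A) K"
    then have KA: "K \<subseteq> A" "connected K" by (auto simp: subcontinuum_top_of_set)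
    then have eq: "subtopology (top_of_set A) K = top_of_set K"
      by (simp add: subtopology_subtopology inf.absorb2)
    have False if LM: "subcontinuum (top_of_set K) L" "subcontinuum (top_of_set K) M" "L \<noteq> K" "M \<noteq> K" "L \<union> M = K" for L M
    proof -
      have c: "compact L" "compact M" "L \<noteq> {}" "M \<noteq> {}" using LM by (auto simp: subcontinuum_top_of_set)
      have "L \<inter> M \<noteq> {}"
      proof
        assume "L \<inter> M = {}"
        then show False
          using connected_closedD[OF \<open>connected K\<close>, of L M] c LM(5) by (auto simp: compact_imp_closed)
      qed
      moreover have "subcontinuum (top_of_set A) L" "subcontinuum (top_of_set A) M"
        using LM KA by (auto simp: subcontinuum_top_of_set)
      ultimately show False using R LM by blast
    qed
    then show "indecomposable (subtopology (top_of_set A) K)"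
      unfolding eq indecomposable_def topspace_euclidean_subtopology by blast
  qed
qed

text \<open>The links are open in the ambient space, may be empty, and only non-neighbouring links
  must be disjoint, so the same links serve every set near \<open>A\<close>. The missing overlaps of
  neighbouring links are recovered from connectedness in
  \<open>fine_chain_imp_chainable\<close>.\<close>

definition fine_chain :: "real \<Rightarrow> 'a::metric_space set \<Rightarrow> bool" where
  "fine_chain e A \<longleftrightarrow> (\<exists>m (U::nat \<Rightarrow> 'a set). (\<forall>i<m. open (U i)) \<and> (\<forall>i<m. \<forall>x\<in>U i. \<forall>y\<in>U i. dist x y < e) \<and>
     (\<forall>i<m. \<forall>j<m. U i \<inter> U j \<noteq> {} \<longrightarrow> \<bar>int i - int j\<bar> \<le> 1) \<and> A \<subseteq> (\<Union>i<m. U i))"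

lemma openin_fine_chain:
  fixes S :: "'a::metric_space set"
  shows "openin (vietoris (top_of_set S)) {A \<in> vietoris_points (top_of_set S). fine_chain e A}"
proof (subst openin_subopen, intro ballI)
  fix A assume A: "A \<in> {A \<in> vietoris_points (top_of_set S). fine_chain e A}"
  then obtain m and U :: "nat \<Rightarrow> 'a set" where U: "\<forall>i<m. open (U i)" "\<forall>i<m. \<forall>x\<in>U i. \<forall>y\<in>U i. dist x y < e"
     "\<forall>i<m. \<forall>j<m. U i \<inter> U j \<noteq> {} \<longrightarrow> \<bar>int i - int j\<bar> \<le> 1" "A \<subseteq> (\<Union>i<m. U i)"
    unfolding fine_chain_def by blast
  let ?T = "{B \<in> vietoris_points (top_of_set S). B \<subseteq> S \<inter> (\<Union>i<m. U i)}"
  have "openin (vietoris (top_of_set S)) ?T"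
    using U(1) by (intro openin_vietoris_subset openin_open_Int) auto
  moreover have "A \<in> ?T" using A U(4) by (auto simp: vietoris_points_top_of_set)
  moreover have "fine_chain e B" if "B \<subseteq> (\<Union>i<m. U i)" for B
    unfolding fine_chain_def using U(1-3) that by (intro exI[of _ m] exI[of _ U] conjI)
  then have "?T \<subseteq> {A \<in> vietoris_points (top_of_set S). fine_chain e A}" by auto
  ultimately show "\<exists>T. openin (vietoris (top_of_set S)) T \<and> A \<in> T \<and> T \<subseteq> {A \<in> vietoris_points (top_of_set S). fine_chain e A}"
    by blast
qed

text \<open>Extends relatively open subsets of \<open>A\<close> to open sets, creating no new intersections.\<close>

definition open_extension :: "'a::metric_space set \<Rightarrow> 'a set \<Rightarrow> 'a set" where
  "open_extension A W = \<Union>{ball w (r/2) |w r. w \<in> W \<and> ball w r \<inter> A \<subseteq> W}"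

lemma open_open_extension: "open (open_extension A W)"
  unfolding open_extension_def by auto

lemma subset_open_extension:
  assumes "openin (top_of_set A) W"
  shows "W \<subseteq> open_extension A W"
proof
  fix w assume "w \<in> W"
  then obtain r where "r > 0" "ball w r \<inter> A \<subseteq> W"
    using assms unfolding openin_contains_ball by blast
  moreover from this have "w \<in> ball w (r/2)" by simp
  ultimately show "w \<in> open_extension A W" using \<open>w \<in> W\<close> unfolding open_extension_def by blast
qed

text \<open>Halving the radii pays off here: if two halved balls meet, the centre of the ball with
  the smaller radius lies in the other full ball, hence in the other set.\<close>

lemma open_extension_disjoint:
  assumes "V \<subseteq> A" "W \<subseteq> A" "open_extension A V \<inter> open_extension A W \<noteq> {}"
  shows "V \<inter> W \<noteq> {}"
proof -
  obtain x v r w s where x: "x \<in> ball v (r/2)" "v \<in> V" "ball v r \<inter> A \<subseteq> V"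
    "x \<in> ball w (s/2)" "w \<in> W" "ball w s \<inter> A \<subseteq> W"
    using assms(3) unfolding open_extension_def by blast
  have d: "dist v w < r/2 + s/2" using x dist_triangle2[of v w x] by (auto simp: dist_commute)
  show ?thesis
  proof (cases "s \<le> r")
    case True
    then have "w \<in> ball v r \<inter> A" using d x assms by auto
    then show ?thesis using x by blast
  next
    case False
    then have "v \<in> ball w s \<inter> A" using d x assms by (auto simp: dist_commute)
    then show ?thesis using x by blast
  qed
qed

lemma chainable_imp_fine_chain:
  fixes A :: "'a::metric_space set"
  assumes "chainable (top_of_set A)" and e: "e > 0"
  shows "fine_chain e A"
proof -
  have "open_cover (top_of_set A) ((\<lambda>x. A \<inter> ball x (e/2)) ` A)"
    unfolding open_cover_def using e by (auto intro: openin_open_Int)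
  then obtain n U where U: "chain_cover (top_of_set A) n U" "\<forall>i<n. \<exists>V \<in> (\<lambda>x. A \<inter> ball x (e/2)) ` A. U i \<subseteq> V"
    using assms(1) unfolding chainable_def by blast
  then have "\<forall>i<n. \<exists>x. U i \<subseteq> A \<inter> ball x (e/2)" by blast
  then obtain z where z: "\<And>i. i < n \<Longrightarrow> U i \<subseteq> A \<inter> ball (z i) (e/2)" by metis
  have op: "\<And>i. i < n \<Longrightarrow> openin (top_of_set A) (U i)" and cov: "(\<Union>i<n. U i) = A"
    using U(1) unfolding chain_cover_def open_cover_def by auto
  show ?thesis
    unfolding fine_chain_def
  proof (intro exI conjI allI impI ballI)
    let ?U = "\<lambda>i. open_extension A (U i) \<inter> ball (z i) (e/2)"
    show "open (?U i)" for i by (simp add: open_open_extension open_Int)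
    show "dist x y < e" if "x \<in> ?U i" "y \<in> ?U i" for i x y
      using that dist_triangle_half_r[of "z i" x e y] by auto
    show "\<bar>int i - int j\<bar> \<le> 1" if "i < n" "j < n" "?U i \<inter> ?U j \<noteq> {}" for i j
    proof -
      have "U i \<subseteq> A" "U j \<subseteq> A" using z[OF that(1)] z[OF that(2)] by auto
      moreover have "open_extension A (U i) \<inter> open_extension A (U j) \<noteq> {}" using that(3) by blast
      ultimately have "U i \<inter> U j \<noteq> {}" by (rule open_extension_disjoint)
      then show ?thesis using U(1) that(1,2) unfolding chain_cover_def by simp
    qed
    show "A \<subseteq> (\<Union>i<n. ?U i)"
    proof
      fix x assume "x \<in> A"
      then obtain i where i: "i < n" "x \<in> U i" using cov by blast
      then have "x \<in> ?U i" using z[OF i(1)] subset_open_extension[OF op[OF i(1)]] by blast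
      then show "x \<in> (\<Union>i<n. ?U i)" using i by blast
    qed
  qed
qed

text \<open>The scale \<open>e\<close> is a Lebesgue number of the cover, so every link that meets
  \<open>A\<close> lies, within \<open>A\<close>, in a member of the cover. By connectedness the
  links meeting \<open>A\<close> form an unbroken run from \<open>p\<close> to \<open>q\<close>, and
  renumbering this run gives the chain cover.\<close>

lemma fine_chain_imp_chainable:
  fixes A :: "'a::metric_space set"
  assumes A: "compact A" "connected A" "A \<noteq> {}" and fine: "\<And>e. e > 0 \<Longrightarrow> \<exists>e'\<le>e. fine_chain e' A"
  shows "chainable (top_of_set A)"
  unfolding chainable_def
proof (intro allI impI)
  fix \<V> assume V: "open_cover (top_of_set A) \<V>"
  let ?G = "{T. open T \<and> A \<inter> T \<in> \<V>}"
  have "A \<subseteq> \<Union>?G"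
  proof
    fix x assume "x \<in> A"
    then obtain W where "W \<in> \<V>" "x \<in> W" using V unfolding open_cover_def by auto
    moreover then obtain T where "open T" "W = A \<inter> T" using V unfolding open_cover_def openin_open by blast
    ultimately show "x \<in> \<Union>?G" by blast
  qed
  then obtain e where e: "e > 0" "\<forall>x\<in>A. \<exists>G\<in>?G. ball x e \<subseteq> G"
    using Heine_Borel_lemma[OF A(1), of ?G] by (metis (no_types, lifting) mem_Collect_eq)
  obtain e' where "e' \<le> e" "fine_chain e' A" using fine e by blast
  then obtain m and U :: "nat \<Rightarrow> 'a set" where U: "\<And>i. i < m \<Longrightarrow> open (U i)" "\<forall>i<m. \<forall>x\<in>U i. \<forall>y\<in>U i. dist x y < e'"
     "\<forall>i<m. \<forall>j<m. U i \<inter> U j \<noteq> {} \<longrightarrow> \<bar>int i - int j\<bar> \<le> 1" "A \<subseteq> (\<Union>i<m. U i)"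
    unfolding fine_chain_def by blast
  define I where "I = {i. i < m \<and> U i \<inter> A \<noteq> {}}"
  have I: "finite I" "I \<noteq> {}" using U(4) A(3) unfolding I_def by auto
  define p where "p = Min I"
  define q where "q = Max I"
  have pq: "p \<in> I" "q \<in> I" "p \<le> q" and Ipq: "\<And>i. i \<in> I \<Longrightarrow> p \<le> i \<and> i \<le> q"
    using I unfolding p_def q_def by auto
  have qm: "q < m" using pq unfolding I_def by blast
  have adj: "U i \<inter> U (Suc i) \<inter> A \<noteq> {}" if i: "p \<le> i" "i < q" for i
  proof -
    \<comment> \<open>Cutting the chain after link \<open>i\<close> covers the connected set
      \<open>A\<close> by two open sets that must overlap in \<open>A\<close>; only the links
      \<open>i\<close> and \<open>Suc i\<close> can be responsible.\<close>
    let ?E1 = "\<Union>k\<in>{..i}. U k" and ?E2 = "\<Union>k\<in>{i<..<m}. U k"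
    have "open ?E1" "open ?E2" using U(1) i qm by (auto intro!: open_UN)
    moreover have "A \<subseteq> ?E1 \<union> ?E2"
    proof
      fix x assume "x \<in> A"
      then obtain k where "k < m" "x \<in> U k" using U(4) by blast
      then show "x \<in> ?E1 \<union> ?E2" by (cases "k \<le> i") auto
    qed
    moreover have "?E1 \<inter> A \<noteq> {}" using pq(1) i unfolding I_def by blast
    moreover have "q \<in> {i<..<m}" "U q \<inter> A \<noteq> {}" using pq(2) i qm unfolding I_def by auto
    then have "?E2 \<inter> A \<noteq> {}" by blast
    ultimately have "?E1 \<inter> ?E2 \<inter> A \<noteq> {}" using connectedD[OF A(2), of ?E1 ?E2] by blast
    then obtain x k l where x: "x \<in> A" "k \<le> i" "x \<in> U k" "i < l" "l < m" "x \<in> U l" by auto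
    then have "\<bar>int k - int l\<bar> \<le> 1" using U(3) by (metis disjoint_iff dual_order.strict_trans le_less_trans)
    then have "k = i" "l = Suc i" using x by auto
    then show ?thesis using x by blast
  qed
  have ne: "U i \<inter> A \<noteq> {}" if "p \<le> i" "i \<le> q" for i
    using adj[of i] that pq(2) unfolding I_def by (cases "i = q") auto
  let ?U = "\<lambda>k. A \<inter> U (p + k)" and ?n = "Suc (q - p)"
  have "chain_cover (top_of_set A) ?n ?U"
    unfolding chain_cover_def open_cover_def
  proof (intro conjI allI impI ballI)
    fix W assume "W \<in> ?U ` {..<?n}"
    then obtain k where k: "k < ?n" "W = ?U k" by blast
    then have "p + k < m" using pq qm by simp
    then show "openin (top_of_set A) W" using U(1) k by (auto intro: openin_open_Int)
  next
    have "A \<subseteq> \<Union>(?U ` {..<?n})"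
    proof
      fix x assume x: "x \<in> A"
      then obtain k where k: "k < m" "x \<in> U k" using U(4) by blast
      then have "p \<le> k \<and> k \<le> q" using Ipq x unfolding I_def by blast
      then have "x \<in> ?U (k - p)" "k - p \<in> {..<?n}" using k x by auto
      then show "x \<in> \<Union>(?U ` {..<?n})" by blast
    qed
    then show "\<Union>(?U ` {..<?n}) = topspace (top_of_set A)" by auto
  next
    fix i j assume ij: "i < ?n" "j < ?n"
    then have b: "p + i \<le> q" "p + j \<le> q" using pq by auto
    show "(?U i \<inter> ?U j \<noteq> {}) = (\<bar>int i - int j\<bar> \<le> 1)"
    proof
      assume "?U i \<inter> ?U j \<noteq> {}"
      then have "U (p + i) \<inter> U (p + j) \<noteq> {}" by blast
      then have "\<bar>int (p + i) - int (p + j)\<bar> \<le> 1" using U(3) b qm by (meson le_less_trans)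
      then show "\<bar>int i - int j\<bar> \<le> 1" by simp
    next
      assume "\<bar>int i - int j\<bar> \<le> 1"
      then consider "i = j" | "j = Suc i" | "i = Suc j" by linarith
      then show "?U i \<inter> ?U j \<noteq> {}"
      proof cases
        case 1 then show ?thesis using ne[of "p + i"] b by auto
      next
        case 2 then show ?thesis using adj[of "p + i"] b by auto
      next
        case 3 then show ?thesis using adj[of "p + j"] b by auto
      qed
    qed
  qed
  moreover have "\<exists>V\<in>\<V>. ?U k \<subseteq> V" if k: "k < ?n" for k
  proof -
    have "p + k \<le> q" using k pq by simp
    then obtain x where x: "x \<in> U (p + k)" "x \<in> A" using ne[of "p + k"] by auto
    then obtain G where G: "open G" "A \<inter> G \<in> \<V>" "ball x e \<subseteq> G" using e by blast
    have "U (p + k) \<subseteq> ball x e"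
    proof
      fix y assume "y \<in> U (p + k)"
      moreover have "p + k < m" using \<open>p + k \<le> q\<close> qm by simp
      ultimately have "dist x y < e'" using U(2) x(1) by blast
      then show "y \<in> ball x e" using \<open>e' \<le> e\<close> by simp
    qed
    then show ?thesis using G by blast
  qed
  ultimately show "\<exists>n U. chain_cover (top_of_set A) n U \<and> (\<forall>i<n. \<exists>V\<in>\<V>. U i \<subseteq> V)" by blast
qed

lemma closedin_vietoris_prod_subset:
  assumes "Hausdorff_space X"
  shows "closedin (prod_topology (vietoris X) (vietoris X)) {(A, B). A \<in> vietoris_points X \<and> B \<in> vietoris_points X \<and> A \<subseteq> B}"
proof -
  let ?P = "prod_topology (vietoris X) (vietoris X)"
  let ?C = "{(A, B). A \<in> vietoris_points X \<and> B \<in> vietoris_points X \<and> A \<subseteq> B}"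
  have "openin ?P (topspace ?P - ?C)"
  proof (subst openin_subopen, intro ballI)
    fix z assume z: "z \<in> topspace ?P - ?C"
    obtain A B where AB: "z = (A, B)" by fastforce
    then have AB': "A \<in> vietoris_points X" "B \<in> vietoris_points X" "\<not> A \<subseteq> B" using z by auto
    obtain \<U> \<W> where UW: "openin (vietoris X) \<U>" "openin (vietoris X) \<W>" "A \<in> \<U>" "B \<in> \<W>"
      "\<And>A' B'. A' \<in> \<U> \<Longrightarrow> B' \<in> \<W> \<Longrightarrow> \<not> A' \<subseteq> B'"
      using vietoris_not_subset_separation[OF assms AB'] by metis
    have "openin ?P (\<U> \<times> \<W>)" using UW by (simp add: openin_prod_Times_iff)
    moreover from this have "\<U> \<times> \<W> \<subseteq> topspace ?P" by (rule openin_subset)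
    then have "\<U> \<times> \<W> \<subseteq> topspace ?P - ?C" using UW(5) by auto
    ultimately show "\<exists>T. openin ?P T \<and> z \<in> T \<and> T \<subseteq> topspace ?P - ?C" using AB UW by blast
  qed
  moreover have "?C \<subseteq> topspace ?P" by auto
  ultimately show ?thesis by (simp add: closedin_def)
qed

lemma closedin_vietoris_prod_meets:
  assumes "Hausdorff_space X"
  shows "closedin (prod_topology (vietoris X) (vietoris X)) {(A, B). A \<in> vietoris_points X \<and> B \<in> vietoris_points X \<and> A \<inter> B \<noteq> {}}"
proof -
  let ?P = "prod_topology (vietoris X) (vietoris X)"
  let ?C = "{(A, B). A \<in> vietoris_points X \<and> B \<in> vietoris_points X \<and> A \<inter> B \<noteq> {}}"
  have "openin ?P (topspace ?P - ?C)"
  proof (subst openin_subopen, intro ballI)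
    fix z assume z: "z \<in> topspace ?P - ?C"
    obtain A B where AB: "z = (A, B)" by fastforce
    then have AB': "A \<in> vietoris_points X" "B \<in> vietoris_points X" "disjnt A B" using z by (auto simp: disjnt_def)
    then have "compactin X A" "compactin X B" by (auto simp: vietoris_points_def)
    then obtain U W where UW: "openin X U" "openin X W" "A \<subseteq> U" "B \<subseteq> W" "disjnt U W"
      using assms AB' unfolding Hausdorff_space_compact_sets by meson
    let ?T = "{K \<in> vietoris_points X. K \<subseteq> U} \<times> {K \<in> vietoris_points X. K \<subseteq> W}"
    have "openin ?P ?T" using UW by (simp add: openin_prod_Times_iff openin_vietoris_subset)
    moreover have "z \<in> ?T" using AB AB' UW by auto
    moreover have "?T \<subseteq> topspace ?P - ?C" using UW(5) by (auto simp: disjnt_def)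
    ultimately show "\<exists>T. openin ?P T \<and> z \<in> T \<and> T \<subseteq> topspace ?P - ?C" by blast
  qed
  moreover have "?C \<subseteq> topspace ?P" by auto
  ultimately show ?thesis by (simp add: closedin_def)
qed

text \<open>A compact family of pairs of subcontinua is projected away, so that failing
  hereditary indecomposability at a fixed scale becomes a closed condition.\<close>

lemma closedin_vietoris_overlapping_pair:
  assumes X: "compact_space X" "Hausdorff_space X"
    and \<L>: "closedin (vietoris X) \<L>" and \<M>: "closedin (vietoris X) \<M>"
  shows "closedin (vietoris X)
    {A \<in> vietoris_points X. \<exists>L\<in>\<L>. \<exists>M\<in>\<M>. L \<subseteq> A \<and> M \<subseteq> A \<and> L \<inter> M \<noteq> {}}"
proof -
  let ?V = "vietoris X"
  let ?P = "prod_topology ?V (prod_topology ?V ?V)"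
  let ?C = "{(A, B). A \<in> vietoris_points X \<and> B \<in> vietoris_points X \<and> A \<subseteq> B}"
  let ?D = "{(A, B). A \<in> vietoris_points X \<and> B \<in> vietoris_points X \<and> A \<inter> B \<noteq> {}}"
  let ?T = "{z \<in> topspace ?P. (fst (snd z), fst z) \<in> ?C} \<inter> {z \<in> topspace ?P. (snd (snd z), fst z) \<in> ?C}
     \<inter> {z \<in> topspace ?P. snd z \<in> ?D} \<inter> {z \<in> topspace ?P. fst (snd z) \<in> \<L>} \<inter> {z \<in> topspace ?P. snd (snd z) \<in> \<M>}"
  have f: "continuous_map ?P ?V fst" by (rule continuous_map_fst)
  have s: "continuous_map ?P (prod_topology ?V ?V) snd" by (rule continuous_map_snd)
  have fs: "continuous_map ?P ?V (\<lambda>z. fst (snd z))"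
    using continuous_map_compose[OF s continuous_map_fst] by (simp add: o_def)
  have ss: "continuous_map ?P ?V (\<lambda>z. snd (snd z))"
    using continuous_map_compose[OF s continuous_map_snd] by (simp add: o_def)
  have 1: "continuous_map ?P (prod_topology ?V ?V) (\<lambda>z. (fst (snd z), fst z))"
    using f fs by (simp add: continuous_map_pairedI)
  have 2: "continuous_map ?P (prod_topology ?V ?V) (\<lambda>z. (snd (snd z), fst z))"
    using f ss by (simp add: continuous_map_pairedI)
  have "closedin ?P ?T"
    by (intro closedin_Int closedin_continuous_map_preimage[OF 1 closedin_vietoris_prod_subset[OF X(2)]]
        closedin_continuous_map_preimage[OF 2 closedin_vietoris_prod_subset[OF X(2)]]
        closedin_continuous_map_preimage[OF s closedin_vietoris_prod_meets[OF X(2)]]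
        closedin_continuous_map_preimage[OF fs \<L>] closedin_continuous_map_preimage[OF ss \<M>])
  moreover have "compact_space (prod_topology ?V ?V)"
    using compact_space_vietoris[OF X(1)] by (simp add: compact_space_prod_topology)
  then have "closed_map ?P ?V fst" by (rule closed_map_fst)
  ultimately have cl: "closedin ?V (fst ` ?T)" unfolding closed_map_def by blast
  have sub: "\<L> \<subseteq> vietoris_points X" "\<M> \<subseteq> vietoris_points X"
    using closedin_subset[OF \<L>] closedin_subset[OF \<M>] by auto
  have "fst ` ?T = {A \<in> vietoris_points X. \<exists>L\<in>\<L>. \<exists>M\<in>\<M>. L \<subseteq> A \<and> M \<subseteq> A \<and> L \<inter> M \<noteq> {}}"
  proof (intro subset_antisym subsetI)
    fix A assume "A \<in> {A \<in> vietoris_points X. \<exists>L\<in>\<L>. \<exists>M\<in>\<M>. L \<subseteq> A \<and> M \<subseteq> A \<and> L \<inter> M \<noteq> {}}"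
    then obtain L M where "A \<in> vietoris_points X" "L \<in> \<L>" "M \<in> \<M>" "L \<subseteq> A" "M \<subseteq> A" "L \<inter> M \<noteq> {}" by blast
    then have "(A, L, M) \<in> ?T" using sub by auto
    then show "A \<in> fst ` ?T" by (intro image_eqI[of _ fst "(A, L, M)"]) simp
  next
    fix A assume "A \<in> fst ` ?T"
    then obtain L M where "(A, L, M) \<in> ?T" by (metis (no_types, lifting) imageE prod.collapse)
    then have "A \<in> vietoris_points X" "L \<in> \<L>" "M \<in> \<M>" "L \<subseteq> A" "M \<subseteq> A" "L \<inter> M \<noteq> {}" by auto
    then show "A \<in> {A \<in> vietoris_points X. \<exists>L\<in>\<L>. \<exists>M\<in>\<M>. L \<subseteq> A \<and> M \<subseteq> A \<and> L \<inter> M \<noteq> {}}" by blast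
  qed
  with cl show ?thesis by simp
qed

text \<open>Excludes a crossing pair whose failure of nesting is witnessed by the two balls. Hitting
  closed balls and avoiding open ones are closed conditions on the pair. The doubled radii leave a
  margin of \<open>r\<close> and \<open>s\<close>, which absorbs the error when an arc is only
  approximately crooked.\<close>

definition indecomposable_at_scale :: "'a::metric_space \<Rightarrow> real \<Rightarrow> 'a \<Rightarrow> real \<Rightarrow> 'a set \<Rightarrow> bool" where
  "indecomposable_at_scale a r b s A \<longleftrightarrow> \<not> (\<exists>L M.
     subcontinuum (top_of_set A) L \<and> L \<inter> cball a r \<noteq> {} \<and> L \<inter> ball b (2 * s) = {} \<and>
     subcontinuum (top_of_set A) M \<and> M \<inter> cball b s \<noteq> {} \<and> M \<inter> ball a (2 * r) = {} \<and> L \<inter> M \<noteq> {})"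

lemma openin_indecomposable_at_scale:
  fixes S :: "'a::metric_space set"
  assumes "compact S"
  shows "openin (vietoris (top_of_set S)) {A \<in> vietoris_points (top_of_set S). indecomposable_at_scale a r b s A}"
proof -
  let ?X = "top_of_set S" and ?VP = "vietoris_points (top_of_set S)"
  have X: "compact_space ?X" "Hausdorff_space ?X"
    using assms by (auto simp: compact_space_subtopology Hausdorff_space_subtopology Hausdorff_space_euclidean)
  define \<F> where "\<F> a r b s = {K \<in> ?VP. connectedin ?X K} \<inter> {K \<in> ?VP. K \<inter> (S \<inter> cball a r) \<noteq> {}}
    \<inter> {K \<in> ?VP. K \<subseteq> S \<inter> - ball b (2 * s)}" for a b r s
  have cl: "closedin (vietoris ?X) (\<F> a r b s)" for a b r s
    unfolding \<F>_def
    by (intro closedin_Int closedin_vietoris_connectedin closedin_vietoris_meets closedin_vietoris_subset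
        closedin_closed_Int closed_Compl X) auto
  have eq: "subcontinuum (top_of_set A) L \<and> L \<inter> cball a r \<noteq> {} \<and> L \<inter> ball b (2 * s) = {} \<longleftrightarrow> L \<in> \<F> a r b s \<and> L \<subseteq> A"
    if "A \<in> ?VP" for A L a b r s
  proof -
    have "L \<subseteq> A \<Longrightarrow> L \<subseteq> S" using that by (auto simp: vietoris_points_top_of_set)
    then show ?thesis
      unfolding \<F>_def by (auto simp: subcontinuum_top_of_set vietoris_points_top_of_set connectedin_subtopology)
  qed
  have "{A \<in> ?VP. indecomposable_at_scale a r b s A} = topspace (vietoris ?X) -
     {A \<in> ?VP. \<exists>L\<in>\<F> a r b s. \<exists>M\<in>\<F> b s a r. L \<subseteq> A \<and> M \<subseteq> A \<and> L \<inter> M \<noteq> {}}"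
  proof (rule set_eqI)
    fix A
    show "A \<in> {A \<in> ?VP. indecomposable_at_scale a r b s A} \<longleftrightarrow> A \<in> topspace (vietoris ?X) -
     {A \<in> ?VP. \<exists>L\<in>\<F> a r b s. \<exists>M\<in>\<F> b s a r. L \<subseteq> A \<and> M \<subseteq> A \<and> L \<inter> M \<noteq> {}}"
    proof (cases "A \<in> ?VP")
      case True
      have "indecomposable_at_scale a r b s A \<longleftrightarrow>
        \<not> (\<exists>L M. (L \<in> \<F> a r b s \<and> L \<subseteq> A) \<and> (M \<in> \<F> b s a r \<and> M \<subseteq> A) \<and> L \<inter> M \<noteq> {})"
        unfolding indecomposable_at_scale_def using eq[OF True] by (metis (no_types, lifting))
      then show ?thesis using True by (simp only: mem_Collect_eq Diff_iff topspace_vietoris) blast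
    qed simp
  qed
  then show ?thesis
    using closedin_vietoris_overlapping_pair[OF X cl[of a r b s] cl[of b s a r]]
    by (simp only: openin_diff openin_topspace)
qed

text \<open>If neither of two subcontinua contains the other, a point of each has positive distance
  from the other, and this is witnessed by balls with centre in \<open>D\<close> and radius
  \<open>1 / Suc n\<close>. With \<open>D\<close> countable, hereditary indecomposability becomes a
  countable conjunction.\<close>

lemma hereditarily_indecomposable_iff_at_scale:
  fixes A :: "'a::metric_space set"
  assumes D: "\<And>U. open U \<Longrightarrow> U \<noteq> {} \<Longrightarrow> \<exists>d\<in>D. d \<in> U"
  shows "hereditarily_indecomposable (top_of_set A) \<longleftrightarrow>
    (\<forall>a\<in>D. \<forall>b\<in>D. \<forall>n m. indecomposable_at_scale a (1 / Suc n) b (1 / Suc m) A)"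
proof
  assume "hereditarily_indecomposable (top_of_set A)"
  then have h: "L \<subseteq> M \<or> M \<subseteq> L" if "subcontinuum (top_of_set A) L" "subcontinuum (top_of_set A) M" "L \<inter> M \<noteq> {}" for L M
    using that unfolding hereditarily_indecomposable_iff by blast
  have "cball a r \<subseteq> ball a (2 * r)" if "r > 0" for a :: 'a and r using that by auto
  moreover have "1 / real (Suc n) > 0" for n by simp
  ultimately show "\<forall>a\<in>D. \<forall>b\<in>D. \<forall>n m. indecomposable_at_scale a (1 / Suc n) b (1 / Suc m) A"
    unfolding indecomposable_at_scale_def using h by (smt (verit) disjoint_iff subset_iff)
next
  assume R: "\<forall>a\<in>D. \<forall>b\<in>D. \<forall>n m. indecomposable_at_scale a (1 / Suc n) b (1 / Suc m) A"
  have sep: "\<exists>a\<in>D. \<exists>n. L \<inter> cball a (1 / Suc n) \<noteq> {} \<and> M \<inter> ball a (2 * (1 / Suc n)) = {}"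
    if LM: "\<not> L \<subseteq> M" "closed M" for L M :: "'a set"
  proof -
    obtain x where x: "x \<in> L" "x \<in> - M" using LM by blast
    then obtain \<epsilon> where \<epsilon>: "\<epsilon> > 0" "ball x \<epsilon> \<subseteq> - M" using LM(2) open_contains_ball[of "- M"] by auto
    \<comment> \<open>One third: the centre \<open>a\<close> is within one radius of
      \<open>x\<close> and the avoided ball has two radii.\<close>
    obtain n where n: "1 / Suc n < \<epsilon> / 3" using \<epsilon>(1) nat_approx_posE[of "\<epsilon>/3"] by auto
    have "ball x (1 / Suc n) \<noteq> {}" by simp
    then obtain a where a: "a \<in> D" "dist x a < 1 / Suc n" using D[of "ball x (1 / Suc n)"] by auto
    have "x \<in> L \<inter> cball a (1 / Suc n)" using a x by (simp add: dist_commute)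
    moreover have "ball a (2 * (1 / Suc n)) \<subseteq> ball x \<epsilon>"
    proof
      fix y assume "y \<in> ball a (2 * (1 / Suc n))"
      then show "y \<in> ball x \<epsilon>" using a n dist_triangle[of x y a] by (simp add: mem_ball)
    qed
    ultimately show ?thesis using \<epsilon>(2) a(1) by blast
  qed
  show "hereditarily_indecomposable (top_of_set A)"
    unfolding hereditarily_indecomposable_iff
  proof (intro allI impI, rule ccontr)
    fix L M assume LM: "subcontinuum (top_of_set A) L" "subcontinuum (top_of_set A) M" "L \<inter> M \<noteq> {}" "\<not> (L \<subseteq> M \<or> M \<subseteq> L)"
    then have "closed L" "closed M" by (auto simp: subcontinuum_top_of_set compact_imp_closed)
    with LM sep obtain a n b m where "a \<in> D" "L \<inter> cball a (1 / Suc n) \<noteq> {}" "M \<inter> ball a (2 * (1 / Suc n)) = {}"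
      "b \<in> D" "M \<inter> cball b (1 / Suc m) \<noteq> {}" "L \<inter> ball b (2 * (1 / Suc m)) = {}" by meson
    then show False using R LM unfolding indecomposable_at_scale_def by blast
  qed
qed

section \<open>Chains in the Hilbert cube swept out by a path\<close>

definition unit_cube :: "(nat \<Rightarrow> real) set" where
  "unit_cube = {x. \<forall>i. x i \<in> {0..1}}"

text \<open>Passing to a subspace of \<open>nat \<Rightarrow> real\<close> gives access to the
  metric \<open>dist\<close> of the function space, in which all estimates are made; the given
  metric \<open>d\<close> enters only through \<open>compatible_metric_uniform\<close>.\<close>

lemma hilbert_cube_eq: "hilbert_cube = top_of_set unit_cube"
proof -
  have "unit_cube = (\<Pi>\<^sub>E i\<in>UNIV. {0..1})" by (auto simp: unit_cube_def PiE_UNIV_domain)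
  then show ?thesis
    unfolding hilbert_cube_def using subtopology_product_topology[of "\<lambda>_. euclideanreal" "UNIV :: nat set" "\<lambda>_. {0..1}"]
    by (simp only: euclidean_product_topology)
qed

lemma compact_unit_cube: "compact unit_cube"
proof -
  have "compact_space hilbert_cube"
    unfolding hilbert_cube_def by (simp add: compact_space_product_topology compact_space_subtopology)
  then show ?thesis unfolding hilbert_cube_eq by (simp add: compact_space_def compactin_subtopology)
qed

lemma unit_cube_nonempty: "unit_cube \<noteq> {}"
  unfolding unit_cube_def by (auto intro!: exI[of _ "\<lambda>_. 0"])

lemma locally_path_connected_unit_cube: "locally path_connected unit_cube"
proof -
  have "locally_path_connected_space hilbert_cube"
    unfolding hilbert_cube_def locally_path_connected_space_product_topology
    using locally_path_connected_is_realinterval[of "{0..1}"] path_connectedin_euclidean[of "{0..1::real}"]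
    by (simp add: is_interval_cc path_connectedin_def convex_imp_path_connected)
  then have *: "\<And>V x. openin (top_of_set unit_cube) V \<Longrightarrow> x \<in> V \<Longrightarrow>
      \<exists>U. openin (top_of_set unit_cube) U \<and> path_connectedin (top_of_set unit_cube) U \<and> x \<in> U \<and> U \<subseteq> V"
    unfolding hilbert_cube_eq locally_path_connected_space by blast
  show ?thesis
    unfolding locally_def
  proof (intro allI impI, elim conjE)
    fix V and x :: "nat \<Rightarrow> real" assume "openin (top_of_set unit_cube) V" "x \<in> V"
    from *[OF this] obtain U where "openin (top_of_set unit_cube) U" "path_connectedin (top_of_set unit_cube) U" "x \<in> U" "U \<subseteq> V" by blast
    then show "\<exists>u v. openin (top_of_set unit_cube) u \<and> path_connected v \<and> x \<in> u \<and> u \<subseteq> v \<and> v \<subseteq> V"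
      by (intro exI[of _ U]) (simp add: path_connectedin_subtopology)
  qed
qed

lemma dist_less_if_eq_initial:
  fixes e :: real
  assumes "e > 0"
  obtains N where "\<And>x y :: nat \<Rightarrow> real. (\<And>i. i < N \<Longrightarrow> x i = y i) \<Longrightarrow> dist x y < e"
proof -
  obtain M where M: "(1/2::real)^M < e" using real_arch_pow_inv[OF assms, of "1/2"] by auto
  \<comment> \<open>The metric on functions weighs indices along the enumeration
    \<open>from_nat\<close>; \<open>N\<close> exceeds the first \<open>M + 1\<close> enumerated
    indices, and the remaining ones contribute at most \<open>(1/2)^M\<close>.\<close>
  define N where "N = Suc (Max ((from_nat :: nat \<Rightarrow> nat) ` {..M}))"
  have "dist x y < e" if xy: "\<And>i. i < N \<Longrightarrow> x i = y i" for x y :: "nat \<Rightarrow> real"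
  proof -
    have "(from_nat n :: nat) < N" if "n \<le> M" for n
      unfolding N_def using that by (simp add: less_Suc_eq_le)
    then have "{dist (x (from_nat n)) (y (from_nat n))|n. n \<le> M} = {0}"
      using xy by (auto intro!: exI[of _ 0])
    then show ?thesis using dist_fun_le_dist_first_terms[of x y M] M by simp
  qed
  then show thesis using that by blast
qed

lemma hausdorff_close_image:
  assumes "\<And>x. x \<in> T \<Longrightarrow> dist (f x) (g x) < e"
  shows "hausdorff_close e (f ` T) (g ` T)"
  unfolding hausdorff_close_def using assms by blast

text \<open>Projection along the compact factor \<open>K\<close> is a closed map, which makes the
  condition of lying inside \<open>U\<close> open in \<open>x\<close>; projection is always open,
  which does the same for meeting \<open>U\<close>.\<close>

lemma continuous_map_vietoris_image:
  assumes K: "compact_space K" "topspace K \<noteq> {}" and \<phi>: "continuous_map (prod_topology X K) Y \<phi>"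
  shows "continuous_map X (vietoris Y) (\<lambda>x. \<phi> ` ({x} \<times> topspace K))"
proof -
  let ?P = "prod_topology X K"
  let ?G = "\<lambda>x. \<phi> ` ({x} \<times> topspace K)"
  have G: "?G x \<in> vietoris_points Y" if "x \<in> topspace X" for x
  proof -
    have "compactin ?P ({x} \<times> topspace K)"
      using K that by (simp add: compactin_Times compact_space_def)
    then show ?thesis using image_compactin[OF _ \<phi>] K unfolding vietoris_points_def by auto
  qed
  have \<phi>Y: "\<phi> z \<in> topspace Y" if "z \<in> topspace X \<times> topspace K" for z
    using continuous_map_image_subset_topspace[OF \<phi>] that by auto
  have sub: "openin X {x \<in> topspace X. ?G x \<subseteq> U}" if U: "openin Y U" for U
  proof -
    have "closedin ?P {z \<in> topspace ?P. \<phi> z \<in> topspace Y - U}"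
      using U by (intro closedin_continuous_map_preimage[OF \<phi>] closedin_diff) auto
    then have "closedin X (fst ` {z \<in> topspace ?P. \<phi> z \<in> topspace Y - U})"
      using closed_map_fst[OF K(1)] unfolding closed_map_def by blast
    moreover have "{x \<in> topspace X. ?G x \<subseteq> U} = topspace X - fst ` {z \<in> topspace ?P. \<phi> z \<in> topspace Y - U}"
      (is "?l = ?r")
    proof
      show "?l \<subseteq> ?r"
      proof
        fix x assume x: "x \<in> ?l"
        then have "\<phi> (x, k) \<in> U" if "k \<in> topspace K" for k using that by blast
        then show "x \<in> ?r" using x by auto
      qed
      show "?r \<subseteq> ?l"
      proof
        fix x assume x: "x \<in> ?r"
        have "\<phi> (x, k) \<in> U" if "k \<in> topspace K" for k
        proof (rule ccontr)
          assume "\<phi> (x, k) \<notin> U"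
          then have "(x, k) \<in> {z \<in> topspace ?P. \<phi> z \<in> topspace Y - U}" using \<phi>Y[of "(x, k)"] x that by auto
          then show False using x by force
        qed
        then show "x \<in> ?l" using x by auto
      qed
    qed
    ultimately show ?thesis by (simp add: openin_diff)
  qed
  have meets: "openin X {x \<in> topspace X. ?G x \<inter> U \<noteq> {}}" if U: "openin Y U" for U
  proof -
    have "openin ?P {z \<in> topspace ?P. \<phi> z \<in> U}"
      using U by (rule openin_continuous_map_preimage[OF \<phi>])
    then have "openin X (fst ` {z \<in> topspace ?P. \<phi> z \<in> U})"
      using open_map_fst[of X K] unfolding open_map_def by blast
    moreover have "{x \<in> topspace X. ?G x \<inter> U \<noteq> {}} = fst ` {z \<in> topspace ?P. \<phi> z \<in> U}"
      (is "?l = ?r")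
    proof
      show "?l \<subseteq> ?r"
      proof
        fix x assume "x \<in> ?l"
        then obtain k where "x \<in> topspace X" "k \<in> topspace K" "\<phi> (x, k) \<in> U" by blast
        then show "x \<in> ?r" by (intro image_eqI[of _ fst "(x, k)"]) auto
      qed
      show "?r \<subseteq> ?l"
      proof
        fix x assume "x \<in> ?r"
        then obtain k where "x \<in> topspace X" "k \<in> topspace K" "\<phi> (x, k) \<in> U" by auto
        then show "x \<in> ?l" by blast
      qed
    qed
    ultimately show ?thesis by simp
  qed
  show ?thesis
    unfolding vietoris_def continuous_on_generated_topo_iff
  proof (intro conjI allI impI)
    fix \<U> assume "\<U> \<in> {{K \<in> vietoris_points Y. K \<subseteq> U} |U. openin Y U} \<union>
             {{K \<in> vietoris_points Y. K \<inter> U \<noteq> {}} |U. openin Y U}"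
    then consider U where "openin Y U" "\<U> = {K \<in> vietoris_points Y. K \<subseteq> U}"
      | U where "openin Y U" "\<U> = {K \<in> vietoris_points Y. K \<inter> U \<noteq> {}}" by blast
    then show "openin X (?G -` \<U> \<inter> topspace X)"
    proof cases
      case (1 U)
      have "?G -` \<U> \<inter> topspace X = {x \<in> topspace X. ?G x \<subseteq> U}" using G 1(2) by blast
      then show ?thesis using sub[OF 1(1)] by simp
    next
      case (2 U)
      have "?G -` \<U> \<inter> topspace X = {x \<in> topspace X. ?G x \<inter> U \<noteq> {}}" using G 2(2) by blast
      then show ?thesis using meets[OF 2(1)] by simp
    qed
  next
    show "?G ` topspace X \<subseteq> \<Union>({{K \<in> vietoris_points Y. K \<subseteq> U} |U. openin Y U} \<union>
             {{K \<in> vietoris_points Y. K \<inter> U \<noteq> {}} |U. openin Y U})"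
      using G topspace_vietoris[of Y] unfolding vietoris_def topology_generated_by_topspace by blast
  qed
qed

text \<open>The time \<open>\<tau>\<close> runs through \<open>[0,2]\<close>: up to 1 the points
  \<open>h (r * \<tau>)\<close> trace the arc, afterwards \<open>h r\<close> is mixed with a point
  \<open>q\<close> of the cube with weight \<open>\<tau> - 1\<close>. The parameters
  \<open>(r, q)\<close> range over one fixed compact set for all times, as
  \<open>continuous_map_vietoris_image\<close> requires.\<close>

definition segment_sweep :: "(real \<Rightarrow> nat \<Rightarrow> real) \<Rightarrow> real \<Rightarrow> real \<Rightarrow> (nat \<Rightarrow> real) \<Rightarrow> nat \<Rightarrow> real" where
  "segment_sweep h \<tau> r q = (\<lambda>i. (1 - max 0 (\<tau> - 1)) * h (r * min \<tau> 1) i + max 0 (\<tau> - 1) * q i)"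

definition sweep :: "(real \<Rightarrow> nat \<Rightarrow> real) \<Rightarrow> real \<Rightarrow> (nat \<Rightarrow> real) set" where
  "sweep h \<tau> = (\<lambda>(r, q). segment_sweep h \<tau> r q) ` ({0..1} \<times> unit_cube)"

lemma convex_comb_in_unit_cube:
  assumes "x \<in> unit_cube" "y \<in> unit_cube" "0 \<le> s" "s \<le> 1"
  shows "(\<lambda>i. (1 - s) * x i + s * y i) \<in> unit_cube"
proof -
  have "(1 - s) * x i + s * y i \<in> {0..1}" for i
  proof -
    have b: "0 \<le> x i" "x i \<le> 1" "0 \<le> y i" "y i \<le> 1" using assms by (auto simp: unit_cube_def)
    have "(1 - s) * x i + s * y i \<le> (1 - s) * 1 + s * 1"
      using assms b by (intro add_mono mult_left_mono) auto
    moreover have "0 \<le> (1 - s) * x i + s * y i" using assms b by simp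
    ultimately show ?thesis by simp
  qed
  then show ?thesis unfolding unit_cube_def by blast
qed

lemma min_mult_in_unit: "r \<in> {0..1} \<Longrightarrow> 0 \<le> \<tau> \<Longrightarrow> r * min \<tau> 1 \<in> {0..1::real}"
  by (auto intro: mult_nonneg_nonneg mult_le_one)

lemma sweep_initial:
  assumes "0 \<le> \<tau>" "\<tau> \<le> 1"
  shows "sweep h \<tau> = h ` {0..\<tau>}"
proof -
  have "sweep h \<tau> = (\<lambda>r. h (r * \<tau>)) ` {0..1}"
    unfolding sweep_def segment_sweep_def using assms unit_cube_nonempty
    by (force simp: max_def min_def image_iff)
  also have "\<dots> = h ` ((\<lambda>r. r * \<tau>) ` {0..1})" by (simp only: image_image)
  also have "(\<lambda>r. r * \<tau>) ` {0..1} = {0..\<tau>}"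
  proof (cases "\<tau> = 0")
    case False
    then show ?thesis using image_mult_atLeastAtMost[of \<tau> 0 1] assms by (simp add: mult.commute)
  qed (simp add: image_constant_conv)
  finally show ?thesis .
qed

lemma sweep_subset:
  assumes h: "h ` {0..1} \<subseteq> unit_cube" and "0 \<le> \<tau>" "\<tau> \<le> 2"
  shows "sweep h \<tau> \<subseteq> unit_cube"
proof
  fix x assume "x \<in> sweep h \<tau>"
  then obtain r q where x: "r \<in> {0..1}" "q \<in> unit_cube" "x = segment_sweep h \<tau> r q" unfolding sweep_def by auto
  have "h (r * min \<tau> 1) \<in> unit_cube" using h min_mult_in_unit[OF x(1) assms(2)] by blast
  then show "x \<in> unit_cube"
    unfolding x(3) segment_sweep_def using x(2) assms by (intro convex_comb_in_unit_cube) auto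
qed

lemma sweep_mono:
  assumes h: "h ` {0..1} \<subseteq> unit_cube" and "0 \<le> \<tau>" "\<tau> \<le> \<tau>'" "\<tau>' \<le> 2"
  shows "sweep h \<tau> \<subseteq> sweep h \<tau>'"
proof (cases "\<tau>' \<le> 1")
  case True
  then show ?thesis using assms by (simp add: sweep_initial image_mono)
next
  case False
  show ?thesis
  proof
    fix x assume "x \<in> sweep h \<tau>"
    then obtain r q where x: "r \<in> {0..1}" "q \<in> unit_cube" "x = segment_sweep h \<tau> r q" unfolding sweep_def by auto
    define r' where "r' = r * min \<tau> 1"
    define s where "s = max 0 (\<tau> - 1)"
    define s' where "s' = \<tau>' - 1"
    have s: "0 \<le> s" "s \<le> s'" "0 < s'" using False assms unfolding s_def s'_def by auto
    have r': "r' \<in> {0..1}" unfolding r'_def using x(1) assms(2) by (rule min_mult_in_unit)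
    \<comment> \<open>A mixture with the smaller weight \<open>s\<close> is one with the larger
      weight \<open>s'\<close> once \<open>q\<close> is moved towards \<open>h r'\<close>; the cube
      is convex. For \<open>\<tau> \<le> 1\<close> the weight \<open>s\<close> is 0 and
      \<open>q'\<close> is \<open>h r'\<close>.\<close>
    define q' where "q' = (\<lambda>i. (1 - s / s') * h r' i + (s / s') * q i)"
    have "q' \<in> unit_cube"
      unfolding q'_def using h r' x(2) s by (intro convex_comb_in_unit_cube) auto
    moreover have "x = segment_sweep h \<tau>' r' q'"
    proof
      fix i
      have "segment_sweep h \<tau>' r' q' i = (1 - s') * h r' i + s' * ((1 - s / s') * h r' i + (s / s') * q i)"
        unfolding segment_sweep_def q'_def s'_def using False by simp
      also have "\<dots> = (1 - s) * h r' i + s * q i"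
        using s by (simp add: field_simps)
      also have "\<dots> = x i" unfolding x(3) segment_sweep_def r'_def s_def ..
      finally show "x i = segment_sweep h \<tau>' r' q' i" by simp
    qed
    ultimately show "x \<in> sweep h \<tau>'" using r' unfolding sweep_def by auto
  qed
qed

lemma sweep_end:
  assumes "h ` {0..1} \<subseteq> unit_cube"
  shows "sweep h 2 = unit_cube"
proof
  show "sweep h 2 \<subseteq> unit_cube" using assms by (rule sweep_subset) auto
  show "unit_cube \<subseteq> sweep h 2"
  proof
    fix q assume "q \<in> unit_cube"
    moreover have "segment_sweep h 2 0 q = q" unfolding segment_sweep_def by simp
    ultimately show "q \<in> sweep h 2" unfolding sweep_def by force
  qed
qed

lemma continuous_map_sweep:
  assumes h: "continuous_on {0..1} h" "h ` {0..1} \<subseteq> unit_cube"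
  shows "continuous_map (top_of_set {0..2}) (vietoris (top_of_set unit_cube)) (sweep h)"
proof -
  let ?K = "top_of_set ({0..1::real} \<times> unit_cube)"
  let ?\<phi> = "\<lambda>(\<tau>, r, q). segment_sweep h \<tau> r q"
  have hc: "continuous_on {0..1} (\<lambda>t. h t i)" for i
    using h(1) by (rule continuous_on_product_then_coordinatewise)
  have "continuous_on ({0..2} \<times> {0..1} \<times> unit_cube) ?\<phi>"
    unfolding case_prod_beta segment_sweep_def
  proof (rule continuous_on_coordinatewise_then_product)
    fix i
    let ?D = "{0..2} \<times> {0..1::real} \<times> unit_cube"
    have 1: "continuous_on ?D (\<lambda>p. h (fst (snd p) * min (fst p) 1) i)"
      by (rule continuous_on_compose2[OF hc])
        (auto intro!: continuous_intros mult_nonneg_nonneg mult_le_one)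
    have 2: "continuous_on ?D (\<lambda>p. snd (snd p) i)"
      by (rule continuous_on_product_then_coordinatewise) (intro continuous_intros)
    show "continuous_on ?D (\<lambda>p. (1 - max 0 (fst p - 1)) * h (fst (snd p) * min (fst p) 1) i + max 0 (fst p - 1) * snd (snd p) i)"
      using 1 2 by (intro continuous_intros)
  qed
  moreover have "?\<phi> ` ({0..2} \<times> {0..1} \<times> unit_cube) \<subseteq> unit_cube"
    using sweep_subset[OF h(2)] unfolding sweep_def by fastforce
  then have "segment_sweep h \<tau> r q \<in> unit_cube" if "0 \<le> \<tau>" "\<tau> \<le> 2" "0 \<le> r" "r \<le> 1" "q \<in> unit_cube" for \<tau> r q
    using that by fastforce
  ultimately have "continuous_map (prod_topology (top_of_set {0..2}) ?K) (top_of_set unit_cube) ?\<phi>"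
    by (auto simp: prod_topology_subtopology_eu)
  moreover have "compact_space ?K"
    using compact_Times[OF compact_Icc compact_unit_cube] by (simp add: compact_space_subtopology)
  moreover have "topspace ?K \<noteq> {}" using unit_cube_nonempty by auto
  ultimately have "continuous_map (top_of_set {0..2}) (vietoris (top_of_set unit_cube))
     (\<lambda>\<tau>. ?\<phi> ` ({\<tau>} \<times> topspace ?K))"
    by (intro continuous_map_vietoris_image)
  moreover have "?\<phi> ` ({\<tau>} \<times> topspace ?K) = sweep h \<tau>" for \<tau>
    unfolding sweep_def by force
  ultimately show ?thesis by simp
qed

lemma sweep_in_connected_chains:
  assumes h: "continuous_on {0..1} h" "h ` {0..1} \<subseteq> unit_cube"
  shows "sweep h ` {0..2} \<in> topspace (connected_chains (top_of_set unit_cube))"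
proof -
  let ?X = "top_of_set unit_cube"
  have X: "compact_space ?X" "Hausdorff_space ?X" "topspace ?X \<noteq> {}"
    using compact_unit_cube unit_cube_nonempty
    by (auto simp: compact_space_subtopology Hausdorff_space_subtopology)
  have cm: "continuous_map (top_of_set {0..2}) (vietoris ?X) (sweep h)" using h by (rule continuous_map_sweep)
  have "compactin (top_of_set {0..2::real}) {0..2}" by (simp add: compactin_subtopology)
  then have "sweep h ` {0..2} \<in> vietoris_points (vietoris ?X)"
    using image_compactin[OF _ cm] by (simp add: vietoris_points_def)
  moreover have "chain\<^sub>\<subseteq> (sweep h ` {0..2})"
    unfolding chain_subset_def
  proof (intro ballI)
    fix A B assume "A \<in> sweep h ` {0..2}" "B \<in> sweep h ` {0..2}"
    then obtain x y where xy: "x \<in> {0..2}" "y \<in> {0..2}" "A = sweep h x" "B = sweep h y" by blast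
    show "A \<subseteq> B \<or> B \<subseteq> A"
      using sweep_mono[OF h(2), of x y] sweep_mono[OF h(2), of y x] xy by (cases "x \<le> y") auto
  qed
  moreover have "connectedin (top_of_set {0..2::real}) {0..2}" by (simp add: connectedin_subtopology)
  then have "connectedin (vietoris ?X) (sweep h ` {0..2})"
    by (rule connectedin_continuous_map_image[OF cm])
  moreover have "topspace ?X \<in> sweep h ` {0..2}"
    using sweep_end[OF h(2)] by (intro image_eqI[of _ _ 2]) auto
  moreover have "{h 0} \<in> sweep h ` {0..2}"
    using sweep_initial[of 0 h] by (intro image_eqI[of _ _ 0]) auto
  moreover have "h 0 \<in> topspace ?X" using h(2) by auto
  ultimately show ?thesis using in_connected_chains_iff[OF X] by blast
qed

section \<open>Approximation by crooked arcs\<close>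

text \<open>Coordinate \<open>N\<close> displays the parameter, so cutting by slabs in that
  coordinate separates non-neighbouring links, however close the arc comes to itself in the other
  coordinates.\<close>

lemma arc_fine_chain:
  fixes h :: "real \<Rightarrow> nat \<Rightarrow> real"
  assumes h: "continuous_on {0..1} h" and hN: "\<And>t. h t N = t" and e: "e > 0" and t: "t \<le> 1"
  shows "fine_chain e (h ` {0..t})"
proof -
  have "uniformly_continuous_on {0..1} h" using h by (intro compact_uniformly_continuous) auto
  then obtain d where d: "d > 0" "\<And>u v. u \<in> {0..1} \<Longrightarrow> v \<in> {0..1} \<Longrightarrow> dist v u < d \<Longrightarrow> dist (h v) (h u) < e/3"
    unfolding uniformly_continuous_on_def using e by (metis divide_pos_pos zero_less_numeral)
  obtain m :: nat where m: "m > 0" "2 / real m < d"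
  proof -
    obtain n where "inverse (real (Suc n)) < d/2" using reals_Archimedean[of "d/2"] d by auto
    then show thesis by (intro that[of "Suc n"]) (auto simp: field_simps)
  qed
  define J where "J i = {u \<in> {0..1}. \<bar>u - real i / m\<bar> < 1 / m}" for i
  \<comment> \<open>The slabs, of width \<open>2 / m\<close> and spaced \<open>1 / m\<close> apart,
    give the chain pattern; the balls give the diameter, as two parameters in \<open>J i\<close>
    differ by less than \<open>2 / m < d\<close>.\<close>
  define U where "U i = {x :: nat \<Rightarrow> real. (real i - 1) / m < x N} \<inter> {x. x N < (real i + 1) / m} \<inter> (\<Union>u\<in>J i. ball (h u) (e/3))" for i
  have "open (U i)" for i
    unfolding U_def by (intro open_Int open_UN open_Collect_less) (auto intro!: continuous_intros)
  moreover have "dist x y < e" if xy: "x \<in> U i" "y \<in> U i" for x y i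
  proof -
    obtain u v where uv: "u \<in> J i" "v \<in> J i" "dist (h u) x < e/3" "dist (h v) y < e/3"
      using xy unfolding U_def by auto
    have "\<bar>v - u\<bar> < 1 / m + 1 / m" using uv(1,2) unfolding J_def by auto
    then have "dist v u < d" using m(2) by (simp add: dist_real_def)
    then have "dist (h v) (h u) < e/3" using uv(1,2) d(2) unfolding J_def by blast
    then show ?thesis
      using uv dist_triangle[of x y "h u"] dist_triangle[of "h u" y "h v"] by (simp add: dist_commute)
  qed
  moreover have "\<bar>int i - int j\<bar> \<le> 1" if ij: "U i \<inter> U j \<noteq> {}" for i j
  proof -
    obtain x where "x \<in> U i" "x \<in> U j" using ij by blast
    then have "(real i - 1) / m < (real j + 1) / m" "(real j - 1) / m < (real i + 1) / m"
      unfolding U_def by auto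
    then have "real i - 1 < real j + 1" "real j - 1 < real i + 1" using m(1) by (simp_all add: divide_less_cancel)
    then show ?thesis by linarith
  qed
  moreover have "h ` {0..t} \<subseteq> (\<Union>i<Suc m. U i)"
  proof
    fix x assume "x \<in> h ` {0..t}"
    then obtain u where "u \<in> {0..t}" "x = h u" by blast
    then have u: "u \<in> {0..1}" "x = h u" using t by auto
    define i where "i = nat \<lfloor>u * m\<rfloor>"
    have i: "real i \<le> u * m" "u * m < real i + 1" using u unfolding i_def by (auto simp: of_nat_nat)
    have "u * m \<le> m" using u by (simp add: mult_left_le_one_le)
    then have "i < Suc m" using i(1) by linarith
    have a: "real i / m \<le> u" "u < (real i + 1) / m" "(real i - 1) / m < u"
    proof -
      show le: "real i / m \<le> u" "u < (real i + 1) / m" using i m by (auto simp: field_simps)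
      have "(real i - 1) / m < real i / m" using m by (simp add: divide_strict_right_mono)
      then show "(real i - 1) / m < u" using le by linarith
    qed
    then have "u \<in> J i" unfolding J_def using u m by (auto simp: add_divide_distrib)
    then have "h u \<in> (\<Union>u\<in>J i. ball (h u) (e/3))" using e by (intro UN_I[of u]) auto
    then have "x \<in> U i" unfolding U_def using a u(2) by (simp add: hN)
    then show "x \<in> (\<Union>i<Suc m. U i)" using \<open>i < Suc m\<close> by blast
  qed
  ultimately show ?thesis unfolding fine_chain_def by (intro exI[of _ "Suc m"] exI[of _ U]) simp
qed

text \<open>Take \<open>x\<close> in \<open>L\<close> near \<open>a\<close>, \<open>y\<close> in
  \<open>M\<close> near \<open>b\<close>, and a common point \<open>z\<close>; let
  \<open>x N \<le> y N\<close>. Projecting to coordinate \<open>N\<close>, \<open>L\<close> contains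
  the arc between \<open>x\<close> and \<open>z\<close>, and \<open>M\<close> the arc between
  \<open>z\<close> and \<open>y\<close>. Crookedness yields \<open>u \<le> v\<close> with
  \<open>h u\<close> near \<open>y\<close>, hence outside \<open>L\<close>, so
  \<open>z N < u\<close>, and \<open>h v\<close> near \<open>x\<close>, hence outside
  \<open>M\<close>, so \<open>v < z N\<close>: a contradiction.\<close>

lemma arc_indecomposable_at_scale:
  fixes h :: "real \<Rightarrow> nat \<Rightarrow> real"
  assumes hN: "\<And>t. h t N = t"
    and crooked: "\<And>p q. 0 \<le> p \<Longrightarrow> p \<le> q \<Longrightarrow> q \<le> 1 \<Longrightarrow>
       \<exists>u v. p \<le> u \<and> u \<le> v \<and> v \<le> q \<and> dist (h u) (h q) < e \<and> dist (h v) (h p) < e"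
    and rs: "e \<le> r" "e \<le> s" and t: "t \<le> 1"
  shows "indecomposable_at_scale a r b s (h ` {0..t})"
  unfolding indecomposable_at_scale_def
proof (rule notI, elim exE conjE)
  fix L M
  let ?A = "h ` {0..t}"
  assume L: "subcontinuum (top_of_set ?A) L" "L \<inter> cball a r \<noteq> {}" "L \<inter> ball b (2 * s) = {}"
    and M: "subcontinuum (top_of_set ?A) M" "M \<inter> cball b s \<noteq> {}" "M \<inter> ball a (2 * r) = {}"
    and LM: "L \<inter> M \<noteq> {}"
  obtain x y z where x: "x \<in> L" "dist a x \<le> r" and y: "y \<in> M" "dist b y \<le> s" and z: "z \<in> L" "z \<in> M"
    using L(2) M(2) LM by auto
  have inA: "h (w N) = w \<and> w N \<in> {0..t}" if "w \<in> ?A" for w using that hN by auto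
  have sub: "L \<subseteq> ?A" "M \<subseteq> ?A" "connected L" "connected M"
    using L(1) M(1) by (auto simp: subcontinuum_top_of_set)
  have between: "h w \<in> K" if K: "K \<subseteq> ?A" "connected K" "k1 \<in> K" "k2 \<in> K" and w: "k1 N \<le> w" "w \<le> k2 N" for K k1 k2 w
  proof -
    have "continuous_on K (\<lambda>x :: nat \<Rightarrow> real. x N)"
      by (rule continuous_on_subset[OF continuous_on_product_coordinates]) simp
    then have "connected ((\<lambda>x. x N) ` K)"
      using K(2) by (rule connected_continuous_image)
    then have "w \<in> (\<lambda>x. x N) ` K"
      using K(3,4) w connectedD_interval[of "(\<lambda>x. x N) ` K" "k1 N" "k2 N" w] by blast
    then obtain k where "k \<in> K" "w = k N" by blast
    then show ?thesis using inA[of k] K(1) by auto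
  qed
  have nM: "h w \<notin> M" if "dist (h w) x < e" for w
  proof
    assume "h w \<in> M"
    then have "\<not> dist a (h w) < 2 * r" using M(3) by auto
    then show False using that x(2) rs(1) dist_triangle[of a "h w" x] by (simp add: dist_commute)
  qed
  have nL: "h w \<notin> L" if "dist (h w) y < e" for w
  proof
    assume "h w \<in> L"
    then have "\<not> dist b (h w) < 2 * s" using L(3) by auto
    then show False using that y(2) rs(2) dist_triangle[of b "h w" y] by (simp add: dist_commute)
  qed
  have hx: "h (x N) = x" "x N \<in> {0..1}" and hy: "h (y N) = y" "y N \<in> {0..1}"
    using inA[of x] inA[of y] x y sub t by auto
  show False
  proof (cases "x N \<le> y N")
    case True
    then obtain u v where uv: "x N \<le> u" "u \<le> v" "v \<le> y N" "dist (h u) y < e" "dist (h v) x < e"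
      using crooked[of "x N" "y N"] hx hy by auto
    have "\<not> u \<le> z N" using between[OF sub(1,3) x(1) z(1) uv(1)] nL[OF uv(4)] by blast
    moreover have "\<not> z N \<le> v" using between[OF sub(2,4) z(2) y(1) _ uv(3)] nM[OF uv(5)] by blast
    ultimately show False using uv(2) by linarith
  next
    case False
    then obtain u v where uv: "y N \<le> u" "u \<le> v" "v \<le> x N" "dist (h u) x < e" "dist (h v) y < e"
      using crooked[of "y N" "x N"] hx hy by auto
    have "\<not> u \<le> z N" using between[OF sub(2,4) y(1) z(2) uv(1)] nM[OF uv(4)] by blast
    moreover have "\<not> z N \<le> v" using between[OF sub(1,3) z(1) x(1) _ uv(3)] nL[OF uv(5)] by blast
    ultimately show False using uv(2) by linarith
  qed
qed

text \<open>With the converse \<open>initial_image_onto_segment\<close>, this shows that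
  precomposing a path with a crooked map leaves its family of initial traces unchanged.\<close>

lemma initial_image_of_segment_map:
  fixes f :: "real \<Rightarrow> real"
  assumes f: "continuous_on {0..1} f" "f 0 = 0" "f ` {0..1} \<subseteq> {0..1}" and t: "t \<in> {0..1}"
  obtains s where "s \<in> {0..1}" "f ` {0..t} = {0..s}"
proof -
  have "continuous_on {0..t} f" using t by (intro continuous_on_subset[OF f(1)]) auto
  then have "connected (f ` {0..t}) \<and> compact (f ` {0..t})"
    by (auto intro: connected_continuous_image compact_continuous_image)
  then obtain a b where ab: "f ` {0..t} = {a..b}" unfolding connected_compact_interval_1 by auto
  have "0 \<in> f ` {0..t}" using t f(2) by (intro image_eqI[of _ _ 0]) auto
  moreover have "f ` {0..t} \<subseteq> {0..1}" using f(3) t by (auto simp: image_subset_iff)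
  ultimately have "a \<le> 0" "0 \<le> b" "a \<in> {0..1}" "b \<in> {0..1}" unfolding ab by auto
  then have "a = 0" by simp
  then show thesis using that \<open>b \<in> {0..1}\<close> ab by blast
qed

lemma initial_image_onto_segment:
  fixes f :: "real \<Rightarrow> real"
  assumes f: "continuous_on {0..1} f" "f 0 = 0" "f 1 = 1" "f ` {0..1} \<subseteq> {0..1}" and s: "s \<in> {0..1}"
  obtains t where "t \<in> {0..1}" "f ` {0..t} = {0..s}"
proof -
  have c: "continuous_on {0..r} f" if "r \<le> 1" for r
    using that by (intro continuous_on_subset[OF f(1)]) auto
  let ?T = "{t \<in> {0..1}. f t = s}"
  have "closedin (top_of_set {0..1}) ?T"
    using continuous_closedin_preimage_constant[OF f(1)] .
  then have "compact ?T" by (rule closedin_compact[OF compact_Icc])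
  moreover have "?T \<noteq> {}" using IVT'[of f 0 s 1] f s by auto
  \<comment> \<open>The first time at which \<open>s\<close> is reached: before it \<open>f\<close>
    cannot exceed \<open>s\<close>, or the value \<open>s\<close> would have been taken
    earlier.\<close>
  ultimately obtain t where t: "t \<in> ?T" "\<forall>u\<in>?T. t \<le> u" using compact_attains_inf by meson
  have "f ` {0..t} \<subseteq> {0..s}"
  proof
    fix y assume "y \<in> f ` {0..t}"
    then obtain u where u: "0 \<le> u" "u \<le> t" "y = f u" by auto
    have "f u \<le> s"
    proof (rule ccontr)
      assume "\<not> f u \<le> s"
      then obtain w where "0 \<le> w" "w \<le> u" "f w = s" using IVT'[of f 0 s u] f(2) s u t c[of u] by auto
      moreover from this have "w \<noteq> u" using \<open>\<not> f u \<le> s\<close> by auto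
      ultimately show False using t u by auto
    qed
    moreover have "f u \<in> {0..1}" using f(4) u t by (auto simp: image_subset_iff)
    ultimately show "y \<in> {0..s}" using u by auto
  qed
  moreover have "{0..s} \<subseteq> f ` {0..t}"
  proof
    fix y assume "y \<in> {0..s}"
    then show "y \<in> f ` {0..t}" using IVT'[of f 0 y t] f(2) t c[of t] by auto
  qed
  ultimately show thesis using that t by blast
qed

text \<open>Density at a single scale. The alternative of being close to the cube is unavoidable,
  since the approximating chain must itself rise from an arc to the cube.\<close>

lemma connected_chain_approximation:
  assumes c: "c \<in> topspace (connected_chains (top_of_set unit_cube))" and e: "e > 0"
  obtains c' where "c' \<in> topspace (connected_chains (top_of_set unit_cube))"
    "\<And>A. A \<in> c \<Longrightarrow> \<exists>A'\<in>c'. hausdorff_close e A A'"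
    "\<And>A'. A' \<in> c' \<Longrightarrow> \<exists>A\<in>c. hausdorff_close e A A'"
    "\<And>A'. A' \<in> c' \<Longrightarrow> hausdorff_close e unit_cube A' \<or>
        fine_chain e A' \<and> (\<forall>a b r s. e \<le> r \<longrightarrow> e \<le> s \<longrightarrow> indecomposable_at_scale a r b s A') \<and>
        (\<exists>f. continuous_on unit_cube f \<and> f ` unit_cube \<subseteq> unit_cube - A' \<and> (\<forall>x\<in>unit_cube. dist (f x) x < e))"
proof -
  \<comment> \<open>At most three errors of size \<open>\<epsilon>\<close> add up: in the
    crookedness estimate, two passages from \<open>h\<close> to
    \<open>\<gamma> \<circ> \<sigma>\<close> and one use of the continuity of
    \<open>\<gamma>\<close>.\<close>
  define \<epsilon> where "\<epsilon> = e / 4"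
  have \<epsilon>: "\<epsilon> > 0" using e by (simp add: \<epsilon>_def)
  obtain \<gamma> where \<gamma>: "path \<gamma>" "path_image \<gamma> \<subseteq> unit_cube"
    "\<And>t. t \<in> {0..1} \<Longrightarrow> \<exists>B\<in>c. hausdorff_close \<epsilon> (\<gamma> ` {0..t}) B"
    "\<And>B. B \<in> c \<Longrightarrow> \<exists>t\<in>{0..1}. hausdorff_close \<epsilon> (\<gamma> ` {0..t}) B"
    using connected_chain_followed_by_path[OF compact_unit_cube unit_cube_nonempty
        locally_path_connected_unit_cube c \<epsilon>] by metis
  have \<gamma>c: "continuous_on {0..1} \<gamma>" using \<gamma>(1) by (simp add: path_def)
  then have "uniformly_continuous_on {0..1} \<gamma>" by (intro compact_uniformly_continuous) auto
  then obtain d where d: "d > 0" "\<And>u v. u \<in> {0..1} \<Longrightarrow> v \<in> {0..1} \<Longrightarrow> dist v u < d \<Longrightarrow> dist (\<gamma> v) (\<gamma> u) < \<epsilon>"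
    unfolding uniformly_continuous_on_def using \<epsilon> by metis
  \<comment> \<open>The crookedness is matched to the modulus of continuity of
    \<open>\<gamma>\<close>; half of \<open>d\<close> turns the weak inequality of
    \<open>crooked_on\<close> into a strict one.\<close>
  obtain \<sigma> where \<sigma>: "continuous_on {0..1} \<sigma>" "\<sigma> 0 = 0" "\<sigma> 1 = (1::real)" "\<sigma> ` {0..1} \<subseteq> {0..1}" "crooked_on (d/2) \<sigma> 0 1"
    using crooked_exists[of "d/2"] d(1) by auto
  obtain N where N: "\<And>x y :: nat \<Rightarrow> real. (\<And>i. i < N \<Longrightarrow> x i = y i) \<Longrightarrow> dist x y < \<epsilon>"
    using dist_less_if_eq_initial[OF \<epsilon>] by blast
  \<comment> \<open>Coordinate \<open>N\<close> records the parameter and makes \<open>h\<close> an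
    arc; coordinate \<open>Suc N\<close> is kept at 0 as room for pushing off. By the choice of
    \<open>N\<close>, changing coordinates from \<open>N\<close> on moves points by less than
    \<open>\<epsilon>\<close>.\<close>
  define h where "h t = (\<lambda>i. if i = N then t else if i = Suc N then 0 else \<gamma> (\<sigma> t) i)" for t
  have hN: "h t N = t" for t by (simp add: h_def)
  have h\<gamma>: "dist (h t) (\<gamma> (\<sigma> t)) < \<epsilon>" for t by (rule N) (simp add: h_def)
  have \<sigma>I: "\<sigma> t \<in> {0..1}" if "t \<in> {0..1}" for t using \<sigma>(4) that by blast
  have \<gamma>\<sigma>: "continuous_on {0..1} (\<lambda>t. \<gamma> (\<sigma> t))"
    by (rule continuous_on_compose2[OF \<gamma>c \<sigma>(1,4)])
  have hc: "continuous_on {0..1} h"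
  proof (rule continuous_on_coordinatewise_then_product)
    fix i
    show "continuous_on {0..1} (\<lambda>t. h t i)"
      unfolding h_def using continuous_on_product_then_coordinatewise[OF \<gamma>\<sigma>, of i]
      by (cases "i = N"; cases "i = Suc N") (auto intro: continuous_intros)
  qed
  have hU: "h ` {0..1} \<subseteq> unit_cube"
  proof
    fix x assume "x \<in> h ` {0..1}"
    then obtain t where t: "t \<in> {0..1}" "x = h t" by blast
    have "\<gamma> (\<sigma> t) \<in> unit_cube" using \<gamma>(2) \<sigma>I[OF t(1)] unfolding path_image_def by blast
    then show "x \<in> unit_cube" using t unfolding unit_cube_def h_def by auto
  qed
  have close: "hausdorff_close \<epsilon> (h ` {0..t}) (\<gamma> ` (\<sigma> ` {0..t}))" for t
    unfolding image_image by (rule hausdorff_close_image) (rule h\<gamma>)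
  have close_c: "\<exists>B\<in>c. hausdorff_close e B (h ` {0..t})" if t: "t \<in> {0..1}" for t
  proof -
    obtain s where s: "s \<in> {0..1}" "\<sigma> ` {0..t} = {0..s}"
      using initial_image_of_segment_map[OF \<sigma>(1,2,4) t] by blast
    obtain B where B: "B \<in> c" "hausdorff_close \<epsilon> (\<gamma> ` {0..s}) B" using \<gamma>(3)[OF s(1)] by blast
    have "hausdorff_close (\<epsilon> + \<epsilon>) (h ` {0..t}) B"
      using close[of t] B(2) unfolding s(2) by (rule hausdorff_close_trans)
    then have "hausdorff_close e B (h ` {0..t})"
      using hausdorff_close_sym[OF hausdorff_close_mono, of "\<epsilon> + \<epsilon>" _ _ e] \<epsilon> by (simp add: \<epsilon>_def)
    then show ?thesis using B by blast
  qed
  have c_close: "\<exists>t\<in>{0..1}. hausdorff_close e B (h ` {0..t})" if B: "B \<in> c" for B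
  proof -
    obtain s where s: "s \<in> {0..1}" "hausdorff_close \<epsilon> (\<gamma> ` {0..s}) B" using \<gamma>(4)[OF B] by blast
    obtain t where t: "t \<in> {0..1}" "\<sigma> ` {0..t} = {0..s}"
      using initial_image_onto_segment[OF \<sigma>(1,2,3,4) s(1)] by blast
    have "hausdorff_close (\<epsilon> + \<epsilon>) (h ` {0..t}) B"
      using close[of t] s(2) unfolding t(2) by (rule hausdorff_close_trans)
    then have "hausdorff_close e B (h ` {0..t})"
      using hausdorff_close_sym[OF hausdorff_close_mono, of "\<epsilon> + \<epsilon>" _ _ e] \<epsilon> by (simp add: \<epsilon>_def)
    then show ?thesis using t by blast
  qed
  have X: "compact_space (top_of_set unit_cube)" "Hausdorff_space (top_of_set unit_cube)" "topspace (top_of_set unit_cube) \<noteq> {}"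
    using compact_unit_cube unit_cube_nonempty by (auto simp: compact_space_subtopology Hausdorff_space_subtopology)
  have top: "unit_cube \<in> c" using c by (simp add: in_connected_chains_iff[OF X])
  have crooked: "\<exists>u v. p \<le> u \<and> u \<le> v \<and> v \<le> q \<and> dist (h u) (h q) < e \<and> dist (h v) (h p) < e"
    if pq: "0 \<le> p" "p \<le> q" "q \<le> 1" for p q
  proof -
    have D: "dist (h u) (h v) < e" if uv: "u \<in> {0..1}" "v \<in> {0..1}" "\<bar>\<sigma> u - \<sigma> v\<bar> \<le> d/2" for u v
    proof -
      have "dist (\<sigma> u) (\<sigma> v) < d" using uv(3) d(1) by (simp add: dist_real_def)
      then have "dist (\<gamma> (\<sigma> u)) (\<gamma> (\<sigma> v)) < \<epsilon>" using d(2) \<sigma>I uv by blast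
      then show ?thesis
        using h\<gamma>[of u] h\<gamma>[of v] dist_triangle[of "h u" "h v" "\<gamma> (\<sigma> u)"] dist_triangle[of "\<gamma> (\<sigma> u)" "h v" "\<gamma> (\<sigma> v)"] \<epsilon>
        by (simp add: dist_commute \<epsilon>_def)
    qed
    obtain u v where "p \<le> u" "u \<le> v" "v \<le> q" "\<bar>\<sigma> u - \<sigma> q\<bar> \<le> d/2" "\<bar>\<sigma> v - \<sigma> p\<bar> \<le> d/2"
      using crooked_onE[OF \<sigma>(5) pq] by blast
    then show ?thesis using pq by (intro exI[of _ u] exI[of _ v] conjI D) auto
  qed
  have Z: "\<exists>f. continuous_on unit_cube f \<and> f ` unit_cube \<subseteq> unit_cube - h ` {0..t} \<and> (\<forall>x\<in>unit_cube. dist (f x) x < e)" for t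
  proof (intro exI conjI ballI)
    \<comment> \<open>The whole arc has coordinate \<open>Suc N\<close> equal to 0, so setting it to
      1 avoids every initial segment at once.\<close>
    let ?f = "\<lambda>x :: nat \<Rightarrow> real. (\<lambda>i. if i = Suc N then 1 else x i)"
    show "continuous_on unit_cube ?f"
    proof (rule continuous_on_coordinatewise_then_product)
      fix i
      have "continuous_on unit_cube (\<lambda>x :: nat \<Rightarrow> real. x i)"
        by (rule continuous_on_subset[OF continuous_on_product_coordinates]) simp
      then show "continuous_on unit_cube (\<lambda>x :: nat \<Rightarrow> real. if i = Suc N then 1 else x i)"
        by (cases "i = Suc N") auto
    qed
    have "?f x \<noteq> h u" for x u by (auto simp: h_def fun_eq_iff intro!: exI[of _ "Suc N"])
    then show "?f ` unit_cube \<subseteq> unit_cube - h ` {0..t}" by (auto simp: unit_cube_def)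
    fix x
    have "dist (?f x) x < \<epsilon>" by (rule N) simp
    then show "dist (?f x) x < e" using \<epsilon> by (simp add: \<epsilon>_def)
  qed
  show thesis
  proof (rule that)
    show "sweep h ` {0..2} \<in> topspace (connected_chains (top_of_set unit_cube))"
      using hc hU by (rule sweep_in_connected_chains)
    show "\<exists>A'\<in>sweep h ` {0..2}. hausdorff_close e A A'" if A: "A \<in> c" for A
    proof -
      obtain t where t: "t \<in> {0..1}" "hausdorff_close e A (h ` {0..t})" using c_close[OF A] by blast
      then have "hausdorff_close e A (sweep h t)" by (simp add: sweep_initial)
      then show ?thesis using t by force
    qed
    fix A' assume "A' \<in> sweep h ` {0..2}"
    then obtain \<tau> where \<tau>: "0 \<le> \<tau>" "\<tau> \<le> 2" "A' = sweep h \<tau>" by auto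
    \<comment> \<open>The cube is a member of \<open>c\<close>, so some \<open>h\<close>-image of
      \<open>{0..t}\<close> is already \<open>e\<close>-close to it, and the later sets of the sweep
      only grow within the cube.\<close>
    have large: "hausdorff_close e unit_cube A'" if "1 \<le> \<tau>"
    proof -
      obtain t where t: "t \<in> {0..1}" "hausdorff_close e unit_cube (h ` {0..t})" using c_close[OF top] by blast
      have "h ` {0..t} \<subseteq> A'"
        using sweep_mono[OF hU, of t \<tau>] sweep_initial[of t h] t that \<tau> by auto
      moreover have "A' \<subseteq> unit_cube" using sweep_subset[OF hU] \<tau> by simp
      ultimately show ?thesis
        using t(2) e unfolding hausdorff_close_def by (metis dist_self subsetD)
    qed
    show "\<exists>A\<in>c. hausdorff_close e A A'"
    proof (cases "\<tau> \<le> 1")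
      case True
      then show ?thesis using close_c[of \<tau>] \<tau> sweep_initial[of \<tau> h] by auto
    next
      case False
      then show ?thesis using large top by force
    qed
    show "hausdorff_close e unit_cube A' \<or>
        fine_chain e A' \<and> (\<forall>a b r s. e \<le> r \<longrightarrow> e \<le> s \<longrightarrow> indecomposable_at_scale a r b s A') \<and>
        (\<exists>f. continuous_on unit_cube f \<and> f ` unit_cube \<subseteq> unit_cube - A' \<and> (\<forall>x\<in>unit_cube. dist (f x) x < e))"
    proof (cases "\<tau> \<le> 1")
      case True
      then have A': "A' = h ` {0..\<tau>}" using sweep_initial \<tau> by simp
      have "indecomposable_at_scale a r b s A'" if "e \<le> r" "e \<le> s" for a b r s
        unfolding A' by (rule arc_indecomposable_at_scale[where h = h, OF hN crooked that True])
      then show ?thesis using arc_fine_chain[where h = h, OF hc hN e True] Z[of \<tau>] unfolding A' by blast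
    next
      case False
      then show ?thesis using large by simp
    qed
  qed
qed

section \<open>The generic connected chain\<close>

lemma fine_chain_mono:
  assumes "fine_chain e A" "e \<le> e'"
  shows "fine_chain e' A"
proof -
  obtain m and U :: "nat \<Rightarrow> 'a set" where U: "\<forall>i<m. open (U i)" "\<forall>i<m. \<forall>x\<in>U i. \<forall>y\<in>U i. dist x y < e"
     "\<forall>i<m. \<forall>j<m. U i \<inter> U j \<noteq> {} \<longrightarrow> \<bar>int i - int j\<bar> \<le> 1" "A \<subseteq> (\<Union>i<m. U i)"
    using assms(1) unfolding fine_chain_def by blast
  moreover have "\<forall>i<m. \<forall>x\<in>U i. \<forall>y\<in>U i. dist x y < e'"
    using U(2) assms(2) less_le_trans by blast
  ultimately show ?thesis unfolding fine_chain_def by (intro exI[of _ m] exI[of _ U] conjI)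
qed

text \<open>Uniform continuity of the identity from \<open>dist\<close> to \<open>d\<close>, by a
  Lebesgue number for the cover by \<open>d\<close>-balls of radius \<open>e/2\<close>. It transfers
  the small push found for \<open>dist\<close> to the arbitrary compatible metric.\<close>

lemma compatible_metric_uniform:
  fixes S :: "'a::metric_space set"
  assumes M: "Metric_space S d" "Metric_space.mtopology S d = top_of_set S" and S: "compact S" and e: "e > 0"
  obtains \<delta> where "\<delta> > 0" "\<And>x y. x \<in> S \<Longrightarrow> y \<in> S \<Longrightarrow> dist x y < \<delta> \<Longrightarrow> d x y < e"
proof -
  interpret Metric_space S d by (rule M(1))
  let ?\<G> = "{T. open T \<and> (\<exists>z\<in>S. S \<inter> T = mball z (e/2))}"
  have "S \<subseteq> \<Union>?\<G>"
  proof
    fix z assume z: "z \<in> S"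
    have "openin (top_of_set S) (mball z (e/2))" using openin_mball[of z "e/2"] M(2) by simp
    then obtain T where T: "open T" "mball z (e/2) = S \<inter> T" unfolding openin_open by blast
    have "z \<in> mball z (e/2)" using z e by simp
    then have "z \<in> T" using T(2) by blast
    then show "z \<in> \<Union>?\<G>" using T z by auto
  qed
  then obtain \<delta> where \<delta>: "\<delta> > 0" "\<And>x. x \<in> S \<Longrightarrow> \<exists>G\<in>?\<G>. ball x \<delta> \<subseteq> G"
    using Heine_Borel_lemma[OF S, of ?\<G>] by (metis (no_types, lifting) mem_Collect_eq)
  have "d x y < e" if xy: "x \<in> S" "y \<in> S" "dist x y < \<delta>" for x y
  proof -
    obtain T z where T: "ball x \<delta> \<subseteq> T" "z \<in> S" "S \<inter> T = mball z (e/2)" using \<delta>(2)[OF xy(1)] by blast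
    have "x \<in> ball x \<delta>" "y \<in> ball x \<delta>" using \<delta>(1) xy(3) by auto
    then have "x \<in> S \<inter> T" "y \<in> S \<inter> T" using T(1) xy(1,2) by auto
    then have "d z x < e/2" "d z y < e/2" unfolding T(3) by auto
    then show ?thesis using triangle[OF xy(1) T(2) xy(2)] commute[of x z] by simp
  qed
  then show thesis using that \<delta>(1) by blast
qed

text \<open>One scale of the Z-set condition. Keeping \<open>X\<close> as codomain and asking for
  disjointness from \<open>A\<close> frees the map from \<open>A\<close>, so that one map can serve
  many sets.\<close>

definition pushed_off :: "'a topology \<Rightarrow> ('a \<Rightarrow> 'a \<Rightarrow> real) \<Rightarrow> real \<Rightarrow> 'a set \<Rightarrow> bool" where
  "pushed_off X d e A \<longleftrightarrow> (\<exists>f. continuous_map X X f \<and> f ` topspace X \<inter> A = {} \<and> (\<forall>x\<in>topspace X. d (f x) x < e))"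

text \<open>The image of a map on the compact space is closed, so a map that avoids \<open>A\<close>
  avoids all sets near \<open>A\<close> too; the union over all admissible maps is open.\<close>

lemma openin_pushed_off:
  assumes X: "compact_space X" "Hausdorff_space X"
  shows "openin (vietoris X) {A \<in> vietoris_points X. pushed_off X d e A}"
proof -
  let ?F = "{f. continuous_map X X f \<and> (\<forall>x\<in>topspace X. d (f x) x < e)}"
  have "openin (vietoris X) {A \<in> vietoris_points X. A \<subseteq> topspace X - f ` topspace X}" if "f \<in> ?F" for f
  proof -
    have "compactin X (f ` topspace X)"
      using that X image_compactin by (fastforce simp: compact_space_def)
    then have "closedin X (f ` topspace X)" using X(2) by (simp add: compactin_imp_closedin)
    then show ?thesis by (intro openin_vietoris_subset openin_diff) auto
  qed
  then have "openin (vietoris X) (\<Union>f\<in>?F. {A \<in> vietoris_points X. A \<subseteq> topspace X - f ` topspace X})"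
    by blast
  moreover have "(\<Union>f\<in>?F. {A \<in> vietoris_points X. A \<subseteq> topspace X - f ` topspace X}) = {A \<in> vietoris_points X. pushed_off X d e A}"
    (is "?l = ?r")
  proof (intro subset_antisym subsetI)
    fix A assume "A \<in> ?l"
    then obtain f where f: "f \<in> ?F" "A \<in> vietoris_points X" "A \<subseteq> topspace X - f ` topspace X" by blast
    then have "f ` topspace X \<inter> A = {}" by blast
    then show "A \<in> ?r" using f(1,2) unfolding pushed_off_def by blast
  next
    fix A assume A: "A \<in> ?r"
    then obtain f where f: "f \<in> ?F" "f ` topspace X \<inter> A = {}" unfolding pushed_off_def by blast
    then have "A \<subseteq> topspace X - f ` topspace X" using A vietoris_points_subset_topspace[of A X] by blast
    then show "A \<in> ?l" using A f by blast
  qed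
  ultimately show ?thesis by simp
qed

lemma Z_set_iff_pushed_off:
  assumes "closedin X A"
  shows "Z_set X d A \<longleftrightarrow> (\<forall>n. pushed_off X d (1 / Suc n) A)"
proof -
  have *: "(\<exists>f. continuous_map X (subtopology X (topspace X - A)) f \<and> (\<forall>x \<in> topspace X. d (f x) x < e)) \<longleftrightarrow> pushed_off X d e A" for e
    unfolding pushed_off_def continuous_map_in_subtopology
    by (intro ex_cong1) (auto dest: continuous_map_image_subset_topspace simp: Pi_iff)
  have "pushed_off X d e A" if h: "\<forall>n. pushed_off X d (1 / Suc n) A" "e > 0" for e
  proof -
    obtain n where "1 / real (Suc n) < e" using nat_approx_posE[OF h(2)] by blast
    then show ?thesis using h(1) unfolding pushed_off_def by (meson less_trans)
  qed
  then show ?thesis unfolding Z_set_def * using assms by (metis of_nat_0_less_iff zero_less_Suc zero_less_divide_1_iff)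
qed

theorem proposition3p6:
  fixes d :: "(nat \<Rightarrow> real) \<Rightarrow> (nat \<Rightarrow> real) \<Rightarrow> real"
    and S :: "(nat \<Rightarrow> real) set set set"
  assumes "Metric_space (topspace hilbert_cube) d"
    and "Metric_space.mtopology (topspace hilbert_cube) d = hilbert_cube"
  defines "S \<equiv> {c \<in> topspace (connected_chains hilbert_cube).
      \<forall>A \<in> c - {topspace hilbert_cube}.
        continuum (subtopology hilbert_cube A) \<and>
        chainable (subtopology hilbert_cube A) \<and>
        hereditarily_indecomposable (subtopology hilbert_cube A) \<and>
        Z_set hilbert_cube d A}"
  shows "gdelta_in (connected_chains hilbert_cube) S \<and>
    connected_chains hilbert_cube closure_of S = topspace (connected_chains hilbert_cube)"
proof -
  let ?Q = "top_of_set unit_cube"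
  let ?C = "connected_chains ?Q" and ?V = "vietoris ?Q" and ?VP = "vietoris_points ?Q"
  note Q = hilbert_cube_eq
  have X: "compact_space ?Q" "Hausdorff_space ?Q" "topspace ?Q \<noteq> {}"
    using compact_unit_cube unit_cube_nonempty by (auto simp: compact_space_subtopology Hausdorff_space_subtopology)
  have m: "Metric_space unit_cube d" "Metric_space.mtopology unit_cube d = ?Q"
    using assms(1,2) by (simp_all add: Q)
  obtain D :: "(nat \<Rightarrow> real) set" where D: "countable D" "\<And>U. open U \<Longrightarrow> U \<noteq> {} \<Longrightarrow> \<exists>a\<in>D. a \<in> U"
    using countable_dense_exists by meson

  \<comment> \<open>Countably many open conditions on the members of a chain\<close>
  define W1 where "W1 n = {A \<in> ?VP. fine_chain (1 / Suc n) A}" for n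
  define W2 where "W2 = (\<lambda>(a, b, n, m). {A \<in> ?VP. indecomposable_at_scale a (1 / Suc n) b (1 / Suc m) A})"
  define W3 where "W3 n = {A \<in> ?VP. pushed_off ?Q d (1 / Suc n) A}" for n
  define \<W> where "\<W> = range W1 \<union> W2 ` (D \<times> D \<times> UNIV \<times> UNIV) \<union> range W3"
  have cW: "countable \<W>" unfolding \<W>_def using D(1) by (intro countable_Un countable_image countable_SIGMA) auto
  have oW: "openin ?V W" if "W \<in> \<W>" for W
    using that openin_fine_chain[of unit_cube] openin_indecomposable_at_scale[OF compact_unit_cube] openin_pushed_off[OF X(1,2)]
    unfolding \<W>_def W1_def W2_def W3_def by auto
  have char: "continuum (subtopology ?Q A) \<and> chainable (subtopology ?Q A) \<and>
      hereditarily_indecomposable (subtopology ?Q A) \<and> Z_set ?Q d A \<longleftrightarrow> (\<forall>W\<in>\<W>. A \<in> W)"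
    if A: "A \<in> ?VP" "connected A" for A
  proof -
    have A': "compact A" "A \<subseteq> unit_cube" "A \<noteq> {}" using A(1) by (auto simp: vietoris_points_top_of_set)
    have eq: "subtopology ?Q A = top_of_set A" using A'(2) by (simp add: subtopology_subtopology inf.absorb2)
    have "continuum (top_of_set A)" using A A' by (simp add: continuum_top_of_set)
    moreover have "chainable (top_of_set A) \<longleftrightarrow> (\<forall>n. A \<in> W1 n)"
    proof
      assume "chainable (top_of_set A)"
      then show "\<forall>n. A \<in> W1 n" unfolding W1_def using A(1) by (auto intro: chainable_imp_fine_chain)
    next
      assume h: "\<forall>n. A \<in> W1 n"
      have "\<exists>e'\<le>e. fine_chain e' A" if e: "e > 0" for e
      proof -
        obtain n where "1 / real (Suc n) < e" using nat_approx_posE[OF e] by blast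
        then show ?thesis using h unfolding W1_def by (intro exI[of _ "1 / real (Suc n)"]) auto
      qed
      then show "chainable (top_of_set A)" using A A' by (intro fine_chain_imp_chainable)
    qed
    moreover have "hereditarily_indecomposable (top_of_set A) \<longleftrightarrow> (\<forall>p \<in> D \<times> D \<times> UNIV \<times> UNIV. A \<in> W2 p)"
      using hereditarily_indecomposable_iff_at_scale[OF D(2), of A] A(1) unfolding W2_def by auto
    moreover have "closedin ?Q A" using A'(1,2) by (simp add: closed_subset compact_imp_closed)
    then have "Z_set ?Q d A \<longleftrightarrow> (\<forall>n. A \<in> W3 n)" using A(1) unfolding W3_def by (simp add: Z_set_iff_pushed_off)
    ultimately show ?thesis unfolding eq \<W>_def by blast
  qed
  \<comment> \<open>What the approximation delivers at one scale, with the push still measured by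
    \<open>dist\<close>. By \<open>thr\<close>, each single condition \<open>W\<close> follows from
    goodness at all sufficiently small scales.\<close>
  define good where "good e A \<longleftrightarrow> fine_chain e A \<and>
      (\<forall>a b r s. e \<le> r \<longrightarrow> e \<le> s \<longrightarrow> indecomposable_at_scale a r b s A) \<and>
      (\<exists>f. continuous_on unit_cube f \<and> f ` unit_cube \<subseteq> unit_cube - A \<and> (\<forall>x\<in>unit_cube. dist (f x) x < e))" for e A
  have thr: "\<exists>e0>0. \<forall>e A. e \<le> e0 \<longrightarrow> A \<in> ?VP \<longrightarrow> good e A \<longrightarrow> A \<in> W"
    if W: "W \<in> \<W>" for W
  proof -
    consider n where "W = W1 n" | a b n m where "W = W2 (a, b, n, m)" | n where "W = W3 n"
      using W unfolding \<W>_def by blast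
    then show ?thesis
    proof cases
      case (1 n)
      have "A \<in> W1 n" if "e \<le> 1 / Suc n" "A \<in> ?VP" "good e A" for e A
        using that fine_chain_mono[of e A "1 / Suc n"] unfolding W1_def good_def by blast
      then show ?thesis unfolding 1 by (intro exI[of _ "1 / real (Suc n)"]) simp
    next
      case (2 a b n m)
      have "A \<in> W2 (a, b, n, m)" if "e \<le> min (1 / Suc n) (1 / Suc m)" "A \<in> ?VP" "good e A" for e A
        using that unfolding W2_def good_def by simp
      then show ?thesis unfolding 2
        by (intro exI[of _ "min (1 / real (Suc n)) (1 / real (Suc m))"]) simp
    next
      case (3 n)
      obtain \<delta> where \<delta>: "\<delta> > 0" "\<And>x y. x \<in> unit_cube \<Longrightarrow> y \<in> unit_cube \<Longrightarrow> dist x y < \<delta> \<Longrightarrow> d x y < 1 / real (Suc n)"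
        using compatible_metric_uniform[OF m compact_unit_cube, of "1 / real (Suc n)"] by auto
      have "A \<in> W3 n" if "e \<le> \<delta>" "A \<in> ?VP" "good e A" for e A
      proof -
        obtain f where f: "continuous_on unit_cube f" "f ` unit_cube \<subseteq> unit_cube - A" "\<forall>x\<in>unit_cube. dist (f x) x < e"
          using \<open>good e A\<close> unfolding good_def by blast
        have 1: "continuous_map ?Q ?Q f" using f by (auto simp: image_subset_iff)
        have 2: "f ` topspace ?Q \<inter> A = {}" using f(2) by auto
        have 3: "\<forall>x\<in>topspace ?Q. d (f x) x < 1 / Suc n"
        proof
          fix x assume "x \<in> topspace ?Q"
          then have x: "x \<in> unit_cube" by simp
          show "d (f x) x < 1 / Suc n"
          proof (rule \<delta>(2))
            show "f x \<in> unit_cube" using f(2) x by blast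
            show "dist (f x) x < \<delta>" using f(3) x \<open>e \<le> \<delta>\<close> by force
          qed (rule x)
        qed
        have "pushed_off ?Q d (1 / Suc n) A" unfolding pushed_off_def using 1 2 3 by (intro exI[of _ f] conjI)
        then show ?thesis using that(2) unfolding W3_def by blast
      qed
      then show ?thesis unfolding 3 using \<delta>(1) by (intro exI[of _ \<delta>]) blast
    qed
  qed

  \<comment> \<open>Countably many dense open sets of chains\<close>
  define B where "B = {(a, k). a \<in> D \<and> ball a (1 / Suc k) \<inter> unit_cube \<noteq> {}}"
  \<comment> \<open>Every member must satisfy \<open>W\<close> or meet the ball. Both alternatives
    are open, so this is a Vietoris condition of the form \<open>c \<subseteq> ?Y\<close>, and the
    cube passes it through the second one, since the balls of \<open>B\<close> meet the
    cube.\<close>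
  define \<O> where "\<O> = (\<lambda>((a, k :: nat), W). {c \<in> topspace ?C. c \<subseteq> W \<union> {A \<in> ?VP. A \<inter> (unit_cube \<inter> ball a (1 / Suc k)) \<noteq> {}}})"
  have inO: "c \<in> \<O> ((a, k), W) \<longleftrightarrow> c \<in> topspace ?C \<and>
      (\<forall>A\<in>c. A \<in> W \<union> {A \<in> ?VP. A \<inter> (unit_cube \<inter> ball a (1 / Suc k)) \<noteq> {}})" for c a k W
    unfolding \<O>_def by (simp add: subset_iff Ball_def)
  have "countable (B \<times> \<W>)"
    using countable_subset[of B "D \<times> UNIV"] D(1) cW unfolding B_def by auto
  then have cO: "countable (\<O> ` (B \<times> \<W>))" by blast
  \<comment> \<open>The intersection over an empty family would be the universal set and not a set
    of chains. The witness uses \<open>k = 0\<close>, that is, radius 1.\<close>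
  have "B \<times> \<W> \<noteq> {}"
  proof -
    obtain z where z: "z \<in> unit_cube" using unit_cube_nonempty by blast
    obtain a where "a \<in> D" "a \<in> ball z 1" using D(2)[of "ball z 1"] by auto
    then have "(a, 0) \<in> B" using z unfolding B_def by (auto simp: dist_commute)
    then show ?thesis unfolding \<W>_def by blast
  qed
  then have neO: "\<O> ` (B \<times> \<W>) \<noteq> {}" by blast
  have opO: "openin ?C T" if T: "T \<in> \<O> ` (B \<times> \<W>)" for T
  proof -
    obtain a k W where aW: "(a, k) \<in> B" "W \<in> \<W>" "T = \<O> ((a, k), W)" using T by auto
    let ?Y = "W \<union> {A \<in> ?VP. A \<inter> (unit_cube \<inter> ball a (1 / Suc k)) \<noteq> {}}"
    have "openin ?V ?Y" using oW[OF aW(2)] by (intro openin_Un openin_vietoris_meets openin_open_Int) auto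
    then have "openin (vietoris ?V) {c \<in> vietoris_points ?V. c \<subseteq> ?Y}" by (rule openin_vietoris_subset)
    then have "openin ?C (topspace ?C \<inter> {c \<in> vietoris_points ?V. c \<subseteq> ?Y})"
      by (subst connected_chains_eq_subtopology) (rule openin_subtopology_Int2)
    moreover have "topspace ?C \<inter> {c \<in> vietoris_points ?V. c \<subseteq> ?Y} = T"
      unfolding aW(3) \<O>_def using in_connected_chains_iff[OF X] by auto
    ultimately show ?thesis by simp
  qed
  have denseO: "?C closure_of T = topspace ?C" if T: "T \<in> \<O> ` (B \<times> \<W>)" for T
    unfolding dense_intersects_open
  proof (intro allI impI)
    fix G assume G: "openin ?C G \<and> G \<noteq> {}"
    obtain a k W where aW: "(a, k) \<in> B" "W \<in> \<W>" "T = \<O> ((a, k), W)" using T by auto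
    obtain N where N: "openin (vietoris ?V) N" "G = N \<inter> topspace ?C"
      using G connected_chains_eq_subtopology[of ?Q] by (metis openin_subtopology)
    obtain c where c: "c \<in> N" "c \<in> topspace ?C" using G N(2) by blast
    obtain e1 where e1: "e1 > 0" "\<forall>c'\<in>vietoris_points ?V.
        (\<forall>A\<in>c. \<exists>A'\<in>c'. hausdorff_close e1 A A') \<longrightarrow> (\<forall>A'\<in>c'. \<exists>A\<in>c. hausdorff_close e1 A A') \<longrightarrow> c' \<in> N"
      using vietoris2_open_imp_hausdorff_close[OF N(1) c(1)] by blast
    obtain e2 where e2: "e2 > 0" "\<And>e A. e \<le> e2 \<Longrightarrow> A \<in> ?VP \<Longrightarrow> good e A \<Longrightarrow> A \<in> W"
      using thr[OF aW(2)] by blast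
    obtain z where z: "z \<in> unit_cube" "z \<in> ball a (1 / Suc k)" using aW(1) unfolding B_def by blast
    then obtain e3 where e3: "e3 > 0" "ball z e3 \<subseteq> ball a (1 / Suc k)" using open_contains_ball open_ball by meson
    \<comment> \<open>The bound \<open>e1\<close> keeps \<open>c'\<close> in the neighbourhood
      \<open>N\<close>, \<open>e2\<close> puts the good members into \<open>W\<close>, and
      \<open>e3\<close> makes the members close to the cube meet the ball.\<close>
    define e where "e = min e1 (min e2 e3)"
    have e: "e > 0" "e \<le> e1" "e \<le> e2" "e \<le> e3" using e1(1) e2(1) e3(1) unfolding e_def by auto
    obtain c' where c': "c' \<in> topspace ?C"
      "\<And>A. A \<in> c \<Longrightarrow> \<exists>A'\<in>c'. hausdorff_close e A A'"
      "\<And>A'. A' \<in> c' \<Longrightarrow> \<exists>A\<in>c. hausdorff_close e A A'"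
      "\<And>A'. A' \<in> c' \<Longrightarrow> hausdorff_close e unit_cube A' \<or> good e A'"
      using connected_chain_approximation[OF c(2) e(1)] unfolding good_def by blast
    have "c' \<in> vietoris_points ?V" using c'(1) in_connected_chains_iff[OF X] by blast
    moreover have "\<forall>A\<in>c. \<exists>A'\<in>c'. hausdorff_close e1 A A'" "\<forall>A'\<in>c'. \<exists>A\<in>c. hausdorff_close e1 A A'"
      using c'(2,3) hausdorff_close_mono[OF _ e(2)] by meson+
    ultimately have "c' \<in> N" using e1(2) by blast
    then have "c' \<in> G" using N(2) c'(1) by blast
    moreover have "c' \<in> T"
    proof -
      have "A \<in> W \<union> {A \<in> ?VP. A \<inter> (unit_cube \<inter> ball a (1 / Suc k)) \<noteq> {}}" if A: "A \<in> c'" for A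
      proof -
        have AV: "A \<in> ?VP" using connected_chains_members[OF X c'(1)] A by blast
        from c'(4)[OF A] show ?thesis
        proof
          assume "hausdorff_close e unit_cube A"
          then obtain y where y: "y \<in> A" "dist z y < e" using z(1) unfolding hausdorff_close_def by blast
          then have "y \<in> ball z e3" using e(4) by simp
          then have "y \<in> A \<inter> (unit_cube \<inter> ball a (1 / Suc k))"
            using y(1) e3(2) AV unfolding vietoris_points_top_of_set by blast
          then show ?thesis using AV by blast
        qed (use e2(2)[OF e(3) AV] in blast)
      qed
      then show ?thesis unfolding aW(3) inO using c'(1) by blast
    qed
    ultimately show "T \<inter> G \<noteq> {}" by blast
  qed

  \<comment> \<open>The intersection of these sets is \<open>S\<close>\<close>
  have memS: "c \<in> S \<longleftrightarrow> c \<in> topspace ?C \<and> (\<forall>A\<in>c. A \<noteq> unit_cube \<longrightarrow> (\<forall>W\<in>\<W>. A \<in> W))" for c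
  proof (cases "c \<in> topspace ?C")
    case True
    have "A \<in> ?VP" "connected A" if "A \<in> c" for A
      using connected_chains_members[OF X True] connected_chains_member_connected[OF X True that] that
      by (auto simp: connectedin_subtopology)
    then have "(\<forall>A\<in>c - {unit_cube}. continuum (subtopology ?Q A) \<and> chainable (subtopology ?Q A) \<and>
      hereditarily_indecomposable (subtopology ?Q A) \<and> Z_set ?Q d A) \<longleftrightarrow> (\<forall>A\<in>c - {unit_cube}. \<forall>W\<in>\<W>. A \<in> W)"
      by (intro ball_cong refl char) auto
    then show ?thesis using True unfolding S_def Q by auto
  qed (simp add: S_def Q)
  have S: "S = \<Inter>(\<O> ` (B \<times> \<W>))"
  proof (intro subset_antisym subsetI)
    fix c assume "c \<in> S"
    then have c: "c \<in> topspace ?C" and cS: "\<And>A. A \<in> c \<Longrightarrow> A \<noteq> unit_cube \<Longrightarrow> \<forall>W\<in>\<W>. A \<in> W"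
      unfolding memS by blast+
    have "c \<in> \<O> ((a, k), W)" if "(a, k) \<in> B" "W \<in> \<W>" for a k W
    proof -
      have "A \<in> W \<union> {A \<in> ?VP. A \<inter> (unit_cube \<inter> ball a (1 / Suc k)) \<noteq> {}}" if "A \<in> c" for A
        using cS[OF that] connected_chains_members[OF X c] that \<open>(a, k) \<in> B\<close> \<open>W \<in> \<W>\<close>
        unfolding B_def by (cases "A = unit_cube") auto
      then show ?thesis unfolding inO using c by blast
    qed
    then show "c \<in> \<Inter>(\<O> ` (B \<times> \<W>))" by auto
  next
    fix c assume c: "c \<in> \<Inter>(\<O> ` (B \<times> \<W>))"
    then have cC: "c \<in> topspace ?C" using neO unfolding \<O>_def by auto
    have "\<forall>W\<in>\<W>. A \<in> W" if A: "A \<in> c" "A \<noteq> unit_cube" for A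
    proof
      fix W assume W: "W \<in> \<W>"
      have "A \<in> ?VP" using connected_chains_members[OF X cC] A by blast
      then have A': "compact A" "A \<subseteq> unit_cube" by (auto simp: vietoris_points_top_of_set)
      then obtain z where z: "z \<in> unit_cube" "z \<in> - A" using A(2) by blast
      have "open (- A)" using A'(1) by (simp add: compact_imp_closed open_Compl)
      then obtain r where r: "r > 0" "ball z r \<subseteq> - A" using z(2) open_contains_ball by meson
      \<comment> \<open>A member other than the cube misses a ball about some \<open>z\<close>; a
        ball with centre in \<open>D\<close>, whose radius and whose centre's distance from
        \<open>z\<close> are both below \<open>r / 2\<close>, fits inside it and belongs to
        \<open>B\<close>, so \<open>W\<close> cannot be escaped.\<close>
      obtain k where k: "1 / real (Suc k) < r / 2" using nat_approx_posE[of "r/2"] r(1) by auto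
      obtain a where a: "a \<in> D" "dist z a < 1 / real (Suc k)" using D(2)[of "ball z (1 / real (Suc k))"] by auto
      have "ball a (1 / real (Suc k)) \<subseteq> ball z r"
      proof
        fix y assume "y \<in> ball a (1 / real (Suc k))"
        then show "y \<in> ball z r" using a(2) k dist_triangle[of z y a] by simp
      qed
      then have "A \<inter> (unit_cube \<inter> ball a (1 / Suc k)) = {}" using r(2) by blast
      moreover have "(a, k) \<in> B" unfolding B_def using a z(1) by (auto simp: dist_commute)
      then have "c \<in> \<O> ((a, k), W)" using c W by blast
      ultimately show "A \<in> W" using A(1) unfolding inO by blast
    qed
    then show "c \<in> S" unfolding memS using cC by blast
  qed
  have "gdelta_in ?C S"
    unfolding S using cO neO opO open_imp_gdelta_in by (intro gdelta_in_Inter) blast+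
  moreover have "compact_space ?C" "regular_space ?C"
    using compact_space_connected_chains[OF X] Hausdorff_space_connected_chains[OF X]
    by (auto intro: compact_Hausdorff_imp_regular_space)
  then have "?C closure_of S = topspace ?C"
    unfolding S using cO opO denseO by (intro Baire_category) (auto intro: compact_imp_locally_compact_space)
  ultimately show ?thesis unfolding Q by blast
qed

end
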